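(* Let $n\ge1$, $\eta_n=\sqrt{(n+1)/n}$, and let $\phi:[a,+\infty)\to[b,+\infty)$ be a bijection such that $\phi$ and $\eta_n^2\,\mathrm{id}-\phi$ are increasing. Define $$\mathcal R^{1n}_\phi=\{\mathbf u\in U_+(r_1): -f_{\bar r_n}(\mathrm{pr}(r_1(t)[\mathbf u]))\ge\tfrac1n t-\phi(t)\text{ for arbitrarily large }t\},$$ $$\mathcal R^{n1}_\phi=\{\mathbf u\in U_+(r_n): -f_{\bar r_1}(\mathrm{pr}(r_n(t)[\mathbf u]))\ge\tfrac1n t-\phi(t)\text{ for arbitrarily large }t\}.$$ Then for $\{i,j\}=\{1,n\}$ and every $s\in(n-1,n)$, $$\mathcal H^s(\mathcal R^{ij}_\phi)=\begin{cases}0,&\text{if }\sum_{k=1}^\infty k^n e^{-(s-n+1)\frac{\eta_n}{2}\phi^{-1}(2\eta_n\ln k)}<\infty,\\ \infty,&\text{if }\sum_{k=1}^\infty k^n e^{-(s-n+1)\frac{\eta_n}{2}\phi^{-1}(2\eta_n\ln k)}=\infty.\end{cases}$$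
   Context: $\mathcal P_{n+1}$ is the space of positive definite quadratic forms on $\mathbb R^{n+1}$ of determinant $1$, with metric $d(Q_1,Q_2)=(\sum(\ln\lambda_i)^2)^{1/2}$ ($\lambda_i$ eigenvalues of $Q_2$ relative to $Q_1$); $SL(n+1,\mathbb R)$ acts on the right by $Q[B]=Q\circ B$. $\mathcal T_{n+1}=\mathcal P_{n+1}/SL(n+1,\mathbb Z)$, $\mathrm{pr}$ the projection. $r_1(t)=\mathrm{diag}(e^{t/\sqrt{n(n+1)}},\dots,e^{t/\sqrt{n(n+1)}},e^{-t\sqrt{n/(n+1)}})$, $r_n(t)=\mathrm{diag}(e^{t\sqrt{n/(n+1)}},e^{-t/\sqrt{n(n+1)}},\dots,e^{-t/\sqrt{n(n+1)}})$, $t\ge0$; $\bar r_i=\mathrm{pr}\circ r_i$, with Busemann function $f_{\bar r_i}(x)=\lim_{t\to\infty}(\mathrm{dist}(x,\bar r_i(t))-t)$. $U_+(r_1)=\{\begin{pmatrix}\mathrm{Id}_n&\bar x\\0&1\end{pmatrix}\}$, $U_+(r_n)=\{\begin{pmatrix}1&\bar x^T\\0&\mathrm{Id}_n\end{pmatrix}\}$, $\bar x\in\mathbb R^n$, identified with Euclidean $\mathbb R^n$ via $\bar x$. *)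

theory Defs
  imports "HOL-Analysis.Analysis" "HOL-Combinatorics.Permutations"
          "HOL-Computational_Algebra.Polynomial"
begin

text \<open>Matrices of size N are functions nat => nat => _ ; only indices < N matter.
  The index set {0..n} of R^(n+1) is used, so coordinate 0 is the first and n the last.\<close>

definition detN :: "nat \<Rightarrow> (nat \<Rightarrow> nat \<Rightarrow> 'a::comm_ring_1) \<Rightarrow> 'a" where
  "detN N A = (\<Sum>p | p permutes {..<N}. of_int (sign p) * (\<Prod>i<N. A i (p i)))"

definition posdef_form :: "nat \<Rightarrow> (nat \<Rightarrow> nat \<Rightarrow> real) \<Rightarrow> bool" where
  "posdef_form N Q \<longleftrightarrow> (\<forall>i j. Q i j = Q j i) \<and> (\<forall>i j. \<not>(i < N \<and> j < N) \<longrightarrow> Q i j = 0) \<and>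
     (\<forall>v::nat\<Rightarrow>real. (\<exists>i<N. v i \<noteq> 0) \<longrightarrow> (\<Sum>i<N. \<Sum>j<N. v i * Q i j * v j) > 0)"

definition PN :: "nat \<Rightarrow> (nat \<Rightarrow> nat \<Rightarrow> real) set" where
  "PN N = {Q. posdef_form N Q \<and> detN N Q = 1}"

text \<open>Polynomial det(Q2 - X Q1); its roots are the eigenvalues of Q2 relative to Q1.\<close>
definition rel_charpoly :: "nat \<Rightarrow> (nat \<Rightarrow> nat \<Rightarrow> real) \<Rightarrow> (nat \<Rightarrow> nat \<Rightarrow> real) \<Rightarrow> real poly" where
  "rel_charpoly N Q1 Q2 = detN N (\<lambda>i j. [:Q2 i j, - Q1 i j:])"

definition pdist :: "nat \<Rightarrow> (nat \<Rightarrow> nat \<Rightarrow> real) \<Rightarrow> (nat \<Rightarrow> nat \<Rightarrow> real) \<Rightarrow> real" where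
  "pdist N Q1 Q2 = sqrt (\<Sum>\<mu>\<in>{\<mu>::real. poly (rel_charpoly N Q1 Q2) \<mu> = 0}.
       real (order \<mu> (rel_charpoly N Q1 Q2)) * (ln \<mu>)\<^sup>2)"

definition act :: "nat \<Rightarrow> (nat \<Rightarrow> nat \<Rightarrow> real) \<Rightarrow> (nat \<Rightarrow> nat \<Rightarrow> real) \<Rightarrow> (nat \<Rightarrow> nat \<Rightarrow> real)" where
  "act N Q B = (\<lambda>i j. if i < N \<and> j < N then (\<Sum>k<N. \<Sum>l<N. B k i * Q k l * B l j) else 0)"

definition SLZ :: "nat \<Rightarrow> (nat \<Rightarrow> nat \<Rightarrow> real) set" where
  "SLZ N = {B. (\<forall>i<N. \<forall>j<N. B i j \<in> \<int>) \<and> detN N B = 1}"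

text \<open>Projection P_N -> T_N = P_N / SL(N,Z): a point of T_N is an orbit.\<close>
definition pr :: "nat \<Rightarrow> (nat \<Rightarrow> nat \<Rightarrow> real) \<Rightarrow> (nat \<Rightarrow> nat \<Rightarrow> real) set" where
  "pr N Q = {act N Q \<gamma> | \<gamma>. \<gamma> \<in> SLZ N}"

definition tdist :: "nat \<Rightarrow> (nat \<Rightarrow> nat \<Rightarrow> real) set \<Rightarrow> (nat \<Rightarrow> nat \<Rightarrow> real) set \<Rightarrow> real" where
  "tdist N X Y = (INF Q1\<in>X. INF Q2\<in>Y. pdist N Q1 Q2)"

definition busemann :: "nat \<Rightarrow> (real \<Rightarrow> nat \<Rightarrow> nat \<Rightarrow> real) \<Rightarrow> (nat \<Rightarrow> nat \<Rightarrow> real) set \<Rightarrow> real" where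
  "busemann N r x = Lim at_top (\<lambda>t. tdist N x (pr N (r t)) - t)"

definition diagm :: "nat \<Rightarrow> (nat \<Rightarrow> real) \<Rightarrow> nat \<Rightarrow> nat \<Rightarrow> real" where
  "diagm N d = (\<lambda>i j. if i = j \<and> i < N then d i else 0)"

definition ray1 :: "nat \<Rightarrow> real \<Rightarrow> nat \<Rightarrow> nat \<Rightarrow> real" where
  "ray1 n t = diagm (n+1) (\<lambda>i. if i < n then exp (t / sqrt (real n * (real n + 1)))
                                 else exp (- t * sqrt (real n / (real n + 1))))"

definition rayn :: "nat \<Rightarrow> real \<Rightarrow> nat \<Rightarrow> nat \<Rightarrow> real" where
  "rayn n t = diagm (n+1) (\<lambda>i. if i = 0 then exp (t * sqrt (real n / (real n + 1)))
                                 else exp (- t / sqrt (real n * (real n + 1))))"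

definition U1 :: "nat \<Rightarrow> (nat \<Rightarrow> real) \<Rightarrow> nat \<Rightarrow> nat \<Rightarrow> real" where
  "U1 n x = (\<lambda>i j. if i < n+1 \<and> j < n+1 then
                 (if i = j then 1 else if j = n then x i else 0) else 0)"

definition Ucn :: "nat \<Rightarrow> (nat \<Rightarrow> real) \<Rightarrow> nat \<Rightarrow> nat \<Rightarrow> real" where
  "Ucn n x = (\<lambda>i j. if i < n+1 \<and> j < n+1 then
                 (if i = j then 1 else if i = 0 \<and> j \<ge> 1 then x (j - 1) else 0) else 0)"

definition Rn :: "nat \<Rightarrow> (nat \<Rightarrow> real) set" where
  "Rn n = {x. \<forall>i\<ge>n. x i = 0}"

definition distn :: "nat \<Rightarrow> (nat \<Rightarrow> real) \<Rightarrow> (nat \<Rightarrow> real) \<Rightarrow> real" where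
  "distn n x y = sqrt (\<Sum>i<n. (x i - y i)\<^sup>2)"

definition diamd :: "('a \<Rightarrow> 'a \<Rightarrow> real) \<Rightarrow> 'a set \<Rightarrow> ennreal" where
  "diamd d U = (SUP x\<in>U. SUP y\<in>U. ennreal (d x y))"

definition hausdorff_delta :: "('a \<Rightarrow> 'a \<Rightarrow> real) \<Rightarrow> real \<Rightarrow> real \<Rightarrow> 'a set \<Rightarrow> ennreal" where
  "hausdorff_delta d s \<delta> A = (INF U\<in>{U :: nat \<Rightarrow> 'a set. A \<subseteq> (\<Union>i. U i) \<and> (\<forall>i. diamd d (U i) \<le> ennreal \<delta>)}.
       (\<Sum>i. ennreal (enn2real (diamd d (U i)) powr s)))"

definition hausdorff_measure :: "('a \<Rightarrow> 'a \<Rightarrow> real) \<Rightarrow> real \<Rightarrow> 'a set \<Rightarrow> ennreal" where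
  "hausdorff_measure d s A = (SUP \<delta>\<in>{0<..}. hausdorff_delta d s \<delta> A)"

definition R1n :: "nat \<Rightarrow> (real \<Rightarrow> real) \<Rightarrow> (nat \<Rightarrow> real) set" where
  "R1n n \<phi> = {x \<in> Rn n. \<forall>T. \<exists>t\<ge>T.
      - busemann (n+1) (rayn n) (pr (n+1) (act (n+1) (ray1 n t) (U1 n x))) \<ge> t / real n - \<phi> t}"

definition Rn1 :: "nat \<Rightarrow> (real \<Rightarrow> real) \<Rightarrow> (nat \<Rightarrow> real) set" where
  "Rn1 n \<phi> = {x \<in> Rn n. \<forall>T. \<exists>t\<ge>T.
      - busemann (n+1) (ray1 n) (pr (n+1) (act (n+1) (rayn n t) (Ucn n x))) \<ge> t / real n - \<phi> t}"

end

theory Submission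
  imports Defs "HOL-Probability.Probability" "HOL-Real_Asymp.Real_Asymp" "Jordan_Normal_Form.Determinant"
begin

text \<open>By Cauchy-Schwarz and the asymptotics of the relative eigenvalues, the Busemann function of
  \<open>pr \<circ> r\<^sub>1\<close> at \<open>pr Q\<close> is \<open>\<eta>\<close> times the logarithm of the minimum of \<open>Q\<close> on primitive integer vectors;
  for \<open>r\<^sub>n\<close> the inverse form takes the place of \<open>Q\<close>. Hence both sets consist of the \<open>x\<close> admitting infinitely
  many integer solutions \<open>(p, q)\<close> of \<open>\<bar>q\<bar>\<^sup>2 + exp (\<eta> t) (p + q \<cdot> x)\<^sup>2 \<le> exp (\<phi> t / \<eta>)\<close>, up to a constant factor: this is
  Diophantine approximation of one linear form. Convergence of the series gives measure zero by
  covering with a mesh of cubes. In the divergence case one restricts to lines parallel to a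
  coordinate axis. For almost every line, by Dirichlet's theorem, the rational hyperplanes of height
  at most \<open>Q\<close> cut every interval in about as many well separated points as possible; an averaging
  argument over a cover then bounds the Hausdorff content of the limsup set in every interval from
  below by a fixed multiple of the length to the power \<open>\<sigma>\<close>, and such a bound forces infinite measure
  because \<open>\<sigma> < 1\<close>. Integrating over the lines finishes the proof.\<close>

section \<open>Content of one-dimensional limsup sets\<close>

text \<open>Neighbourhoods of hyperplanes have codimension one, so slicing by lines turns the
  exponent s in (n-1,n) into \<sigma> = s - n + 1 in (0,1). With k = exp(\<phi> t / (2 \<eta>)) and
  \<theta>(k) = exp(- \<eta> t / 2) the Diophantine condition becomes |q| \<le> k, |p + q . x| \<le>
  k \<theta>(k) up to constants, and the series becomes the sum of k^n \<theta>(k)^\<sigma>. Since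
  \<phi> is increasing, t grows with k, and then the hypothesis on \<eta>^2 id - \<phi> says that k
  \<theta>(k) is nonincreasing; the series is therefore comparable with sums over geometric blocks,
  which absorb every constant factor. Two obstacles shape the divergence part. The constants must be
  common to almost all lines, or integration over the lines would lose them; only the level from
  which the estimates hold may depend on the line. And slices of an arbitrary cover need not be
  measurable, so they enter the integral only through boxes that contain them.\<close>

lemma sum_separated_le:
  fixes z \<omega> :: "'a \<Rightarrow> real"
  assumes "finite F" "\<And>f. f \<in> F \<Longrightarrow> u + \<omega> f \<le> z f" "\<And>f. f \<in> F \<Longrightarrow> z f + \<omega> f \<le> v" "u \<le> v"
    "\<And>f g. f \<in> F \<Longrightarrow> g \<in> F \<Longrightarrow> f \<noteq> g \<Longrightarrow> \<omega> f + \<omega> g \<le> \<bar>z f - z g\<bar>"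
    "\<And>f. f \<in> F \<Longrightarrow> 0 \<le> \<omega> f"
  shows "(\<Sum>f\<in>F. 2 * \<omega> f) \<le> v - u"
  using assms
proof (induction F arbitrary: v rule: finite_ranking_induct[where f = z])
  case empty
  then show ?case by simp
next
  case (insert x S)
  show ?case
  proof (cases "x \<in> S")
    case True
    then show ?thesis using insert by (simp add: insert_absorb)
  next
    case False
    \<comment> \<open>Nothing lies to the right of \<open>x\<close>, so the remaining intervals fit
      to the left of its left end, which serves as the new \<open>v\<close>.\<close>
    have *: "z g + \<omega> g \<le> z x - \<omega> x" if "g \<in> S" for g
    proof -
      have "\<omega> x + \<omega> g \<le> \<bar>z x - z g\<bar>" using that False insert.prems(4) by (metis insertCI)
      moreover have "z g \<le> z x" using that insert by auto
      ultimately show ?thesis by linarith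
    qed
    have "(\<Sum>f\<in>S. 2 * \<omega> f) \<le> (z x - \<omega> x) - u"
    proof (rule insert.IH)
      show "u \<le> z x - \<omega> x" using insert.prems(1)[of x] by simp
    qed (use insert.prems * in auto)
    moreover have "z x + \<omega> x \<le> v" using insert.prems(2) by auto
    ultimately show ?thesis using False insert.hyps(1) by simp
  qed
qed

lemma card_separated_le:
  fixes P :: "real set"
  assumes "finite P" "P \<subseteq> {u..v}" "u \<le> v" "\<And>a b. a \<in> P \<Longrightarrow> b \<in> P \<Longrightarrow> a \<noteq> b \<Longrightarrow> D \<le> \<bar>a - b\<bar>" "0 < D"
  shows "real (card P) \<le> (v - u) / D + 1"
proof -
  have "(\<Sum>f\<in>P. 2 * (D/2)) \<le> (v + D/2) - (u - D/2)"
    by (rule sum_separated_le[where z = "\<lambda>x. x"]) (use assms in auto)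
  then have "real (card P) * D \<le> (v - u) + D" by simp
  then show ?thesis using \<open>0 < D\<close> by (simp add: field_simps)
qed

text \<open>If the capped series converged, its terms would tend to zero and the cap would
  eventually be inactive. Capping the widths at a fraction of the spacing keeps intervals of one
  level apart without spoiling divergence.\<close>

lemma not_summable_min:
  fixes X w :: "nat \<Rightarrow> real"
  assumes "\<And>m. 0 < X m" "\<not> summable (\<lambda>m. X m * w m)" "0 < \<delta>"
  shows "\<not> summable (\<lambda>m. X m * min (w m) (\<delta> / X m))"
proof
  assume s: "summable (\<lambda>m. X m * min (w m) (\<delta> / X m))"
  have "eventually (\<lambda>m. X m * min (w m) (\<delta> / X m) < \<delta>) sequentially"
    using summable_LIMSEQ_zero[OF s] assms(3) by (rule order_tendstoD)
  then have "eventually (\<lambda>m. X m * min (w m) (\<delta> / X m) = X m * w m) sequentially"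
  proof eventually_elim
    case (elim m)
    then show ?case using assms(1)[of m] by (auto simp: min_def split: if_splits)
  qed
  from summable_cong[OF this] s assms(2) show False by simp
qed

text \<open>A greedy selection, level by level. The intervals chosen so far cover only a small part of
  the interval and, by geometric growth, are few in number compared with the points of the
  next level, so a fixed proportion of the latter stays available until the total length is reached.\<close>
lemma resonant_family:
  fixes Z :: "nat \<Rightarrow> real set" and X w :: "nat \<Rightarrow> real"
  assumes Xpos: "\<And>m. 0 < X m" and c: "0 < c" and geo: "\<And>M. (\<Sum>m<M. X m) \<le> c / 8 * X M"
    and wpos: "\<And>m. 0 < w m" and div: "\<not> summable (\<lambda>m. X m * w m)" and eps: "0 < \<epsilon>" and uv: "u < v"
    and ub: "\<And>m. m0 \<le> m \<Longrightarrow> \<exists>P. finite P \<and> P \<subseteq> Z m \<inter> {u..v} \<and> c * X m * (v - u) \<le> real (card P)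
               \<and> (\<forall>a\<in>P. \<forall>b\<in>P. a \<noteq> b \<longrightarrow> 1 / X m \<le> \<bar>a - b\<bar>)"
    and big: "\<And>m. m0 \<le> m \<Longrightarrow> 1 \<le> X m * (v - u)"
  defines "W \<equiv> \<lambda>m. min (w m) (1 / (4 * \<epsilon>) / X m)"
  shows "\<exists>F :: (real \<times> nat) set. finite F \<and> (\<forall>f\<in>F. m0 \<le> snd f \<and> fst f \<in> Z (snd f) \<inter> {u..v})
    \<and> (\<forall>f\<in>F. \<forall>g\<in>F. f \<noteq> g \<longrightarrow> \<epsilon> * (W (snd f) + W (snd g)) \<le> \<bar>fst f - fst g\<bar>)
    \<and> c / 8 * (v - u) \<le> (\<Sum>f\<in>F. \<epsilon> * W (snd f))"
proof -
  define L where "L = v - u"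
  have L: "0 < L" using uv by (simp add: L_def)
  have Wpos: "0 < W m" for m using Xpos[of m] wpos[of m] eps by (simp add: W_def)
  \<comment> \<open>The cap in \<open>W\<close> makes the radius \<open>\<epsilon> * W m\<close> at
    most a quarter of the spacing \<open>1 / X m\<close>, so intervals of the same level never
    conflict.\<close>
  have WX: "\<epsilon> * W m * X m \<le> 1/4" for m
  proof -
    have "W m \<le> 1 / (4 * \<epsilon>) / X m" by (simp add: W_def)
    then show ?thesis using Xpos[of m] eps by (simp add: field_simps)
  qed
  \<comment> \<open>A lower bound for the total radius collected below level \<open>M\<close> while
    the target \<open>c / 8 * L\<close> is missed: every level contributes at least a quarter of its
    guaranteed points.\<close>
  define T where "T M = (\<Sum>m\<in>{m0..<M}. c / 4 * X m * L * (\<epsilon> * W m))" for M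
  have ex: "\<exists>F :: (real \<times> nat) set. finite F \<and> (\<forall>f\<in>F. m0 \<le> snd f \<and> snd f < M \<and> fst f \<in> Z (snd f) \<inter> {u..v})
    \<and> (\<forall>f\<in>F. \<forall>g\<in>F. f \<noteq> g \<longrightarrow> \<epsilon> * (W (snd f) + W (snd g)) \<le> \<bar>fst f - fst g\<bar>)
    \<and> real (card F) \<le> (\<Sum>m<M. 2 * X m * L)
    \<and> min (c / 8 * L) (T M) \<le> (\<Sum>f\<in>F. \<epsilon> * W (snd f))" for M
  proof (induction M)
    case 0
    show ?case by (rule exI[of _ "{}"]) (use c L in \<open>auto simp: T_def\<close>)
  next
    case (Suc M)
    then obtain F :: "(real \<times> nat) set" where F0: "finite F"
      "\<forall>f\<in>F. m0 \<le> snd f \<and> snd f < M \<and> fst f \<in> Z (snd f) \<inter> {u..v}"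
      "\<forall>f\<in>F. \<forall>g\<in>F. f \<noteq> g \<longrightarrow> \<epsilon> * (W (snd f) + W (snd g)) \<le> \<bar>fst f - fst g\<bar>"
      "real (card F) \<le> (\<Sum>m<M. 2 * X m * L)"
      "min (c / 8 * L) (T M) \<le> (\<Sum>f\<in>F. \<epsilon> * W (snd f))" by blast
    have F: "finite F" "\<And>f. f \<in> F \<Longrightarrow> m0 \<le> snd f \<and> snd f < M \<and> fst f \<in> Z (snd f) \<inter> {u..v}"
      "\<And>f g. f\<in>F \<Longrightarrow> g\<in>F \<Longrightarrow> f \<noteq> g \<Longrightarrow> \<epsilon> * (W (snd f) + W (snd g)) \<le> \<bar>fst f - fst g\<bar>"
      "real (card F) \<le> (\<Sum>m<M. 2 * X m * L)"
      "min (c / 8 * L) (T M) \<le> (\<Sum>f\<in>F. \<epsilon> * W (snd f))" using F0 by blast+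
    have mono: "(\<Sum>m<M. 2 * X m * L) \<le> (\<Sum>m<Suc M. 2 * X m * L)" using Xpos[of M] L by simp
    show ?case
    proof (cases "M < m0 \<or> c / 8 * L \<le> (\<Sum>f\<in>F. \<epsilon> * W (snd f))")
      case True
      have "min (c / 8 * L) (T (Suc M)) \<le> (\<Sum>f\<in>F. \<epsilon> * W (snd f))"
      proof (cases "M < m0")
        case True
        then have "T (Suc M) = T M" by (simp add: T_def)
        then show ?thesis using F(5) by simp
      next
        case False
        then show ?thesis using True by auto
      qed
      moreover have "real (card F) \<le> (\<Sum>m<Suc M. 2 * X m * L)" by (rule order_trans[OF F(4) mono])
      moreover have "snd f < Suc M" if "f \<in> F" for f using F(2)[OF that] by simp
      ultimately show ?thesis using F(1) F(2) F0(3) by (intro exI[of _ F] conjI ballI) auto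
    next
      case False
      then have M: "m0 \<le> M" and small: "(\<Sum>f\<in>F. \<epsilon> * W (snd f)) < c / 8 * L" by auto
      have TM: "T M \<le> (\<Sum>f\<in>F. \<epsilon> * W (snd f))" using F(5) small by linarith
      obtain P where P: "finite P" "P \<subseteq> Z M \<inter> {u..v}" "c * X M * L \<le> real (card P)"
        "\<And>a b. a\<in>P \<Longrightarrow> b\<in>P \<Longrightarrow> a \<noteq> b \<Longrightarrow> 1 / X M \<le> \<bar>a - b\<bar>"
        using ub[OF M] unfolding L_def by blast
      define B where "B f = {a \<in> P. \<bar>fst f - a\<bar> < \<epsilon> * (W (snd f) + W M)}" for f
      define E where "E = P - (\<Union>f\<in>F. B f)"
      \<comment> \<open>A chosen interval blocks a number of points proportional to its length, plus
        a constant. The constant part is controlled by the bound on \<open>card F\<close>, which is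
        why the induction carries it; the other part by the target not being reached yet.\<close>
      have cB: "real (card (B f)) \<le> 3/2 + 2 * (\<epsilon> * W (snd f)) * X M" for f
      proof -
        let ?r = "\<epsilon> * (W (snd f) + W M)"
        have "real (card (B f)) \<le> ((fst f + ?r) - (fst f - ?r)) / (1 / X M) + 1"
        proof (rule card_separated_le)
          show "fst f - ?r \<le> fst f + ?r" using eps Wpos[of "snd f"] Wpos[of M] by (simp add: add_nonneg_nonneg)
        qed (use P Xpos[of M] in \<open>auto simp: B_def\<close>)
        also have "\<dots> = 2 * (\<epsilon> * W (snd f)) * X M + 2 * (\<epsilon> * W M * X M) + 1" by (simp add: algebra_simps)
        finally show ?thesis using WX[of M] by linarith
      qed
      have "real (card (\<Union>f\<in>F. B f)) \<le> (\<Sum>f\<in>F. real (card (B f)))"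
        using card_UN_le[OF F(1), of B] by (metis of_nat_le_iff of_nat_sum)
      also have "\<dots> \<le> (\<Sum>f\<in>F. 3/2 + 2 * (\<epsilon> * W (snd f)) * X M)" by (intro sum_mono cB)
      also have "\<dots> = 3/2 * real (card F) + 2 * X M * (\<Sum>f\<in>F. \<epsilon> * W (snd f))"
        by (simp add: sum.distrib sum_distrib_left mult_ac)
      also have "\<dots> \<le> 3/2 * (2 * L * (c / 8 * X M)) + 2 * X M * (c / 8 * L)"
      proof (intro add_mono mult_left_mono)
        have "(\<Sum>m<M. 2 * X m * L) = 2 * L * (\<Sum>m<M. X m)" by (simp add: sum_distrib_left mult_ac)
        also have "\<dots> \<le> 2 * L * (c / 8 * X M)" using geo[of M] L by (intro mult_left_mono) auto
        finally show "real (card F) \<le> 2 * L * (c / 8 * X M)" using F(4) by linarith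
      qed (use small Xpos[of M] in auto)
      \<comment> \<open>The two parts are 3/8 and 1/4 of \<open>c * X M * L\<close>, so at least a
        quarter of the points of level \<open>M\<close> stays available.\<close>
      also have "\<dots> \<le> 3/4 * (c * X M * L)" using c Xpos[of M] L by (simp add: field_simps)
      finally have cU: "real (card (\<Union>f\<in>F. B f)) \<le> 3/4 * (c * X M * L)" .
      have "real (card P) \<le> real (card E) + real (card (\<Union>f\<in>F. B f))"
      proof -
        have "P \<subseteq> E \<union> (\<Union>f\<in>F. B f)" by (auto simp: E_def)
        moreover have "finite (E \<union> (\<Union>f\<in>F. B f))" using P(1) F(1) by (auto simp: E_def B_def)
        ultimately have "card P \<le> card (E \<union> (\<Union>f\<in>F. B f))" by (rule card_mono[rotated])
        also have "\<dots> \<le> card E + card (\<Union>f\<in>F. B f)" by (rule card_Un_le)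
        finally show ?thesis by linarith
      qed
      then have cE: "c / 4 * X M * L \<le> real (card E)" using P(3) cU by linarith
      have cE2: "real (card E) \<le> 2 * X M * L"
      proof -
        have "real (card E) \<le> (v - u) / (1 / X M) + 1"
          by (rule card_separated_le) (use P uv Xpos[of M] in \<open>auto simp: E_def\<close>)
        then show ?thesis using big[OF M] by (simp add: L_def algebra_simps)
      qed
      have fE: "finite E" using P(1) by (simp add: E_def)
      define F' where "F' = F \<union> (\<lambda>a. (a, M)) ` E"
      have disj: "F \<inter> (\<lambda>a. (a, M)) ` E = {}" using F(2) by force
      have inj: "inj_on (\<lambda>a. (a, M)) E" by (auto simp: inj_on_def)
      have cF': "card F' = card F + card E"
        unfolding F'_def using card_Un_disjoint[OF F(1) _ disj] fE card_image[OF inj] by simp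
      have sF': "(\<Sum>f\<in>F'. \<epsilon> * W (snd f)) = (\<Sum>f\<in>F. \<epsilon> * W (snd f)) + real (card E) * (\<epsilon> * W M)"
        unfolding F'_def using sum.union_disjoint[OF F(1) _ disj, of "\<lambda>f. \<epsilon> * W (snd f)"] fE by (simp add: sum.reindex[OF inj])
      have EM: "\<epsilon> * (W (snd f) + W M) \<le> \<bar>fst f - a\<bar>" if "f \<in> F" "a \<in> E" for f a
        using that by (auto simp: E_def B_def not_less)
      have EE: "\<epsilon> * (W M + W M) \<le> \<bar>a - b\<bar>" if "a \<in> E" "b \<in> E" "a \<noteq> b" for a b
      proof -
        have "\<epsilon> * (W M + W M) \<le> 1 / X M" using WX[of M] Xpos[of M] by (simp add: field_simps)
        moreover have "1 / X M \<le> \<bar>a - b\<bar>" using that P(4) by (auto simp: E_def)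
        ultimately show ?thesis by linarith
      qed
      show ?thesis
      proof (intro exI[of _ F'] conjI ballI impI)
        show "finite F'" using F(1) fE by (simp add: F'_def)
      next
        fix f assume "f \<in> F'"
        then show "m0 \<le> snd f" "snd f < Suc M" "fst f \<in> Z (snd f) \<inter> {u..v}"
          using F(2)[of f] P(2) M unfolding F'_def E_def by auto
      next
        fix f g assume "f \<in> F'" "g \<in> F'" "f \<noteq> g"
        then consider "f \<in> F" "g \<in> F" | a where "f \<in> F" "g = (a,M)" "a \<in> E"
          | a where "g \<in> F" "f = (a,M)" "a \<in> E" | a b where "f = (a,M)" "g = (b,M)" "a \<in> E" "b \<in> E" "a \<noteq> b"
          unfolding F'_def by auto
        then show "\<epsilon> * (W (snd f) + W (snd g)) \<le> \<bar>fst f - fst g\<bar>"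
        proof cases
          case 1 then show ?thesis using F(3) \<open>f \<noteq> g\<close> by blast
        next
          case 2 then show ?thesis using EM[of f a] by simp
        next
          case 3 then show ?thesis using EM[of g a] by (simp add: abs_minus_commute add.commute)
        next
          case 4 then show ?thesis using EE[of a b] by simp
        qed
      next
        show "real (card F') \<le> (\<Sum>m<Suc M. 2 * X m * L)" using cF' F(4) cE2 by simp
      next
        have "T (Suc M) = T M + c / 4 * X M * L * (\<epsilon> * W M)" using M by (simp add: T_def)
        moreover have "c / 4 * X M * L * (\<epsilon> * W M) \<le> real (card E) * (\<epsilon> * W M)"
          using cE eps Wpos[of M] by (intro mult_right_mono) auto
        ultimately show "min (c / 8 * L) (T (Suc M)) \<le> (\<Sum>f\<in>F'. \<epsilon> * W (snd f))"
          using sF' TM by linarith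
      qed
    qed
  qed
  \<comment> \<open>Were the target never reached, the bounded \<open>T\<close> would make the
    capped series converge.\<close>
  have "\<exists>M. c / 8 * L \<le> T M"
  proof (rule ccontr)
    assume "\<nexists>M. c / 8 * L \<le> T M"
    then have bd: "T M < c / 8 * L" for M by (simp add: not_le)
    let ?C = "c / 4 * L * \<epsilon>"
    have C: "0 < ?C" using c L eps by simp
    have "summable (\<lambda>m. X (m + m0) * W (m + m0))"
    proof (rule summableI_nonneg_bounded)
      fix n show "0 \<le> X (n + m0) * W (n + m0)" using Xpos[of "n+m0"] Wpos[of "n+m0"] by simp
    next
      fix k
      have "T (k + m0) = (\<Sum>m<k. c / 4 * X (m+m0) * L * (\<epsilon> * W (m+m0)))"
        unfolding T_def using sum.shift_bounds_nat_ivl[of _ 0 m0 k] by (simp add: lessThan_atLeast0)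
      also have "\<dots> = ?C * (\<Sum>m<k. X (m+m0) * W (m+m0))" by (simp add: sum_distrib_left mult_ac)
      finally have eq: "T (k + m0) = ?C * (\<Sum>m<k. X (m+m0) * W (m+m0))" .
      have "?C * (\<Sum>m<k. X (m+m0) * W (m+m0)) \<le> c / 8 * L"
        using bd[of "k+m0"] unfolding eq by (rule less_imp_le)
      then show "(\<Sum>m<k. X (m+m0) * W (m+m0)) \<le> (c / 8 * L) / ?C"
        unfolding pos_le_divide_eq[OF C] by (simp only: mult.commute)
    qed
    then have "summable (\<lambda>m. X m * W m)" by (simp only: summable_iff_shift[of "\<lambda>m. X m * W m" m0])
    moreover have "\<not> summable (\<lambda>m. X m * W m)"
      unfolding W_def by (rule not_summable_min[OF Xpos div]) (use eps in auto)
    ultimately show False by simp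
  qed
  then obtain M where M: "c / 8 * L \<le> T M" by blast
  obtain F :: "(real \<times> nat) set" where F: "finite F" "\<forall>f\<in>F. m0 \<le> snd f \<and> snd f < M \<and> fst f \<in> Z (snd f) \<inter> {u..v}"
      "\<forall>f\<in>F. \<forall>g\<in>F. f \<noteq> g \<longrightarrow> \<epsilon> * (W (snd f) + W (snd g)) \<le> \<bar>fst f - fst g\<bar>"
      "min (c / 8 * L) (T M) \<le> (\<Sum>f\<in>F. \<epsilon> * W (snd f))" using ex[of M] by blast
  then show ?thesis using M by (intro exI[of _ F]) (auto simp: L_def)
qed

text \<open>The length \<open>W f powr (1/\<sigma>)\<close> has \<sigma>-th power \<open>W f\<close>
  and is short against the gap \<open>\<epsilon> * W f\<close> around the member. If
  \<open>U\<close> meets two members, all members it meets crowd near one point and their gaps fit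
  into length \<open>8 * d\<close>; \<open>4 * d \<le> \<epsilon> * d powr \<sigma>\<close> turns
  this into a bound by \<open>d powr \<sigma>\<close>. The last factor is at least 1 and expresses
  the bound as a share of the total.\<close>

lemma sum_meeting_le:
  fixes z W :: "'a \<Rightarrow> real"
  assumes fin: "finite F" and Wpos: "\<And>f. f \<in> F \<Longrightarrow> 0 < W f"
    and small: "\<And>f. f \<in> F \<Longrightarrow> W f powr (1/\<sigma>) \<le> \<epsilon> * W f"
    and sep: "\<And>f g. f \<in> F \<Longrightarrow> g \<in> F \<Longrightarrow> f \<noteq> g \<Longrightarrow> \<epsilon> * (W f + W g) \<le> \<bar>z f - z g\<bar>"
    and S: "L powr \<sigma> \<le> sum W F" and U: "\<And>a b. a \<in> U \<Longrightarrow> b \<in> U \<Longrightarrow> \<bar>a - b\<bar> \<le> d"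
    and d: "0 < d" "4 * d \<le> \<epsilon> * d powr \<sigma>" and \<sigma>: "0 < \<sigma>" and eps: "0 < \<epsilon>" and L: "0 < L"
  shows "(\<Sum>f\<in>{f\<in>F. U \<inter> {z f - W f powr (1/\<sigma>) / 2..z f + W f powr (1/\<sigma>) / 2} \<noteq> {}}.
            min d (W f powr (1/\<sigma>)) powr \<sigma>) \<le> d powr \<sigma> * (sum W F / L powr \<sigma>)"
proof -
  define l where "l f = W f powr (1/\<sigma>)" for f
  define T where "T = {f\<in>F. U \<inter> {z f - l f / 2..z f + l f / 2} \<noteq> {}}"
  have fT: "finite T" using fin by (simp add: T_def)
  have lW: "l f powr \<sigma> = W f" if "f \<in> F" for f
    using Wpos[OF that] \<sigma> by (simp add: l_def powr_powr)
  have ge: "d powr \<sigma> \<le> d powr \<sigma> * (sum W F / L powr \<sigma>)"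
  proof -
    have "1 \<le> sum W F / L powr \<sigma>" using S L by simp
    then have "d powr \<sigma> * 1 \<le> d powr \<sigma> * (sum W F / L powr \<sigma>)" by (intro mult_left_mono) auto
    then show ?thesis by simp
  qed
  have "(\<Sum>f\<in>T. min d (l f) powr \<sigma>) \<le> d powr \<sigma>"
  proof (cases "\<exists>f g. f \<in> T \<and> g \<in> T \<and> f \<noteq> g")
    case False
    then have "T = {} \<or> (\<exists>f. T = {f})" by blast
    then show ?thesis
    proof
      assume "\<exists>f. T = {f}"
      then obtain f where f: "T = {f}" by blast
      have "min d (l f) powr \<sigma> \<le> d powr \<sigma>" using d \<sigma> by (intro powr_mono2) (auto simp: l_def)
      then show ?thesis using f by simp
    qed simp
  next
    case True
    then obtain f1 f2 where f12: "f1 \<in> T" "f2 \<in> T" "f1 \<noteq> f2" by blast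
    then obtain a where a: "a \<in> U" "a \<in> {z f1 - l f1 / 2..z f1 + l f1 / 2}" unfolding T_def by blast
    \<comment> \<open>The separation is at most \<open>d\<close> plus the two half-lengths, and
      these take up at most half of the gaps; so half the sum of the gaps is at most
      \<open>d\<close>.\<close>
    have w2: "\<epsilon> * W f \<le> 2 * d" if fT: "f \<in> T" for f
    proof -
      obtain g where g: "g \<in> T" "g \<noteq> f" using f12 by metis
      obtain b where b: "b \<in> U" "b \<in> {z f - l f / 2..z f + l f / 2}" using fT unfolding T_def by blast
      obtain b' where b': "b' \<in> U" "b' \<in> {z g - l g / 2..z g + l g / 2}" using g unfolding T_def by blast
      have F: "f \<in> F" "g \<in> F" using fT g by (auto simp: T_def)
      have "\<bar>b - b'\<bar> \<le> d" using U b b' by blast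
      then have "\<bar>z f - z g\<bar> \<le> l f / 2 + d + l g / 2" using b(2) b'(2) by (auto simp: abs_le_iff)
      moreover have "l f \<le> \<epsilon> * W f" "l g \<le> \<epsilon> * W g" using small F by (auto simp: l_def)
      moreover have "\<epsilon> * (W f + W g) \<le> \<bar>z f - z g\<bar>" using sep F g by blast
      moreover have "0 \<le> \<epsilon> * W g" using eps Wpos[OF F(2)] by simp
      ultimately show ?thesis by (simp add: distrib_left)
    qed
    have za: "\<bar>z f - a\<bar> \<le> 2 * d" if fT: "f \<in> T" for f
    proof -
      obtain b where b: "b \<in> U" "b \<in> {z f - l f / 2..z f + l f / 2}" using fT unfolding T_def by blast
      have "\<bar>b - a\<bar> \<le> d" using U a b by blast
      moreover have "l f \<le> 2 * d" using small[of f] w2[OF fT] fT by (auto simp: l_def T_def)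
      ultimately show ?thesis using b(2) by (auto simp: abs_le_iff)
    qed
    have "(\<Sum>f\<in>T. 2 * (\<epsilon> * W f)) \<le> (a + 4 * d) - (a - 4 * d)"
    proof (rule sum_separated_le[OF fT])
      fix f assume f: "f \<in> T"
      show "a - 4 * d + \<epsilon> * W f \<le> z f" "z f + \<epsilon> * W f \<le> a + 4 * d"
        using za[OF f] w2[OF f] by (auto simp: abs_le_iff)
      show "0 \<le> \<epsilon> * W f" using eps Wpos[of f] f by (auto simp: T_def)
    next
      fix f g assume "f \<in> T" "g \<in> T" "f \<noteq> g"
      then show "\<epsilon> * W f + \<epsilon> * W g \<le> \<bar>z f - z g\<bar>" using sep[of f g] by (auto simp: T_def distrib_left)
    qed (use d in auto)
    moreover have "(\<Sum>f\<in>T. 2 * (\<epsilon> * W f)) = 2 * \<epsilon> * sum W T" by (simp add: sum_distrib_left mult.assoc)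
    ultimately have "\<epsilon> * sum W T \<le> \<epsilon> * d powr \<sigma>" using d(2) by linarith
    then have "sum W T \<le> d powr \<sigma>" using eps by simp
    moreover have "(\<Sum>f\<in>T. min d (l f) powr \<sigma>) \<le> sum W T"
    proof (rule sum_mono)
      fix f assume "f \<in> T"
      then have f: "f \<in> F" by (simp add: T_def)
      have "min d (l f) powr \<sigma> \<le> l f powr \<sigma>" using d \<sigma> by (intro powr_mono2) (auto simp: l_def)
      then show "min d (l f) powr \<sigma> \<le> W f" using lW[OF f] by simp
    qed
    ultimately show ?thesis by linarith
  qed
  then show ?thesis using ge unfolding T_def l_def by linarith
qed

text \<open>An interval is light when a given cover \<open>U\<close>, with diameters below \<open>e\<close>, is cheap on it; a nested sequence
  of light intervals shrinks to a point that is not covered.\<close>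
definition light :: "(nat \<Rightarrow> real set) \<Rightarrow> (nat \<Rightarrow> real) \<Rightarrow> real \<Rightarrow> real \<Rightarrow> real \<Rightarrow> real \<Rightarrow> bool" where
  "light U e \<sigma> K u v \<longleftrightarrow>
     (\<Sum>i. if U i \<inter> {u..v} \<noteq> {} then ennreal (e i powr \<sigma>) else 0) < ennreal (K * (v - u) powr \<sigma>)"

lemma light_powr_less:
  assumes "light U e \<sigma> K u v" "U i \<inter> {u..v} \<noteq> {}"
  shows "e i powr \<sigma> < K * (v - u) powr \<sigma>"
proof -
  let ?f = "\<lambda>i. if U i \<inter> {u..v} \<noteq> {} then ennreal (e i powr \<sigma>) else 0"
  have "sum ?f {i} \<le> suminf ?f" by (rule sum_le_suminf) auto
  then have "ennreal (e i powr \<sigma>) \<le> suminf ?f" using assms(2) by simp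
  also have "\<dots> < ennreal (K * (v - u) powr \<sigma>)" using assms(1) by (simp add: light_def)
  finally show ?thesis by (simp add: ennreal_less_iff)
qed

text \<open>For \<open>e powr \<sigma> < K * L powr \<sigma>\<close> to imply
  \<open>4 * e \<le> \<epsilon> * e powr \<sigma>\<close> with
  \<open>\<epsilon> = c / 16 * L powr (1 - \<sigma>)\<close>, solve for \<open>K\<close>: this gives
  the power of \<open>c / 64\<close>. The bound 1 handles sets at least as long as a member, which
  already cost its whole weight. Only \<open>c\<close> and \<sigma> enter, so the constant is common
  to almost all lines.\<close>

definition content_const :: "real \<Rightarrow> real \<Rightarrow> real" where
  "content_const c \<sigma> = min 1 ((c / 64) powr (\<sigma> / (1 - \<sigma>)))"

lemma content_const: "0 < c \<Longrightarrow> 0 < content_const c \<sigma>" "content_const c \<sigma> \<le> 1"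
  by (auto simp: content_const_def)

locale ubiquitous =
  fixes Z :: "nat \<Rightarrow> real set" and X \<rho> :: "nat \<Rightarrow> real" and c \<sigma> :: real
  assumes Xpos: "\<And>m. 0 < X m" and c: "0 < c" "c \<le> 1" and \<sigma>: "0 < \<sigma>" "\<sigma> < 1"
    and geo: "\<And>M. (\<Sum>m<M. X m) \<le> c / 8 * X M" and Xinf: "filterlim X at_top sequentially"
    and \<rho>pos: "\<And>m. 0 < \<rho> m" and \<rho>0: "\<rho> \<longlonglongrightarrow> 0"
    and div: "\<not> summable (\<lambda>m. X m * \<rho> m powr \<sigma>)"
    and ub: "\<And>u v. u < v \<Longrightarrow> \<exists>m0. \<forall>m\<ge>m0. \<exists>P. finite P \<and> P \<subseteq> Z m \<inter> {u..v} \<and> c * X m * (v - u) \<le> real (card P)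
               \<and> (\<forall>a\<in>P. \<forall>b\<in>P. a \<noteq> b \<longrightarrow> 1 / X m \<le> \<bar>a - b\<bar>)"
begin

text \<open>Otherwise all members of the family from \<open>resonant_family\<close> would be heavy. A set of small diameter \<open>d\<close> either
  meets a single member or has \<open>d\<close> large against the separation of those it meets; in both cases it
  contributes to all of them together at most its share \<open>(d / L) powr \<sigma>\<close> of the total, so summing over
  the family contradicts lightness of the given interval.\<close>
lemma light_subinterval:
  assumes L: "light U e \<sigma> (content_const c \<sigma>) u v" and uv: "u < v" and epos: "\<And>i. 0 < e i"
    and U: "\<And>i a b. a \<in> U i \<Longrightarrow> b \<in> U i \<Longrightarrow> \<bar>a - b\<bar> \<le> e i"
  shows "\<exists>u' v' z m. u \<le> u' \<and> u' < v' \<and> v' \<le> v \<and> light U e \<sigma> (content_const c \<sigma>) u' v' \<and> M \<le> m \<and> z \<in> Z m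
           \<and> {u'..v'} \<subseteq> {z - \<rho> m..z + \<rho> m} \<and> v' - u' \<le> (v - u) / 2"
proof -
  define L where "L = v - u"
  define \<kappa> where "\<kappa> = c / 8"
  \<comment> \<open>Makes \<open>\<epsilon> * L powr \<sigma>\<close> equal to
    \<open>\<kappa> * L / 2\<close>, the total radius reached on the middle half of the interval, so
    that the weights add up to at least \<open>L powr \<sigma>\<close>.\<close>
  define \<epsilon> where "\<epsilon> = \<kappa> * L powr (1 - \<sigma>) / 2"
  have L0: "0 < L" using uv by (simp add: L_def)
  have \<kappa>: "0 < \<kappa>" using c by (simp add: \<kappa>_def)
  have eps: "0 < \<epsilon>" using \<kappa> L0 by (simp add: \<epsilon>_def)
  \<comment> \<open>The middle half leaves a margin \<open>L/4\<close> in which the intervals about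
    the chosen points fit.\<close>
  obtain m1 where m1: "\<And>m. m1 \<le> m \<Longrightarrow> \<exists>P. finite P \<and> P \<subseteq> Z m \<inter> {u + L/4..v - L/4} \<and> c * X m * ((v - L/4) - (u + L/4)) \<le> real (card P)
               \<and> (\<forall>a\<in>P. \<forall>b\<in>P. a \<noteq> b \<longrightarrow> 1 / X m \<le> \<bar>a - b\<bar>)"
    using ub[of "u + L/4" "v - L/4"] uv by (auto simp: L_def field_simps)
  \<comment> \<open>The bound by \<open>\<epsilon> powr (1 / (1 - \<sigma>))\<close> gives
    \<open>\<rho> m \<le> \<epsilon> * \<rho> m powr \<sigma>\<close>: at these levels an interval
    is short against its gap.\<close>
  have "eventually (\<lambda>m. m1 \<le> m \<and> M \<le> m \<and> 2 / L \<le> X m \<and> \<rho> m < min (L/4) (\<epsilon> powr (1 / (1 - \<sigma>)))) sequentially"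
    using Xinf \<rho>0 L0 eps
    by (intro eventually_conj eventually_ge_at_top order_tendstoD(2)[OF \<rho>0])
       (auto simp: filterlim_at_top)
  then obtain m0 where m0: "\<And>m. m0 \<le> m \<Longrightarrow> m1 \<le> m \<and> M \<le> m \<and> 2 / L \<le> X m \<and> \<rho> m < min (L/4) (\<epsilon> powr (1 / (1 - \<sigma>)))"
    unfolding eventually_sequentially by blast
  define W where "W m = min (\<rho> m powr \<sigma>) (1 / (4 * \<epsilon>) / X m)" for m
  have "\<exists>F :: (real \<times> nat) set. finite F \<and> (\<forall>f\<in>F. m0 \<le> snd f \<and> fst f \<in> Z (snd f) \<inter> {u + L/4..v - L/4})
    \<and> (\<forall>f\<in>F. \<forall>g\<in>F. f \<noteq> g \<longrightarrow> \<epsilon> * (W (snd f) + W (snd g)) \<le> \<bar>fst f - fst g\<bar>)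
    \<and> c / 8 * ((v - L/4) - (u + L/4)) \<le> (\<Sum>f\<in>F. \<epsilon> * W (snd f))"
    unfolding W_def
  proof (rule resonant_family[OF Xpos c(1) geo _ div eps])
    show "0 < \<rho> m powr \<sigma>" for m using \<rho>pos[of m] by simp
    show "u + L/4 < v - L/4" using uv by (simp add: L_def field_simps)
    show "1 \<le> X m * ((v - L/4) - (u + L/4))" if "m0 \<le> m" for m
    proof -
      have "2 / L \<le> X m" using m0[OF that] by simp
      then have "1 \<le> X m * (L / 2)" using L0 by (simp add: field_simps)
      moreover have "(v - L/4) - (u + L/4) = L / 2" by (simp add: L_def field_simps)
      ultimately show ?thesis by metis
    qed
  qed (use m1 m0 in blast)
  then obtain F :: "(real \<times> nat) set" where F: "finite F"
    "\<forall>f\<in>F. m0 \<le> snd f \<and> fst f \<in> Z (snd f) \<inter> {u + L/4..v - L/4}"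
    "\<forall>f\<in>F. \<forall>g\<in>F. f \<noteq> g \<longrightarrow> \<epsilon> * (W (snd f) + W (snd g)) \<le> \<bar>fst f - fst g\<bar>"
    "c / 8 * ((v - L/4) - (u + L/4)) \<le> (\<Sum>f\<in>F. \<epsilon> * W (snd f))" by blast
  define S where "S = (\<Sum>f\<in>F. W (snd f))"
  have "\<kappa> * L / 2 \<le> \<epsilon> * S"
  proof -
    have "c / 8 * ((v - L/4) - (u + L/4)) = \<kappa> * L / 2" by (simp add: \<kappa>_def L_def field_simps)
    moreover have "\<epsilon> * S = (\<Sum>f\<in>F. \<epsilon> * W (snd f))" unfolding S_def by (rule sum_distrib_left)
    ultimately show ?thesis using F(4) by metis
  qed
  moreover have "\<kappa> * L / 2 = \<epsilon> * L powr \<sigma>"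
    using L0 by (simp add: \<epsilon>_def powr_diff)
  ultimately have S: "L powr \<sigma> \<le> S" using eps by simp
  have Spos: "0 < S" using S L0 by (smt (verit) powr_gt_zero)
  have Wpos: "0 < W m" for m using Xpos[of m] \<rho>pos[of m] eps by (simp add: W_def)
  define l where "l f = W (snd f) powr (1/\<sigma>)" for f :: "real \<times> nat"
  have lpos: "0 < l f" for f using Wpos[of "snd f"] by (simp add: l_def)
  have l\<sigma>: "l f powr \<sigma> = W (snd f)" for f using Wpos[of "snd f"] \<sigma> by (simp add: l_def powr_powr)
  have l\<rho>: "l f \<le> \<rho> (snd f)" for f
  proof -
    have "l f \<le> (\<rho> (snd f) powr \<sigma>) powr (1/\<sigma>)"
      unfolding l_def using \<sigma> Wpos[of "snd f"] by (intro powr_mono2) (auto simp: W_def)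
    also have "\<dots> = \<rho> (snd f)" using \<sigma> \<rho>pos[of "snd f"] by (simp add: powr_powr)
    finally show ?thesis .
  qed
  have lsmall: "l f \<le> \<epsilon> * W (snd f)" if "f \<in> F" for f
  proof -
    have "l f \<le> \<epsilon> powr (1 / (1 - \<sigma>))" using l\<rho>[of f] m0[of "snd f"] F(2) that by force
    then have "l f powr (1 - \<sigma>) \<le> (\<epsilon> powr (1 / (1 - \<sigma>))) powr (1 - \<sigma>)"
      using \<sigma> lpos[of f] by (intro powr_mono2) auto
    then have "l f powr (1 - \<sigma>) \<le> \<epsilon>" using \<sigma> eps by (simp add: powr_powr)
    then have "l f powr (1 - \<sigma>) * l f powr \<sigma> \<le> \<epsilon> * l f powr \<sigma>" by (intro mult_right_mono) auto
    moreover have "l f powr (1 - \<sigma>) * l f powr \<sigma> = l f" using lpos[of f] by (simp flip: powr_add)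
    ultimately show ?thesis by (simp add: l\<sigma>)
  qed
  define I where "I f = {fst f - l f / 2..fst f + l f / 2}" for f
  have Isub: "I f \<subseteq> {u..v}" and llen: "l f \<le> L / 4" if "f \<in> F" for f
  proof -
    have 1: "l f \<le> L / 4" using l\<rho>[of f] m0[of "snd f"] F(2) that by force
    have "fst f \<in> {u + L/4..v - L/4}" using F(2) that by blast
    then show "I f \<subseteq> {u..v}" using 1 L0 by (auto simp: I_def)
    show "l f \<le> L / 4" by (rule 1)
  qed
  have "\<exists>f\<in>F. light U e \<sigma> (content_const c \<sigma>) (fst f - l f / 2) (fst f + l f / 2)"
  proof (rule ccontr)
    assume "\<not> (\<exists>f\<in>F. light U e \<sigma> (content_const c \<sigma>) (fst f - l f / 2) (fst f + l f / 2))"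
    then have heavy: "ennreal (content_const c \<sigma> * W (snd f)) \<le> (\<Sum>i. if U i \<inter> I f \<noteq> {} then ennreal (e i powr \<sigma>) else 0)"
      if "f \<in> F" for f
      using that by (auto simp: light_def I_def not_less l\<sigma>)
    let ?g = "\<lambda>i f. if U i \<inter> I f \<noteq> {} then ennreal (min (e i) (l f) powr \<sigma>) else 0"
    \<comment> \<open>Cutting \<open>e i\<close> down to \<open>l f\<close> keeps members heavy: a
      single set at least as long as the member still costs \<open>W (snd f)\<close>, and
      \<open>content_const\<close> is at most 1.\<close>
    have heavy': "ennreal (content_const c \<sigma> * W (snd f)) \<le> (\<Sum>i. ?g i f)" if f: "f \<in> F" for f
    proof (cases "\<exists>i. U i \<inter> I f \<noteq> {} \<and> l f \<le> e i")
      case True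
      then obtain i where i: "U i \<inter> I f \<noteq> {}" "l f \<le> e i" by blast
      have "sum (\<lambda>i. ?g i f) {i} \<le> (\<Sum>i. ?g i f)" by (rule sum_le_suminf) auto
      then have "ennreal (W (snd f)) \<le> (\<Sum>i. ?g i f)" using i by (simp add: l\<sigma> min_absorb2)
      moreover have "ennreal (content_const c \<sigma> * W (snd f)) \<le> ennreal (W (snd f))"
        using content_const(1)[OF c(1), of \<sigma>] content_const(2)[of c \<sigma>] Wpos[of "snd f"] by (intro ennreal_leI) (simp add: mult_le_cancel_right1)
      ultimately show ?thesis by (rule order_trans[rotated])
    next
      case False
      then have "?g i f = (if U i \<inter> I f \<noteq> {} then ennreal (e i powr \<sigma>) else 0)" for i
        by (cases "U i \<inter> I f = {}") (auto simp: min_def)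
      then show ?thesis using heavy[OF f] by simp
    qed
    let ?h = "\<lambda>i. if U i \<inter> {u..v} \<noteq> {} then ennreal (e i powr \<sigma>) else 0"
    have bound: "(\<Sum>f\<in>F. ?g i f) \<le> ?h i * ennreal (S / L powr \<sigma>)" for i
    proof (cases "U i \<inter> {u..v} = {}")
      case True
      then have "U i \<inter> I f = {}" if "f \<in> F" for f using Isub[OF that] by blast
      then show ?thesis by simp
    next
      case False
      have "e i powr \<sigma> < content_const c \<sigma> * L powr \<sigma>"
        using light_powr_less[OF assms(1) False] by (simp add: L_def)
      then have "e i powr \<sigma> < ((c / 64) powr (\<sigma> / (1 - \<sigma>))) * L powr \<sigma>"
        by (smt (verit) content_const_def mult_right_mono powr_ge_zero min.cobounded2)
      then have "(e i powr \<sigma>) powr ((1 - \<sigma>)/\<sigma>) \<le> (((c / 64) powr (\<sigma> / (1 - \<sigma>))) * L powr \<sigma>) powr ((1 - \<sigma>)/\<sigma>)"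
        using \<sigma> by (intro powr_mono2) auto
      then have ee: "e i powr (1 - \<sigma>) \<le> c / 64 * L powr (1 - \<sigma>)"
        using \<sigma> c by (simp add: powr_mult powr_powr)
      have "4 * e i = 4 * (e i powr \<sigma> * e i powr (1 - \<sigma>))" using epos[of i] by (simp flip: powr_add)
      also have "\<dots> \<le> 4 * (e i powr \<sigma> * (c / 64 * L powr (1 - \<sigma>)))" using ee by (intro mult_left_mono) auto
      also have "\<dots> = \<epsilon> * e i powr \<sigma>" by (simp add: \<epsilon>_def \<kappa>_def)
      finally have e4: "4 * e i \<le> \<epsilon> * e i powr \<sigma>" .
      have "(\<Sum>f\<in>{f\<in>F. U i \<inter> I f \<noteq> {}}. min (e i) (l f) powr \<sigma>) \<le> e i powr \<sigma> * (S / L powr \<sigma>)"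
        unfolding I_def l_def S_def
      proof (rule sum_meeting_le[where \<epsilon> = \<epsilon>, OF F(1)])
        show "0 < W (snd f)" for f :: "real \<times> nat" by (rule Wpos)
        show "W (snd f) powr (1 / \<sigma>) \<le> \<epsilon> * W (snd f)" if "f \<in> F" for f
          using lsmall[OF that] by (simp add: l_def)
        show "\<epsilon> * (W (snd f) + W (snd g)) \<le> \<bar>fst f - fst g\<bar>" if "f \<in> F" "g \<in> F" "f \<noteq> g" for f g
          using F(3) that by blast
        show "L powr \<sigma> \<le> (\<Sum>f\<in>F. W (snd f))" using S by (simp add: S_def)
        show "\<bar>a - b\<bar> \<le> e i" if "a \<in> U i" "b \<in> U i" for a b by (rule U[OF that])
      qed (rule epos e4 \<sigma>(1) eps L0)+
      moreover have "(\<Sum>f\<in>F. ?g i f) = ennreal (\<Sum>f\<in>{f\<in>F. U i \<inter> I f \<noteq> {}}. min (e i) (l f) powr \<sigma>)"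
        by (subst sum.inter_filter[OF F(1), symmetric], rule sum_ennreal) simp
      ultimately show ?thesis using False Spos by (simp add: ennreal_mult[symmetric] ennreal_leI)
    qed
    have "ennreal (content_const c \<sigma> * S) = (\<Sum>f\<in>F. ennreal (content_const c \<sigma> * W (snd f)))"
      using content_const(1)[OF c(1), of \<sigma>] content_const(2)[of c \<sigma>] Wpos by (subst sum_ennreal) (auto simp: S_def sum_distrib_left less_imp_le)
    also have "\<dots> \<le> (\<Sum>f\<in>F. \<Sum>i. ?g i f)" by (intro sum_mono heavy')
    also have "\<dots> = (\<Sum>i. \<Sum>f\<in>F. ?g i f)" by (rule suminf_sum[symmetric]) auto
    also have "\<dots> \<le> (\<Sum>i. ?h i * ennreal (S / L powr \<sigma>))" by (intro suminf_le bound) auto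
    also have "\<dots> = (\<Sum>i. ?h i) * ennreal (S / L powr \<sigma>)" by (rule ennreal_suminf_multc)
    also have "\<dots> < ennreal (content_const c \<sigma> * L powr \<sigma>) * ennreal (S / L powr \<sigma>)"
      using assms(1) Spos L0 unfolding light_def L_def
      by (intro ennreal_mult_strict_right_mono) auto
    also have "\<dots> = ennreal (content_const c \<sigma> * S)"
      using L0 content_const(1)[OF c(1), of \<sigma>] content_const(2)[of c \<sigma>] Spos by (simp add: ennreal_mult[symmetric])
    finally show False by simp
  qed
  then obtain f where f: "f \<in> F" "light U e \<sigma> (content_const c \<sigma>) (fst f - l f / 2) (fst f + l f / 2)" by blast
  show ?thesis
  proof (intro exI conjI)
    show "light U e \<sigma> (content_const c \<sigma>) (fst f - l f / 2) (fst f + l f / 2)" by (rule f)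
    show "u \<le> fst f - l f / 2" "fst f + l f / 2 \<le> v"
      using Isub[OF f(1)] lpos[of f] by (auto simp: I_def)
    show "fst f - l f / 2 < fst f + l f / 2" using lpos[of f] by simp
    show "M \<le> snd f" "fst f \<in> Z (snd f)" using F(2) f(1) m0 by auto
    show "{fst f - l f / 2..fst f + l f / 2} \<subseteq> {fst f - \<rho> (snd f)..fst f + \<rho> (snd f)}"
      using l\<rho>[of f] lpos[of f] by auto
    show "(fst f + l f / 2) - (fst f - l f / 2) \<le> (v - u) / 2"
      using llen[OF f(1)] L0 by (simp add: L_def)
  qed
qed

text \<open>The content bound in contrapositive form: a cover that captures the limsup set inside an
  interval cannot be light there. Every refinement moves to a later level, so the limit point is
  approximated infinitely often.\<close>

lemma light_limsup_point:
  assumes L: "light U e \<sigma> (content_const c \<sigma>) u v" and uv: "u < v" and epos: "\<And>i. 0 < e i"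
    and U: "\<And>i a b. a \<in> U i \<Longrightarrow> b \<in> U i \<Longrightarrow> \<bar>a - b\<bar> \<le> e i"
  shows "\<exists>x\<in>{u..v}. (\<forall>M. \<exists>m\<ge>M. \<exists>z\<in>Z m. \<bar>x - z\<bar> \<le> \<rho> m) \<and> (\<forall>i. x \<notin> U i)"
proof -
  let ?P = "\<lambda>(n::nat) p. fst p < snd p \<and> u \<le> fst p \<and> snd p \<le> v \<and> light U e \<sigma> (content_const c \<sigma>) (fst p) (snd p) \<and> snd p - fst p \<le> (v - u) / 2 ^ n"
  let ?Q = "\<lambda>n p q. fst p \<le> fst q \<and> snd q \<le> snd p \<and> (\<exists>m\<ge>n. \<exists>z\<in>Z m. {fst q..snd q} \<subseteq> {z - \<rho> m..z + \<rho> m})"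
  have "\<exists>J. \<forall>n. ?P n (J n) \<and> ?Q n (J n) (J (Suc n))"
  proof (rule dependent_nat_choice)
    show "\<exists>p. ?P 0 p" by (rule exI[of _ "(u,v)"]) (use L uv in auto)
  next
    fix p n assume p: "?P n p"
    obtain u' v' z m where *: "fst p \<le> u'" "u' < v'" "v' \<le> snd p" "light U e \<sigma> (content_const c \<sigma>) u' v'" "n \<le> m" "z \<in> Z m"
      "{u'..v'} \<subseteq> {z - \<rho> m..z + \<rho> m}" "v' - u' \<le> (snd p - fst p) / 2"
      using light_subinterval[of U e "fst p" "snd p" n] epos U p by blast
    have "v' - u' \<le> (v - u) / 2 ^ Suc n"
    proof -
      have "v' - u' \<le> ((v - u) / 2 ^ n) / 2"
        using order_trans[OF *(8) divide_right_mono[of "snd p - fst p" "(v - u) / 2 ^ n" 2]] p by simp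
      then show ?thesis by (simp add: mult.commute)
    qed
    then show "\<exists>q. ?P (Suc n) q \<and> ?Q n p q"
      using * p by (intro exI[of _ "(u',v')"]) auto
  qed
  then obtain J where J: "\<And>n. ?P n (J n)" "\<And>n. ?Q n (J n) (J (Suc n))" by blast
  have dec: "decseq (\<lambda>n. {fst (J n)..snd (J n)})"
    by (rule decseq_SucI) (use J(2) in auto)
  have "(\<Inter>n. {fst (J n)..snd (J n)}) \<noteq> {}"
  proof (rule compact_nest)
    show "compact {fst (J n)..snd (J n)}" "{fst (J n)..snd (J n)} \<noteq> {}" for n
      using J(1)[of n] by auto
    show "{fst (J n)..snd (J n)} \<subseteq> {fst (J m)..snd (J m)}" if "m \<le> n" for m n
      using dec that by (auto simp: decseq_def)
  qed
  then obtain x where x: "\<And>n. x \<in> {fst (J n)..snd (J n)}" by blast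
  show ?thesis
  proof (intro bexI[of _ x] conjI allI)
    show "x \<in> {u..v}" using x[of 0] J(1)[of 0] by auto
    fix M
    obtain m z where "m \<ge> M" "z \<in> Z m" "{fst (J (Suc M))..snd (J (Suc M))} \<subseteq> {z - \<rho> m..z + \<rho> m}"
      using J(2)[of M] by blast
    then show "\<exists>m\<ge>M. \<exists>z\<in>Z m. \<bar>x - z\<bar> \<le> \<rho> m"
      using x[of "Suc M"] by (intro exI[of _ m] conjI bexI[of _ z]) (auto simp: abs_le_iff)
  next
    fix i
    show "x \<notin> U i"
    proof
      assume xi: "x \<in> U i"
      \<comment> \<open>Lightness of every nested interval bounds the summand of \<open>U i\<close>
        by a power of its shrinking length, which is incompatible with
        \<open>0 < e i\<close>.\<close>
      have "e i powr \<sigma> < (v - u) powr \<sigma> / (2 powr \<sigma>) ^ n" for n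
      proof -
        have "e i powr \<sigma> < content_const c \<sigma> * (snd (J n) - fst (J n)) powr \<sigma>"
          by (rule light_powr_less) (use J(1)[of n] xi x[of n] in auto)
        also have "\<dots> \<le> 1 * (snd (J n) - fst (J n)) powr \<sigma>" using content_const(1)[OF c(1), of \<sigma>] content_const(2)[of c \<sigma>] by (intro mult_right_mono) auto
        also have "\<dots> \<le> 1 * ((v - u) / 2 ^ n) powr \<sigma>"
          using J(1)[of n] \<sigma> by (intro mult_left_mono powr_mono2) auto
        also have "\<dots> = (v - u) powr \<sigma> / (2 powr \<sigma>) ^ n"
        proof -
          have "((2::real) ^ n) powr \<sigma> = (2 powr \<sigma>) ^ n"
            by (simp add: powr_powr mult.commute flip: powr_realpow)
          then show ?thesis using uv by (simp add: powr_divide)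
        qed
        finally show ?thesis .
      qed
      moreover have "(\<lambda>n. (v - u) powr \<sigma> / (2 powr \<sigma>) ^ n) \<longlonglongrightarrow> 0"
        using \<sigma> by (intro LIMSEQ_divide_realpow_zero) auto
      ultimately have "e i powr \<sigma> \<le> 0"
        by (intro LIMSEQ_le_const[of "\<lambda>n. (v - u) powr \<sigma> / (2 powr \<sigma>) ^ n"]) (auto intro: less_imp_le)
      then show False using epos[of i] by simp
    qed
  qed
qed

end

section \<open>Dirichlet's theorem and ubiquity on a line\<close>

text \<open>Pigeonhole: the \<open>(Q + 1) ^ n\<close> vectors with entries between 0 and
  \<open>Q\<close> fall into \<open>Q ^ n\<close> cells of fractional parts, and \<open>q\<close> is
  the difference of two vectors in one cell.\<close>

lemma dirichlet_linear_form:
  fixes x :: "nat \<Rightarrow> real"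
  assumes Q: "0 < Q" and n: "0 < n"
  shows "\<exists>(q :: nat \<Rightarrow> int) (p :: int). (\<exists>i<n. q i \<noteq> 0) \<and> (\<forall>i. \<bar>q i\<bar> \<le> int Q) \<and>
           \<bar>of_int p + (\<Sum>i<n. of_int (q i) * x i)\<bar> \<le> 1 / real Q ^ n"
proof -
  define A where "A = PiE {..<n} (\<lambda>_. {0..Q})"
  define s where "s f = (\<Sum>i<n. real (f i) * x i)" for f :: "nat \<Rightarrow> nat"
  define h where "h f = nat \<lfloor>real Q ^ n * frac (s f)\<rfloor>" for f
  have fA: "finite A" by (auto simp: A_def intro: finite_PiE)
  have cA: "card A = (Q + 1) ^ n" by (simp add: A_def card_PiE)
  have hA: "h ` A \<subseteq> {..<Q ^ n}"
  proof
    fix y assume "y \<in> h ` A"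
    then obtain f where y: "y = h f" by blast
    have "real Q ^ n * frac (s f) < real Q ^ n * 1"
      using Q frac_lt_1[of "s f"] by (intro mult_strict_left_mono) auto
    then have "\<lfloor>real Q ^ n * frac (s f)\<rfloor> < int (Q ^ n)" by (simp add: floor_less_iff)
    then show "y \<in> {..<Q ^ n}" by (simp add: y h_def nat_less_iff Q)
  qed
  have "card (h ` A) \<le> Q ^ n" using card_mono[OF _ hA] by simp
  also have "\<dots> < card A" unfolding cA using n by (intro power_strict_mono) auto
  finally have "\<not> inj_on h A" using card_image by fastforce
  then obtain f g where fg: "f \<in> A" "g \<in> A" "f \<noteq> g" "h f = h g" by (auto simp: inj_on_def)
  define q where "q i = (if i < n then int (f i) - int (g i) else 0)" for i
  define p where "p = \<lfloor>s g\<rfloor> - \<lfloor>s f\<rfloor>"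
  show ?thesis
  proof (intro exI[of _ q] exI[of _ p] conjI allI)
    obtain i where "f i \<noteq> g i" using fg(3) by blast
    have "i < n"
    proof (rule ccontr)
      assume "\<not> i < n"
      then have "f i = undefined" "g i = undefined" using fg(1,2) by (auto simp: A_def PiE_def extensional_def)
      then show False using \<open>f i \<noteq> g i\<close> by simp
    qed
    then show "\<exists>i<n. q i \<noteq> 0" using \<open>f i \<noteq> g i\<close> by (auto simp: q_def)
  next
    fix i show "\<bar>q i\<bar> \<le> int Q"
    proof (cases "i < n")
      case True
      then have "f i \<le> Q" "g i \<le> Q" using fg(1,2) by (auto simp: A_def PiE_def)
      then have "\<bar>int (f i) - int (g i)\<bar> \<le> int Q" by linarith
      then show ?thesis by (simp add: q_def)
    qed (simp add: q_def)
  next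
    have "(\<Sum>i<n. of_int (q i) * x i) = s f - s g"
      by (simp add: s_def q_def sum_subtractf[symmetric] left_diff_distrib)
    then have eq: "of_int p + (\<Sum>i<n. of_int (q i) * x i) = frac (s f) - frac (s g)"
      by (simp add: p_def frac_def)
    have "\<lfloor>real Q ^ n * frac (s f)\<rfloor> = \<lfloor>real Q ^ n * frac (s g)\<rfloor>"
      using fg(4) by (simp add: h_def eq_nat_nat_iff)
    then have "\<bar>real Q ^ n * frac (s f) - real Q ^ n * frac (s g)\<bar> < 1" by linarith
    then have "real Q ^ n * \<bar>frac (s f) - frac (s g)\<bar> < 1"
      by (simp add: abs_mult flip: right_diff_distrib)
    then show "\<bar>of_int p + (\<Sum>i<n. of_int (q i) * x i)\<bar> \<le> 1 / real Q ^ n"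
      unfolding eq using Q by (simp add: field_simps)
  qed
qed

section \<open>Measure of strips on a line\<close>

lemma strip_sets [measurable]: "{w \<in> {u..v}. \<exists>p::int. \<bar>of_int p + a + c * w\<bar> \<le> r} \<in> sets (borel :: real measure)"
  by measurable

text \<open>Each \<open>p\<close> contributes an interval of length \<open>2 * r / k\<close>, and
  the number of relevant \<open>p\<close> is at most \<open>k * (v - u) + 3\<close>, where 3 comes
  from rounding and \<open>r \<le> 1\<close>. The error is kept as \<open>3 / k\<close> because its
  sum over \<open>k\<close> is then only logarithmic.\<close>

lemma emeasure_strip_pos:
  fixes a u v r :: real and k :: int
  assumes "1 \<le> k" "u \<le> v" "0 \<le> r" "r \<le> 1"
  shows "emeasure lborel {w \<in> {u..v}. \<exists>p::int. \<bar>of_int p + a + of_int k * w\<bar> \<le> r} \<le> ennreal (2 * r * (v - u + 3 / of_int k))"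
proof -
  let ?J = "{\<lceil>k * u + a - r\<rceil>..\<lfloor>k * v + a + r\<rfloor>}"
  let ?I = "\<lambda>j::int. {(j - a - r) / k..(j - a + r) / k}"
  have k0: "0 < real_of_int k" using assms(1) by simp
  have "{w \<in> {u..v}. \<exists>p::int. \<bar>of_int p + a + of_int k * w\<bar> \<le> r} \<subseteq> (\<Union>j\<in>?J. ?I j)"
  proof
    fix w assume "w \<in> {w \<in> {u..v}. \<exists>p::int. \<bar>of_int p + a + of_int k * w\<bar> \<le> r}"
    then obtain p :: int where w: "u \<le> w" "w \<le> v" and p: "\<bar>of_int p + a + of_int k * w\<bar> \<le> r" by auto
    have "k * u \<le> k * w" "k * w \<le> k * v" using w k0 by auto
    then have "- p \<in> ?J" using p by (auto simp: ceiling_le_iff le_floor_iff abs_le_iff)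
    moreover have "w \<in> ?I (-p)" using p k0 by (auto simp: abs_le_iff field_simps)
    ultimately show "w \<in> (\<Union>j\<in>?J. ?I j)" by blast
  qed
  then have "emeasure lborel {w \<in> {u..v}. \<exists>p::int. \<bar>of_int p + a + of_int k * w\<bar> \<le> r} \<le> emeasure lborel (\<Union>j\<in>?J. ?I j)"
    by (intro emeasure_mono) auto
  also have "\<dots> \<le> (\<Sum>j\<in>?J. emeasure lborel (?I j))" by (intro emeasure_subadditive_finite) auto
  also have "\<dots> = (\<Sum>j\<in>?J. ennreal (2 * r / k))"
  proof (intro sum.cong refl)
    fix j :: int
    have "(j - a - r) / k \<le> (j - a + r) / k" using k0 assms(3) by (intro divide_right_mono) auto
    then show "emeasure lborel (?I j) = ennreal (2 * r / k)"
      by (simp add: diff_divide_distrib[symmetric])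
  qed
  also have "\<dots> = ennreal (real (card ?J) * (2 * r / k))"
    using k0 assms(3) by (subst sum_ennreal) auto
  also have "\<dots> \<le> ennreal (2 * r * (v - u + 3 / of_int k))"
  proof (rule ennreal_leI)
    have nn: "0 \<le> k * (v - u) + 3" using k0 assms(2) by simp
    have "real (card ?J) \<le> k * (v - u) + 3"
    proof (cases "0 \<le> \<lfloor>k * v + a + r\<rfloor> - \<lceil>k * u + a - r\<rceil> + 1")
      case True
      then have "real (card ?J) = of_int (\<lfloor>k * v + a + r\<rfloor> - \<lceil>k * u + a - r\<rceil> + 1)" by simp
      also have "\<dots> \<le> (k * v + a + r) - (k * u + a - r) + 1" by linarith
      also have "\<dots> \<le> k * (v - u) + 3" using assms(4) by (simp add: algebra_simps)
      finally show ?thesis .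
    qed (use nn in simp)
    then have "real (card ?J) * (2 * r / k) \<le> (k * (v - u) + 3) * (2 * r / k)"
      using k0 assms(3) by (intro mult_right_mono) auto
    also have "\<dots> = 2 * r * (v - u + 3 / of_int k)" using k0 by (simp add: field_simps)
    finally show "real (card ?J) * (2 * r / k) \<le> 2 * r * (v - u + 3 / of_int k)" .
  qed
  finally show ?thesis .
qed

lemma emeasure_strip:
  fixes a u v r :: real and k :: int
  assumes "k \<noteq> 0" "u \<le> v" "0 \<le> r" "r \<le> 1"
  shows "emeasure lborel {w \<in> {u..v}. \<exists>p::int. \<bar>of_int p + a + of_int k * w\<bar> \<le> r} \<le> ennreal (2 * r * (v - u + 3))"
proof -
  define k' a' where "k' = \<bar>k\<bar>" and "a' = (if 0 < k then a else - a)"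
  have k': "1 \<le> k'" using assms(1) by (auto simp: k'_def)
  have "(\<exists>p::int. \<bar>of_int p + a + of_int k * w\<bar> \<le> r) \<longleftrightarrow> (\<exists>p::int. \<bar>of_int p + a' + of_int k' * w\<bar> \<le> r)" for w
  proof (cases "0 < k")
    case False
    have "\<bar>of_int (- p) + a' + of_int k' * w\<bar> = \<bar>of_int p + a + of_int k * w\<bar>" for p
    proof -
      have "of_int (- p) + a' + of_int k' * w = - (of_int p + a + of_int k * w)"
        using False by (simp add: k'_def a'_def)
      then show ?thesis by simp
    qed
    then show ?thesis by (metis minus_minus)
  qed (simp add: k'_def a'_def)
  then have "emeasure lborel {w \<in> {u..v}. \<exists>p::int. \<bar>of_int p + a + of_int k * w\<bar> \<le> r}
      \<le> ennreal (2 * r * (v - u + 3 / of_int k'))"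
    using emeasure_strip_pos[OF k' assms(2-4), of a'] by simp
  also have "\<dots> \<le> ennreal (2 * r * (v - u + 3))"
    using k' assms by (intro ennreal_leI mult_left_mono add_left_mono) (auto simp: field_simps)
  finally show ?thesis .
qed

lemma harm_le: "0 < n \<Longrightarrow> harm n \<le> ln (real n) + 1"
  using decseqD[OF decseq_harm_diff_ln, of 0 "n - 1"] by (simp add: harm_def)

text \<open>This is what Dirichlet's theorem in \<open>Suc d\<close> variables says when the last
  coefficient vanishes. In \<open>d\<close> variables the exponent \<open>Suc d\<close> exceeds the
  Dirichlet exponent by one, so such points are exceptional.\<close>

definition well_approx :: "nat \<Rightarrow> nat \<Rightarrow> (nat \<Rightarrow> real) \<Rightarrow> bool" where
  "well_approx d Q y \<longleftrightarrow> (\<exists>(q :: nat \<Rightarrow> int) (p :: int). (\<exists>i<d. q i \<noteq> 0) \<and> (\<forall>i<d. \<bar>q i\<bar> \<le> int Q) \<and>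
           \<bar>of_int p + (\<Sum>i<d. of_int (q i) * y i)\<bar> \<le> 1 / real Q ^ Suc d)"

text \<open>The points where the rational hyperplanes of height at most \<open>Q\<close> meet the vertical line over \<open>y\<close>.\<close>
definition resonant :: "nat \<Rightarrow> (nat \<Rightarrow> real) \<Rightarrow> nat \<Rightarrow> real set" where
  "resonant d y Q = {- (of_int p + (\<Sum>i<d. of_int (q i) * y i)) / of_int k | (p :: int) (q :: nat \<Rightarrow> int) (k :: int).
      1 \<le> k \<and> k \<le> int Q \<and> (\<forall>i<d. \<bar>q i\<bar> \<le> int Q)}"

lemma resonantI:
  "1 \<le> k \<Longrightarrow> k \<le> int Q \<Longrightarrow> (\<And>i. i < d \<Longrightarrow> \<bar>q i\<bar> \<le> int Q) \<Longrightarrow>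
    - (of_int p + (\<Sum>i<d. of_int (q i) * y i)) / of_int k \<in> resonant d y Q"
  unfolding resonant_def by blast

text \<open>A separated set of greatest cardinality is also a net, since a far point could be added;
  \<open>card_separated_le\<close> bounds the cardinalities.\<close>

lemma maximal_separated:
  fixes S :: "real set"
  assumes "S \<subseteq> {u..v}" "u \<le> v" "0 < D"
  shows "\<exists>P. finite P \<and> P \<subseteq> S \<and> (\<forall>a\<in>P. \<forall>b\<in>P. a \<noteq> b \<longrightarrow> D \<le> \<bar>a - b\<bar>) \<and> (\<forall>z\<in>S. \<exists>a\<in>P. \<bar>z - a\<bar> \<le> D)"
proof -
  let ?good = "\<lambda>P. finite P \<and> P \<subseteq> S \<and> (\<forall>a\<in>P. \<forall>b\<in>P. a \<noteq> b \<longrightarrow> D \<le> \<bar>a - b\<bar>)"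
  have "\<exists>P. ?good P \<and> (\<forall>R. ?good R \<longrightarrow> card R \<le> card P)"
  proof (rule ex_has_greatest_nat[where b = "Suc (nat \<lceil>(v - u) / D + 1\<rceil>)"])
    show "?good {}" by simp
    show "\<forall>P. ?good P \<longrightarrow> card P < Suc (nat \<lceil>(v - u) / D + 1\<rceil>)"
    proof (intro allI impI)
      fix P assume P: "?good P"
      have "real (card P) \<le> (v - u) / D + 1"
        by (rule card_separated_le) (use P assms in auto)
      then show "card P < Suc (nat \<lceil>(v - u) / D + 1\<rceil>)" by linarith
    qed
  qed
  then obtain P where P: "?good P" "\<And>R. ?good R \<Longrightarrow> card R \<le> card P" by blast
  have "\<exists>a\<in>P. \<bar>z - a\<bar> \<le> D" if z: "z \<in> S" for z
  proof (rule ccontr)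
    assume "\<not> (\<exists>a\<in>P. \<bar>z - a\<bar> \<le> D)"
    then have far: "\<And>a. a \<in> P \<Longrightarrow> D < \<bar>z - a\<bar>" by (auto simp: not_le)
    then have "z \<notin> P" using assms(3) by force
    have "?good (insert z P)"
      using P(1) z far by (auto simp: abs_minus_commute intro: less_imp_le)
    then have "card (insert z P) \<le> card P" by (rule P(2))
    then show False using \<open>z \<notin> P\<close> P(1) by simp
  qed
  then show ?thesis using P(1) by blast
qed

text \<open>Dirichlet's theorem puts every point of the line close to a hyperplane. The points for which the
  coefficient along the line is below \<open>Q / E\<close> have small measure, and every other one lies within
  \<open>E / Q ^ (d + 2)\<close> of a resonant point.\<close>
lemma fibre_ubiquity:
  fixes d :: nat and L :: real
  assumes L: "0 < L"
  defines "E \<equiv> 8 * 3 ^ d :: real"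
  shows "\<exists>Q0. \<forall>Q\<ge>Q0. \<forall>u v y. v - u = L \<longrightarrow> \<not> well_approx d Q y \<longrightarrow>
    (\<exists>P. finite P \<and> P \<subseteq> resonant d y Q \<inter> {u..v} \<and> 1/16 * (real Q ^ (d+2) / E) * L \<le> real (card P) \<and>
         (\<forall>a\<in>P. \<forall>b\<in>P. a \<noteq> b \<longrightarrow> 1 / (real Q ^ (d+2) / E) \<le> \<bar>a - b\<bar>))"
proof -
  have E: "8 \<le> E" by (simp add: E_def)
  \<comment> \<open>Bounds the part of the bad set that stems from the errors
    \<open>3 / k\<close>.\<close>
  have "eventually (\<lambda>Q::nat. 6 * 3 ^ d * ((ln (real Q) + 1) / real Q) < L / 8) sequentially"
    using L by real_asymp
  moreover have "eventually (\<lambda>Q::nat. 2 * (E / real Q ^ (d+2)) < L / 8) sequentially"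
  proof -
    have "eventually (\<lambda>Q::nat. 2 * (E / real Q) < L / 8) sequentially" using L by real_asymp
    then show ?thesis using eventually_ge_at_top[of 1]
    proof eventually_elim
      case (elim Q)
      have "real Q ^ 1 \<le> real Q ^ (d+2)" using elim by (intro power_increasing) auto
      then have "E / real Q ^ (d+2) \<le> E / real Q" using E elim by (intro divide_left_mono) auto
      then show ?case using elim by linarith
    qed
  qed
  ultimately have "eventually (\<lambda>Q::nat. 1 \<le> Q \<and> 6 * 3 ^ d * ((ln (real Q) + 1) / real Q) < L / 8
      \<and> 2 * (E / real Q ^ (d+2)) < L / 8) sequentially"
    using eventually_ge_at_top[of 1] by eventually_elim auto
  then obtain Q0 where Q0: "\<And>Q. Q0 \<le> Q \<Longrightarrow> 1 \<le> Q \<and> 6 * 3 ^ d * ((ln (real Q) + 1) / real Q) < L / 8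
      \<and> 2 * (E / real Q ^ (d+2)) < L / 8"
    unfolding eventually_sequentially by blast
  show ?thesis
  proof (rule exI[of _ Q0], intro allI impI)
    fix Q :: nat and u v :: real and y :: "nat \<Rightarrow> real"
    assume "Q0 \<le> Q" and uv: "v - u = L" and nwa: "\<not> well_approx d Q y"
    define \<Delta> where "\<Delta> = E / real Q ^ (d+2)"
    have Q: "1 \<le> Q" and Qln: "6 * 3 ^ d * ((ln (real Q) + 1) / real Q) < L / 8" and \<Delta>L: "2 * \<Delta> < L / 8"
      using Q0[OF \<open>Q0 \<le> Q\<close>] by (auto simp: \<Delta>_def)
    have \<Delta>: "0 < \<Delta>" using E Q by (simp add: \<Delta>_def)
    define r where "r = 1 / real Q ^ Suc d"
    have "1 \<le> real Q ^ Suc d" using Q by (intro one_le_power) auto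
    then have r: "0 \<le> r" "r \<le> 1" unfolding r_def by (auto simp: divide_le_eq_1 simp del: power_Suc)
    define s where "s q = (\<Sum>i<d. of_int (q i) * y i)" for q :: "nat \<Rightarrow> int"
    define A where "A = PiE {..<d} (\<lambda>_. {- int Q..int Q})"
    have fA: "finite A" by (auto simp: A_def intro: finite_PiE)
    define T where "T k q = {w \<in> {u..v}. \<exists>p::int. \<bar>of_int p + s q + of_int k * w\<bar> \<le> r}" for k :: int and q
    \<comment> \<open>For coefficients below \<open>Q / E\<close>, dividing by \<open>k\<close>
      would put the resonant point too far from \<open>w\<close>; these points are discarded
      instead.\<close>
    define K where "K = {k::int. 1 \<le> k \<and> of_int k * E < real Q}"
    have KQ: "K \<subseteq> {1..int Q}"
    proof
      fix k assume "k \<in> K"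
      then have k: "1 \<le> k" "of_int k * E < real Q" by (auto simp: K_def)
      have "real_of_int k * 1 \<le> of_int k * E" using k(1) E by (intro mult_left_mono) auto
      then have "real_of_int k < real_of_int (int Q)" using k(2) by simp
      then show "k \<in> {1..int Q}" using k(1) by (simp only: of_int_less_iff atLeastAtMost_iff less_imp_le)
    qed
    then have fK: "finite K" by (rule finite_subset) simp
    define Bad where "Bad = (\<Union>k\<in>K. \<Union>q\<in>A. T k q)"
    define S where "S = resonant d y Q \<inter> {u..v}"
    have Tm: "T k q \<in> sets borel" for k q unfolding T_def by (rule strip_sets)
    have Bm: "Bad \<in> sets borel" unfolding Bad_def using fK fA Tm by (intro sets.finite_UN) auto
    have harm: "(\<Sum>k\<in>K. 1 / real_of_int k) \<le> ln (real Q) + 1"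
    proof -
      have "(\<Sum>k\<in>K. 1 / real_of_int k) \<le> (\<Sum>k\<in>{1..int Q}. 1 / real_of_int k)"
        using KQ by (intro sum_mono2) auto
      also have "{1..int Q} = int ` {1..Q}" by (simp add: image_int_atLeastAtMost)
      also have "(\<Sum>k\<in>int ` {1..Q}. 1 / real_of_int k) = harm Q"
        by (simp add: sum.reindex harm_def inverse_eq_divide)
      also have "\<dots> \<le> ln (real Q) + 1" using harm_le[of Q] Q by simp
      finally show ?thesis .
    qed
    have cK: "real (card K) \<le> real Q / E"
    proof -
      have "K \<subseteq> {1..\<lfloor>real Q / E\<rfloor>}" using E by (auto simp: K_def le_floor_iff field_simps)
      then have "card K \<le> card {1..\<lfloor>real Q / E\<rfloor>}" by (intro card_mono) auto
      then have "real (card K) \<le> real (nat \<lfloor>real Q / E\<rfloor>)" by simp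
      also have "\<dots> \<le> real Q / E" using E by (simp add: of_nat_floor)
      finally show ?thesis .
    qed
    have "emeasure lborel Bad \<le> (\<Sum>k\<in>K. \<Sum>q\<in>A. emeasure lborel (T k q))"
      unfolding Bad_def using fK fA Tm
      by (intro order_trans[OF emeasure_subadditive_finite] sum_mono emeasure_subadditive_finite)
         (auto intro!: sets.finite_UN)
    also have "\<dots> \<le> (\<Sum>k\<in>K. \<Sum>q\<in>A. ennreal (2 * r * (L + 3 / of_int k)))"
    proof (intro sum_mono)
      fix k q assume "k \<in> K" "q \<in> A"
      then show "emeasure lborel (T k q) \<le> ennreal (2 * r * (L + 3 / of_int k))"
        unfolding T_def using emeasure_strip_pos[of k u v r "s q"] r L uv by (simp add: K_def)
    qed
    also have "\<dots> = ennreal (\<Sum>k\<in>K. \<Sum>q\<in>A. 2 * r * (L + 3 / of_int k))"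
    proof -
      have nn: "0 \<le> 2 * r * (L + 3 / of_int k)" if "k \<in> K" for k
        using that r L by (auto simp: K_def)
      have "(\<Sum>k\<in>K. \<Sum>q\<in>A. ennreal (2 * r * (L + 3 / of_int k))) = (\<Sum>k\<in>K. ennreal (\<Sum>q\<in>A. 2 * r * (L + 3 / of_int k)))"
        by (intro sum.cong refl sum_ennreal nn)
      also have "\<dots> = ennreal (\<Sum>k\<in>K. \<Sum>q\<in>A. 2 * r * (L + 3 / of_int k))"
        by (intro sum_ennreal sum_nonneg nn)
      finally show ?thesis .
    qed
    also have "\<dots> \<le> ennreal (3 * L / 8)"
    proof (rule ennreal_leI)
      have "real (card A) = (2 * real Q + 1) ^ d" by (simp add: A_def card_PiE)
      also have "\<dots> \<le> (3 * real Q) ^ d" using Q by (intro power_mono) auto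
      finally have cA: "real (card A) \<le> (3 * real Q) ^ d" .
      have "(\<Sum>k\<in>K. \<Sum>q\<in>A. 2 * r * (L + 3 / of_int k)) = real (card A) * (2 * r * (real (card K) * L + 3 * (\<Sum>k\<in>K. 1 / of_int k)))"
        by (simp add: sum_distrib_left sum.distrib distrib_left mult_ac)
      also have "\<dots> \<le> (3 * real Q) ^ d * (2 * r * (real Q / E * L + 3 * (ln (real Q) + 1)))"
      proof (rule mult_mono[OF cA mult_left_mono])
        have "real (card K) * L \<le> real Q / E * L" using cK L by (intro mult_right_mono) auto
        then show "real (card K) * L + 3 * (\<Sum>k\<in>K. 1 / of_int k) \<le> real Q / E * L + 3 * (ln (real Q) + 1)"
          using harm by (intro add_mono mult_left_mono) auto
        have "0 \<le> (\<Sum>k\<in>K. 1 / real_of_int k)" by (rule sum_nonneg) (simp add: K_def)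
        moreover have "0 \<le> real (card K) * L" using L by simp
        ultimately have "0 \<le> real (card K) * L + 3 * (\<Sum>k\<in>K. 1 / real_of_int k)" by linarith
        then show "0 \<le> 2 * r * (real (card K) * L + 3 * (\<Sum>k\<in>K. 1 / of_int k))"
          using r(1) by (intro mult_nonneg_nonneg) auto
      qed (use r in simp_all)
      also have "\<dots> = 2 * 3 ^ d * (L / E) + 6 * 3 ^ d * ((ln (real Q) + 1) / real Q)"
        using Q E by (simp add: r_def power_mult_distrib field_simps)
      \<comment> \<open>Origin of \<open>E = 8 * 3 ^ d\<close>: at most \<open>(3 * Q) ^ d\<close>
        vectors and \<open>Q / E\<close> values of \<open>k\<close> give strips whose main term is a
        quarter of the interval.\<close>
      also have "2 * 3 ^ d * (L / E) = L / 4" by (simp add: E_def)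
      also have "L / 4 + 6 * 3 ^ d * ((ln (real Q) + 1) / real Q) \<le> 3 * L / 8" using Qln by simp
      finally show "(\<Sum>k\<in>K. \<Sum>q\<in>A. 2 * r * (L + 3 / of_int k)) \<le> 3 * L / 8" .
    qed
    finally have Bad: "emeasure lborel Bad \<le> ennreal (3 * L / 8)" .
    have "S \<subseteq> {u..v}" "u \<le> v" using uv L by (auto simp: S_def)
    from maximal_separated[OF this \<Delta>] obtain P where P: "finite P" "P \<subseteq> S"
      "\<forall>a\<in>P. \<forall>b\<in>P. a \<noteq> b \<longrightarrow> \<Delta> \<le> \<bar>a - b\<bar>" "\<forall>z\<in>S. \<exists>a\<in>P. \<bar>z - a\<bar> \<le> \<Delta>" by blast
    have cover: "{u + \<Delta>..v - \<Delta>} \<subseteq> Bad \<union> (\<Union>a\<in>P. {a - 2 * \<Delta>..a + 2 * \<Delta>})"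
    proof
      fix w assume w: "w \<in> {u + \<Delta>..v - \<Delta>}"
      obtain q0 :: "nat \<Rightarrow> int" and p0 :: int where q0: "\<exists>i<Suc d. q0 i \<noteq> 0" "\<forall>i. \<bar>q0 i\<bar> \<le> int Q"
        "\<bar>of_int p0 + (\<Sum>i<Suc d. of_int (q0 i) * (y(d := w)) i)\<bar> \<le> 1 / real Q ^ Suc d"
        using dirichlet_linear_form[of Q "Suc d" "y(d := w)"] Q by auto
      then have e0: "\<bar>of_int p0 + s q0 + of_int (q0 d) * w\<bar> \<le> r" by (simp add: s_def r_def add.assoc)
      \<comment> \<open>Otherwise the approximation would not involve \<open>w\<close>, and
        \<open>y\<close> itself would be well approximable.\<close>
      have qd: "q0 d \<noteq> 0"
      proof
        assume "q0 d = 0"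
        then have "\<exists>i<d. q0 i \<noteq> 0" using q0(1) less_Suc_eq by metis
        moreover have "\<bar>of_int p0 + s q0\<bar> \<le> r" using e0 \<open>q0 d = 0\<close> by simp
        ultimately show False using nwa q0(2) unfolding well_approx_def s_def r_def by blast
      qed
      \<comment> \<open>The relation is multiplied by a sign, as \<open>resonant\<close> asks for a
        positive denominator.\<close>
      define sg :: int where "sg = (if 0 < q0 d then 1 else - 1)"
      define q where "q i = sg * q0 i" for i
      define p where "p = sg * p0"
      have k1: "1 \<le> q d" using qd by (simp add: q_def sg_def)
      have qQ: "\<bar>q i\<bar> \<le> int Q" for i using q0(2) by (simp add: q_def sg_def)
      have "of_int p + s q + of_int (q d) * w = of_int sg * (of_int p0 + s q0 + of_int (q0 d) * w)"
        by (simp add: p_def q_def s_def distrib_left sum_distrib_left mult_ac)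
      then have e1: "\<bar>of_int p + s q + of_int (q d) * w\<bar> \<le> r" using e0 by (simp add: sg_def abs_mult)
      show "w \<in> Bad \<union> (\<Union>a\<in>P. {a - 2 * \<Delta>..a + 2 * \<Delta>})"
      proof (cases "of_int (q d) * E < real Q")
        case True
        define q' where "q' = restrict q {..<d}"
        have "q' \<in> A" using qQ by (auto simp: q'_def A_def abs_le_iff minus_le_iff)
        moreover have "s q' = s q" by (simp add: s_def q'_def)
        moreover have "w \<in> {u..v}" using w \<Delta> by auto
        ultimately have "w \<in> T (q d) q'" using e1 unfolding T_def by (intro CollectI conjI exI[of _ p]) simp_all
        then have "w \<in> Bad" using \<open>q' \<in> A\<close> True k1 unfolding Bad_def K_def by blast
        then show ?thesis by simp
      next
        case False
        define z where "z = - (of_int p + s q) / of_int (q d)"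
        have k0: "0 < real_of_int (q d)" using k1 by simp
        have "\<bar>w - z\<bar> = \<bar>of_int p + s q + of_int (q d) * w\<bar> / of_int (q d)"
        proof -
          have "w - z = (of_int p + s q + of_int (q d) * w) / of_int (q d)" using k0 by (simp add: z_def field_simps)
          then show ?thesis using k0 by simp
        qed
        also have "\<dots> \<le> r / of_int (q d)" using e1 k0 by (intro divide_right_mono) auto
        also have "\<dots> \<le> r / (real Q / E)"
          using False r E Q k0 by (intro divide_left_mono) (auto simp: field_simps)
        also have "\<dots> = \<Delta>" using Q E by (simp add: r_def \<Delta>_def field_simps)
        finally have wz: "\<bar>w - z\<bar> \<le> \<Delta>" .
        have "z \<in> resonant d y Q" unfolding z_def s_def
          using k1 qQ[of d] qQ by (intro resonantI) auto
        moreover have "z \<in> {u..v}" using wz w by (auto simp: abs_le_iff)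
        ultimately have "z \<in> S" by (simp add: S_def)
        then obtain a where "a \<in> P" "\<bar>z - a\<bar> \<le> \<Delta>" using P(4) by blast
        then have "a \<in> P \<and> w \<in> {a - 2 * \<Delta>..a + 2 * \<Delta>}" using wz by (auto simp: abs_le_iff)
        then show ?thesis by blast
      qed
    qed
    \<comment> \<open>The margins take less than \<open>L / 8\<close> and the bad set at most
      \<open>3 * L / 8\<close>; the remaining half is covered by pieces of length
      \<open>4 * \<Delta>\<close> about the net points, which bounds their number from
      below.\<close>
    have "ennreal (L - 2 * \<Delta>) = emeasure lborel {u + \<Delta>..v - \<Delta>}" using uv \<Delta>L L by (simp add: algebra_simps)
    also have "\<dots> \<le> emeasure lborel (Bad \<union> (\<Union>a\<in>P. {a - 2 * \<Delta>..a + 2 * \<Delta>}))"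
      using cover Bm P(1) by (intro emeasure_mono) (auto intro!: sets.Un sets.finite_UN)
    also have "\<dots> \<le> emeasure lborel Bad + emeasure lborel (\<Union>a\<in>P. {a - 2 * \<Delta>..a + 2 * \<Delta>})"
      using Bm P(1) by (intro emeasure_subadditive) (auto intro!: sets.finite_UN)
    also have "\<dots> \<le> ennreal (3 * L / 8) + (\<Sum>a\<in>P. emeasure lborel {a - 2 * \<Delta>..a + 2 * \<Delta>})"
      using P(1) by (intro add_mono Bad emeasure_subadditive_finite) auto
    also have "\<dots> = ennreal (3 * L / 8) + ennreal (real (card P) * (4 * \<Delta>))"
      using \<Delta> by (simp add: ennreal_mult ennreal_of_nat_eq_real_of_nat)
    also have "\<dots> = ennreal (3 * L / 8 + real (card P) * (4 * \<Delta>))"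
      using L \<Delta> by (subst ennreal_plus) auto
    finally have "L - 2 * \<Delta> \<le> 3 * L / 8 + real (card P) * (4 * \<Delta>)"
      using L \<Delta> by (subst (asm) ennreal_le_iff) auto
    then have "L / 8 \<le> real (card P) * \<Delta>" using \<Delta>L by linarith
    then have "1/16 * (real Q ^ (d+2) / E) * L \<le> real (card P)"
    proof -
      have "1/16 * (real Q ^ (d+2) / E) * L = (L / 16) / \<Delta>" using E Q by (simp add: \<Delta>_def)
      also have "\<dots> \<le> (real (card P) * \<Delta>) / \<Delta>" using \<open>L / 8 \<le> _\<close> L \<Delta> by (intro divide_right_mono) auto
      finally show ?thesis using \<Delta> by simp
    qed
    moreover have "1 / (real Q ^ (d+2) / E) = \<Delta>" by (simp add: \<Delta>_def)
    ultimately show "\<exists>P. finite P \<and> P \<subseteq> resonant d y Q \<inter> {u..v} \<and> 1/16 * (real Q ^ (d+2) / E) * L \<le> real (card P) \<and>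
         (\<forall>a\<in>P. \<forall>b\<in>P. a \<noteq> b \<longrightarrow> 1 / (real Q ^ (d+2) / E) \<le> \<bar>a - b\<bar>)"
      using P by (intro exI[of _ P]) (auto simp: S_def)
  qed
qed

section \<open>Slicing and infinite measure\<close>

interpretation lborel_product: product_sigma_finite "\<lambda>_. lborel :: real measure"
  by standard

lemma PiE_box_sets [measurable]:
  assumes "finite I"
  shows "PiE I (\<lambda>i. {l i..h i}) \<in> sets (PiM I (\<lambda>_. lborel :: real measure))"
  using assms by (intro sets_PiM_I_finite) auto

lemma emeasure_PiE_box:
  fixes l h :: "'i \<Rightarrow> real"
  assumes "finite I" "\<And>i. i \<in> I \<Longrightarrow> l i \<le> h i"
  shows "emeasure (PiM I (\<lambda>_. lborel)) (PiE I (\<lambda>i. {l i..h i})) = ennreal (\<Prod>i\<in>I. h i - l i)"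
proof -
  have "emeasure (PiM I (\<lambda>_. lborel)) (PiE I (\<lambda>i. {l i..h i})) = (\<Prod>i\<in>I. emeasure lborel {l i..h i})"
    using assms(1) by (intro lborel_product.emeasure_PiM) auto
  also have "\<dots> = (\<Prod>i\<in>I. ennreal (h i - l i))" using assms(2) by (intro prod.cong) auto
  also have "\<dots> = ennreal (\<Prod>i\<in>I. h i - l i)" using assms(2) by (intro prod_ennreal) auto
  finally show ?thesis .
qed

lemma strip_box_sets [measurable]:
  fixes q :: "'i \<Rightarrow> int" and r :: real
  assumes I: "finite I"
  shows "{y \<in> PiE I (\<lambda>_. {lo..hi}). \<exists>p::int. \<bar>of_int p + (\<Sum>i\<in>I. of_int (q i) * y i)\<bar> \<le> r}
           \<in> sets (PiM I (\<lambda>_. lborel :: real measure))"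
proof -
  let ?M = "PiM I (\<lambda>_. lborel :: real measure)"
  have [measurable]: "(\<lambda>y. y i) \<in> borel_measurable ?M" if "i \<in> I" for i
    using measurable_component_singleton[OF that, of "\<lambda>_. lborel :: real measure"] by simp
  have [measurable]: "(\<lambda>y. \<Sum>i\<in>I. of_int (q i) * y i) \<in> borel_measurable ?M"
    by (intro borel_measurable_sum borel_measurable_times) auto
  have "{y \<in> space ?M. \<exists>p::int. \<bar>of_int p + (\<Sum>i\<in>I. of_int (q i) * y i)\<bar> \<le> r} \<in> sets ?M"
    by measurable
  then have "PiE I (\<lambda>_. {lo..hi}) \<inter> {y \<in> space ?M. \<exists>p::int. \<bar>of_int p + (\<Sum>i\<in>I. of_int (q i) * y i)\<bar> \<le> r} \<in> sets ?M"
    using I by (intro sets.Int PiE_box_sets)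
  moreover have "PiE I (\<lambda>_. {lo..hi}) \<inter> {y \<in> space ?M. \<exists>p::int. \<bar>of_int p + (\<Sum>i\<in>I. of_int (q i) * y i)\<bar> \<le> r}
     = {y \<in> PiE I (\<lambda>_. {lo..hi}). \<exists>p::int. \<bar>of_int p + (\<Sum>i\<in>I. of_int (q i) * y i)\<bar> \<le> r}"
    by (auto simp: space_PiM PiE_def)
  ultimately show ?thesis by simp
qed

text \<open>Fubini in a coordinate \<open>j\<close> with nonzero coefficient: the one-dimensional
  bound is uniform in the other coordinates, whose box has volume
  \<open>(hi - lo) ^ (card I - 1)\<close>.\<close>

lemma emeasure_strip_box:
  fixes q :: "'i \<Rightarrow> int" and r :: real
  assumes I: "finite I" "j \<in> I" "q j \<noteq> 0" and lo: "lo \<le> hi" and r: "0 \<le> r" "r \<le> 1"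
  shows "emeasure (PiM I (\<lambda>_. lborel)) {y \<in> PiE I (\<lambda>_. {lo..hi}). \<exists>p::int. \<bar>of_int p + (\<Sum>i\<in>I. of_int (q i) * y i)\<bar> \<le> r}
    \<le> ennreal (2 * r * (hi - lo + 3) * (hi - lo) ^ (card I - 1))"
proof -
  define J where "J = I - {j}"
  have J: "finite J" "j \<notin> J" "I = insert j J" "card J = card I - 1" using I by (auto simp: J_def)
  let ?A = "{y \<in> PiE I (\<lambda>_. {lo..hi}). \<exists>p::int. \<bar>of_int p + (\<Sum>i\<in>I. of_int (q i) * y i)\<bar> \<le> r}"
  let ?B = "\<lambda>x. {w \<in> {lo..hi}. \<exists>p::int. \<bar>of_int p + (\<Sum>i\<in>J. of_int (q i) * x i) + of_int (q j) * w\<bar> \<le> r}"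
  let ?C = "ennreal (2 * r * (hi - lo + 3))"
  have mA: "?A \<in> sets (PiM I (\<lambda>_. lborel))" by (rule strip_box_sets[OF I(1)])
  have "emeasure (PiM I (\<lambda>_. lborel)) ?A = (\<integral>\<^sup>+ y. indicator ?A y \<partial>PiM I (\<lambda>_. lborel))"
    using mA by simp
  also have "\<dots> = (\<integral>\<^sup>+ x. (\<integral>\<^sup>+ w. indicator ?A (x(j := w)) \<partial>lborel) \<partial>PiM J (\<lambda>_. lborel))"
    using mA J by (simp only: J(3)) (rule lborel_product.product_nn_integral_insert, auto)
  also have "\<dots> \<le> (\<integral>\<^sup>+ x. ?C * indicator (PiE J (\<lambda>_. {lo..hi})) x \<partial>PiM J (\<lambda>_. lborel))"
  proof (rule nn_integral_mono)
    fix x assume "x \<in> space (PiM J (\<lambda>_. lborel :: real measure))"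
    show "(\<integral>\<^sup>+ w. indicator ?A (x(j := w)) \<partial>lborel) \<le> ?C * indicator (PiE J (\<lambda>_. {lo..hi})) x"
    proof (cases "x \<in> PiE J (\<lambda>_. {lo..hi})")
      case True
      have sum: "(\<Sum>i\<in>I. of_int (q i) * (x(j := w)) i) = (\<Sum>i\<in>J. of_int (q i) * x i) + of_int (q j) * w" for w
      proof -
        have "(\<Sum>i\<in>J. of_int (q i) * (x(j := w)) i) = (\<Sum>i\<in>J. of_int (q i) * x i)"
          using J(2) by (intro sum.cong) auto
        then show ?thesis using J(1,2) by (simp add: J(3))
      qed
      have "(\<integral>\<^sup>+ w. indicator ?A (x(j := w)) \<partial>lborel) \<le> (\<integral>\<^sup>+ w. indicator (?B x) w \<partial>lborel)"
      proof (rule nn_integral_mono)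
        fix w
        have "w \<in> ?B x" if "x(j := w) \<in> ?A"
          using that sum[of w] I(2) by (auto simp: PiE_def Pi_def add.assoc)
        then show "(indicator ?A (x(j := w)) :: ennreal) \<le> indicator (?B x) w"
          by (auto simp: indicator_def)
      qed
      also have "\<dots> = emeasure lborel (?B x)" using strip_sets by (subst nn_integral_indicator) auto
      also have "\<dots> \<le> ?C" by (rule emeasure_strip[OF I(3) lo r])
      finally show ?thesis using True by simp
    next
      case False
      have "x(j := w) \<notin> ?A" for w
      proof
        assume "x(j := w) \<in> ?A"
        then have "x(j := w) \<in> PiE I (\<lambda>_. {lo..hi})" by simp
        have "x i \<in> {lo..hi}" if i: "i \<in> J" for i
          using PiE_mem[OF \<open>x(j := w) \<in> PiE I (\<lambda>_. {lo..hi})\<close>, of i] i J(2,3) by (cases "i = j") auto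
        moreover have "x \<in> extensional J" using \<open>x \<in> space _\<close> by (simp add: space_PiM PiE_def)
        ultimately show False using False by (auto simp: PiE_def Pi_def)
      qed
      then have "(\<lambda>w. indicator ?A (x(j := w)) :: ennreal) = (\<lambda>_. 0)"
        by (intro ext indicator_simps(2))
      then show ?thesis by (simp only: nn_integral_const zero_le mult_zero_left)
    qed
  qed
  also have "\<dots> = ?C * emeasure (PiM J (\<lambda>_. lborel)) (PiE J (\<lambda>_. {lo..hi}))"
    using J(1) by (intro nn_integral_cmult_indicator PiE_box_sets)
  also have "emeasure (PiM J (\<lambda>_. lborel)) (PiE J (\<lambda>_. {lo..hi})) = ennreal ((hi - lo) ^ card J)"
    using emeasure_PiE_box[OF J(1), of "\<lambda>_. lo" "\<lambda>_. hi"] lo by simp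
  also have "?C * \<dots> = ennreal (2 * r * (hi - lo + 3) * (hi - lo) ^ (card I - 1))"
    using r lo J(4) by (simp add: ennreal_mult)
  finally show ?thesis .
qed

text \<open>Borel-Cantelli: at height Q there are at most of order Q^d vectors \<open>q\<close>,
  each with a strip of measure at most of order 1/Q^(d+1), so the exceptional set has measure at
  most of order 1/Q. This bound is summable along powers of \<open>b\<close>, though not along all
  heights, which is one reason for working with geometric levels.\<close>

lemma AE_not_well_approx:
  fixes b :: nat
  assumes b: "2 \<le> b"
  shows "AE y in PiM {..<d} (\<lambda>_. lborel). y \<in> PiE {..<d} (\<lambda>_. {0..1}) \<longrightarrow>
           (\<forall>\<^sub>F m in sequentially. \<not> well_approx d (b ^ m) y)"
proof -
  let ?M = "PiM {..<d} (\<lambda>_. lborel :: real measure)"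
  define r where "r m = 1 / real (b ^ m) ^ Suc d" for m
  define A where "A m = {q \<in> PiE {..<d} (\<lambda>_. {- int (b ^ m)..int (b ^ m)}). \<exists>j<d. q j \<noteq> 0}" for m
  define G where "G m = (\<Union>q\<in>A m. {y \<in> PiE {..<d} (\<lambda>_. {0..1}). \<exists>p::int. \<bar>of_int p + (\<Sum>i\<in>{..<d}. of_int (q i) * y i)\<bar> \<le> r m})" for m
  have fA: "finite (A m)" for m
    unfolding A_def by (rule finite_subset[of _ "PiE {..<d} (\<lambda>_. {- int (b ^ m)..int (b ^ m)})"]) (auto intro: finite_PiE)
  have bm: "1 \<le> real (b ^ m)" for m using b by simp
  have r: "0 \<le> r m" "r m \<le> 1" for m
  proof -
    have "1 \<le> real (b ^ m) ^ Suc d" by (rule one_le_power[OF bm])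
    then show "r m \<le> 1" by (simp add: r_def del: power_Suc)
  qed (simp add: r_def)
  have mG: "G m \<in> sets ?M" for m
    unfolding G_def using fA by (intro sets.finite_UN strip_box_sets) auto
  have bound: "emeasure ?M (G m) \<le> ennreal (8 * 3 ^ d * (1 / 2) ^ m)" for m
  proof -
    have "emeasure ?M (G m) \<le> (\<Sum>q\<in>A m. emeasure ?M {y \<in> PiE {..<d} (\<lambda>_. {0..1}). \<exists>p::int. \<bar>of_int p + (\<Sum>i\<in>{..<d}. of_int (q i) * y i)\<bar> \<le> r m})"
      unfolding G_def using fA strip_box_sets[of "{..<d}"] by (intro emeasure_subadditive_finite) auto
    also have "\<dots> \<le> (\<Sum>q\<in>A m. ennreal (8 * r m))"
    proof (rule sum_mono)
      fix q assume "q \<in> A m"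
      then obtain j where "j \<in> {..<d}" "q j \<noteq> 0" by (auto simp: A_def)
      with emeasure_strip_box[of "{..<d}" j q 0 1 "r m"] r[of m]
      show "emeasure ?M {y \<in> PiE {..<d} (\<lambda>_. {0..1}). \<exists>p::int. \<bar>of_int p + (\<Sum>i\<in>{..<d}. of_int (q i) * y i)\<bar> \<le> r m} \<le> ennreal (8 * r m)"
        by (simp add: mult.commute)
    qed
    also have "\<dots> = ennreal (real (card (A m)) * (8 * r m))" using r by (simp add: ennreal_mult ennreal_of_nat_eq_real_of_nat)
    also have "\<dots> \<le> ennreal (8 * 3 ^ d * (1 / 2) ^ m)"
    proof (rule ennreal_leI)
      have "card (A m) \<le> card (PiE {..<d} (\<lambda>_. {- int (b ^ m)..int (b ^ m)}))"
        unfolding A_def by (intro card_mono finite_PiE) auto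
      also have "\<dots> = (2 * b ^ m + 1) ^ d"
      proof -
        have "int (b ^ m) - - int (b ^ m) + 1 = int (2 * b ^ m + 1)" by simp
        then show ?thesis by (simp only: card_PiE finite_lessThan prod_constant card_atLeastAtMost_int nat_int card_lessThan)
      qed
      finally have "real (card (A m)) \<le> real ((2 * b ^ m + 1) ^ d)" by (simp only: of_nat_le_iff)
      then have "real (card (A m)) \<le> (2 * real (b ^ m) + 1) ^ d" by (simp add: add.commute)
      also have "\<dots> \<le> (3 * real (b ^ m)) ^ d" using bm[of m] by (intro power_mono) auto
      finally have "real (card (A m)) * (8 * r m) \<le> (3 * real (b ^ m)) ^ d * (8 * r m)"
        using r[of m] by (intro mult_right_mono) auto
      also have "\<dots> = 8 * 3 ^ d * (1 / real (b ^ m))" using bm[of m] b by (simp add: r_def power_mult_distrib)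
      also have "1 / real (b ^ m) = (1 / real b) ^ m" by (simp add: power_one_over)
      also have "8 * 3 ^ d * (1 / real b) ^ m \<le> 8 * 3 ^ d * (1 / 2) ^ m"
        using b by (intro mult_left_mono power_mono) (auto simp: field_simps)
      finally show "real (card (A m)) * (8 * r m) \<le> 8 * 3 ^ d * (1 / 2) ^ m" .
    qed
    finally show ?thesis .
  qed
  have "AE y in ?M. eventually (\<lambda>m. y \<in> space ?M - G m) sequentially"
  proof (rule borel_cantelli_AE1[OF mG])
    show "emeasure ?M (G m) < \<infinity>" for m using bound[of m] by (auto intro: le_less_trans)
    show "summable (\<lambda>m. measure ?M (G m))"
    proof (rule summable_comparison_test'[where N = 0])
      show "summable (\<lambda>m. 8 * 3 ^ d * (1 / 2 :: real) ^ m)" by (intro summable_mult summable_geometric) auto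
      show "norm (measure ?M (G m)) \<le> 8 * 3 ^ d * (1 / 2) ^ m" for m
        using bound[of m] by (simp add: measure_def enn2real_leI)
    qed
  qed
  then show ?thesis
  proof eventually_elim
    case (elim y)
    show ?case
    proof
      assume y: "y \<in> PiE {..<d} (\<lambda>_. {0..1})"
      from elim show "\<forall>\<^sub>F m in sequentially. \<not> well_approx d (b ^ m) y"
      proof eventually_elim
        case (elim m)
        show ?case
        proof
          assume "well_approx d (b ^ m) y"
          then obtain q :: "nat \<Rightarrow> int" and p :: int where q: "\<exists>i<d. q i \<noteq> 0" "\<forall>i<d. \<bar>q i\<bar> \<le> int (b ^ m)"
            "\<bar>of_int p + (\<Sum>i<d. of_int (q i) * y i)\<bar> \<le> r m"
            unfolding well_approx_def r_def by blast
          define q' where "q' = restrict q {..<d}"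
          have "q' \<in> A m" using q(1,2) by (auto simp: q'_def A_def abs_le_iff minus_le_iff)
          moreover have "(\<Sum>i<d. of_int (q' i) * y i) = (\<Sum>i<d. of_int (q i) * y i)"
            by (simp add: q'_def)
          ultimately have "y \<in> G m" using q(3) y unfolding G_def
            by (intro UN_I[of q'] CollectI conjI exI[of _ p]) simp_all
          then show False using elim by simp
        qed
      qed
    qed
  qed
qed

section \<open>Lower bounds for covers by integration over the fibres\<close>

lemma diamd_ge: "x \<in> U \<Longrightarrow> y \<in> U \<Longrightarrow> ennreal (d x y) \<le> diamd d U"
  unfolding diamd_def by (intro SUP_upper2[of x] SUP_upper) auto

lemma abs_diff_le_distn: "i < n \<Longrightarrow> \<bar>x i - y i\<bar> \<le> distn n x y"
proof -
  assume "i < n"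
  then have "(x i - y i)\<^sup>2 \<le> (\<Sum>i<n. (x i - y i)\<^sup>2)" by (intro member_le_sum) auto
  then show ?thesis unfolding distn_def by (metis real_sqrt_abs real_sqrt_le_iff)
qed

text \<open>Slices over almost every \<open>y\<close> satisfy the ubiquity hypothesis with the same constant, so every
  cover costs at least a fixed amount on each of \<open>K\<close> vertical blocks; sets of diameter below \<open>1/(4K)\<close>
  cannot serve two blocks, whence the total is at least of order \<open>K powr (1 - \<sigma>)\<close>.\<close>
lemma hausdorff_measure_infinite:
  fixes A :: "(nat \<Rightarrow> real) set" and d :: nat and \<rho> :: "nat \<Rightarrow> real"
  assumes \<sigma>: "0 < \<sigma>" "\<sigma> < 1" and \<rho>pos: "\<And>m. 0 < \<rho> m" and \<rho>0: "\<rho> \<longlonglongrightarrow> 0"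
    and div: "\<not> summable (\<lambda>m. real (129 ^ m) ^ (d+2) * \<rho> m powr \<sigma>)"
    and A: "\<And>x. x \<in> Rn (Suc d) \<Longrightarrow> (\<forall>M. \<exists>m\<ge>M. \<exists>z\<in>resonant d x (129 ^ m). \<bar>x d - z\<bar> \<le> \<rho> m) \<Longrightarrow> x \<in> A"
  shows "hausdorff_measure (distn (Suc d)) (\<sigma> + d) A = \<infinity>"
proof -
  define E :: real where "E = 8 * 3 ^ d"
  define X where "X m = real (129 ^ m) ^ (d+2) / E" for m
  define s where "s = \<sigma> + d"
  have s: "0 < s" using \<sigma> by (simp add: s_def)
  have E: "0 < E" by (simp add: E_def)
  define cc where "cc = content_const (1/16) \<sigma>"
  have ubi: "ubiquitous (\<lambda>m. resonant d y (129 ^ m)) X \<rho> (1/16) \<sigma>"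
    if good: "\<forall>\<^sub>F m in sequentially. \<not> well_approx d (129 ^ m) y" for y
  proof
    show Xp: "0 < X m" for m using E by (simp add: X_def)
    have Xm: "X m = (129 ^ (d+2)) ^ m / E" for m
      by (simp only: X_def of_nat_power of_nat_numeral power_mult[symmetric] mult.commute)
    have big: "(129::real) \<le> 129 ^ (d+2)" using power_increasing[of 1 "d+2" "129::real"] by simp
    \<comment> \<open>Origin of the base 129: with \<open>c = 1/16\<close> from
      \<open>fibre_ubiquity\<close> the earlier levels together may have 1/128 of the current
      density, and the ratio of the geometric sum exceeds 1 by at least 128.\<close>
    show "(\<Sum>m<M. X m) \<le> 1/16 / 8 * X M" for M
    proof -
      let ?R = "129 ^ (d+2) :: real"
      have "(\<Sum>m<M. X m) = (\<Sum>m<M. ?R ^ m) / E" by (simp only: Xm sum_divide_distrib)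
      also have "(\<Sum>m<M. ?R ^ m) = (?R ^ M - 1) / (?R - 1)" by (rule geometric_sum) (use big in auto)
      also have "\<dots> \<le> ?R ^ M / 128" using big by (intro frac_le) auto
      finally show ?thesis using E unfolding Xm by (simp add: divide_right_mono)
    qed
    show "filterlim X at_top sequentially"
    proof -
      have "filterlim (\<lambda>m. (129 ^ (d+2) :: real) ^ m) at_infinity sequentially"
        using big by (intro filterlim_realpow_sequentially_gt1) simp
      then have "filterlim (\<lambda>m. (129 ^ (d+2) :: real) ^ m) at_top sequentially"
        by (rule filterlim_at_infinity_imp_filterlim_at_top) simp
      then have "filterlim (\<lambda>m. 1 / E * (129 ^ (d+2) :: real) ^ m) at_top sequentially"
        by (rule filterlim_tendsto_pos_mult_at_top[OF tendsto_const, rotated]) (use E in simp)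
      then show ?thesis unfolding Xm by (simp only: times_divide_eq_left mult_1)
    qed
    show "\<not> summable (\<lambda>m. X m * \<rho> m powr \<sigma>)"
    proof
      assume "summable (\<lambda>m. X m * \<rho> m powr \<sigma>)"
      then have "summable (\<lambda>m. E * (X m * \<rho> m powr \<sigma>))" by (rule summable_mult)
      then show False using div E by (simp add: X_def)
    qed
    fix u v :: real assume "u < v"
    obtain Q0 where Q0: "\<forall>Q\<ge>Q0. \<forall>u' v' y. v' - u' = v - u \<longrightarrow> \<not> well_approx d Q y \<longrightarrow>
      (\<exists>P. finite P \<and> P \<subseteq> resonant d y Q \<inter> {u'..v'} \<and> 1/16 * (real Q ^ (d+2) / E) * (v - u) \<le> real (card P) \<and>
         (\<forall>a\<in>P. \<forall>b\<in>P. a \<noteq> b \<longrightarrow> 1 / (real Q ^ (d+2) / E) \<le> \<bar>a - b\<bar>))"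
      using fibre_ubiquity[of "v - u" d] \<open>u < v\<close> unfolding E_def by auto
    have "\<forall>\<^sub>F m in sequentially. Q0 \<le> 129 ^ m"
      using eventually_ge_at_top[of Q0]
    proof eventually_elim
      case (elim m)
      have "m < 129 ^ m" by (rule less_exp[THEN less_le_trans]) (simp add: power_mono)
      then show ?case using elim by simp
    qed
    with good have "\<forall>\<^sub>F m in sequentially. Q0 \<le> 129 ^ m \<and> \<not> well_approx d (129 ^ m) y"
      by eventually_elim auto
    then obtain m0 where m0: "\<And>m. m0 \<le> m \<Longrightarrow> Q0 \<le> 129 ^ m \<and> \<not> well_approx d (129 ^ m) y"
      unfolding eventually_sequentially by blast
    show "\<exists>m0. \<forall>m\<ge>m0. \<exists>P. finite P \<and> P \<subseteq> resonant d y (129 ^ m) \<inter> {u..v} \<and> 1/16 * X m * (v - u) \<le> real (card P)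
               \<and> (\<forall>a\<in>P. \<forall>b\<in>P. a \<noteq> b \<longrightarrow> 1 / X m \<le> \<bar>a - b\<bar>)"
    proof (intro exI[of _ m0] allI impI)
      fix m assume "m0 \<le> m"
      then show "\<exists>P. finite P \<and> P \<subseteq> resonant d y (129 ^ m) \<inter> {u..v} \<and> 1/16 * X m * (v - u) \<le> real (card P)
               \<and> (\<forall>a\<in>P. \<forall>b\<in>P. a \<noteq> b \<longrightarrow> 1 / X m \<le> \<bar>a - b\<bar>)"
        using Q0[rule_format, of "129 ^ m" v u y] m0[of m] unfolding X_def by blast
    qed
  qed (use \<sigma> \<rho>pos \<rho>0 in auto)
  let ?M = "PiM {..<d} (\<lambda>_. lborel :: real measure)"
  let ?Y = "PiE {..<d} (\<lambda>_. {0..1::real})"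
  have AEgood: "AE y in ?M. y \<in> ?Y \<longrightarrow> (\<forall>\<^sub>F m in sequentially. \<not> well_approx d (129 ^ m) y)"
    by (rule AE_not_well_approx) simp
  define C where "C = cc / (2 powr \<sigma> * 2 ^ d)"
  \<comment> \<open>The power of \<open>K\<close> is the number of blocks times the \<sigma>-th
    power of their length; \<tau> pays for making all diameters positive.\<close>
  have main: "ennreal (C * real K powr (1 - \<sigma>)) \<le> hausdorff_delta (distn (Suc d)) s (1 / (4 * real K)) A + ennreal \<tau>"
    if K: "0 < K" and \<tau>0: "0 < \<tau>" and \<tau>s: "\<tau> \<le> (1 / (2 * real K)) powr s - (1 / (4 * real K)) powr s" for K :: nat and \<tau> :: real
  proof -
    let ?\<delta> = "1 / (4 * real K)"
    have "ennreal (C * real K powr (1 - \<sigma>)) - ennreal \<tau> \<le> (\<Sum>i. ennreal (enn2real (diamd (distn (Suc d)) (U i)) powr s))"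
      if cov: "A \<subseteq> (\<Union>i. U i)" and diam: "\<And>i. diamd (distn (Suc d)) (U i) \<le> ennreal ?\<delta>" for U :: "nat \<Rightarrow> (nat \<Rightarrow> real) set"
    proof -
      define D where "D i = enn2real (diamd (distn (Suc d)) (U i))" for i
      have D0: "0 \<le> D i" for i by (simp add: D_def)
      have DK: "D i \<le> ?\<delta>" for i unfolding D_def using diam[of i] by (intro enn2real_leI) auto
      have dist: "distn (Suc d) x x' \<le> D i" if "x \<in> U i" "x' \<in> U i" for x x' i
      proof -
        have "ennreal (distn (Suc d) x x') \<le> diamd (distn (Suc d)) (U i)" by (rule diamd_ge[OF that])
        moreover have "diamd (distn (Suc d)) (U i) = ennreal (D i)"
          unfolding D_def using diam[of i] by (intro ennreal_enn2real[symmetric]) (auto intro: le_less_trans)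
        ultimately show ?thesis using D0[of i] by (simp add: distn_def)
      qed
      \<comment> \<open>Padded diameters: the extra terms add up to \<tau>, and sets of diameter
        zero become admissible for \<open>light_limsup_point\<close>.\<close>
      define e where "e i = (D i powr s + \<tau> * (1/2) ^ Suc i) powr (1/s)" for i
      have base: "0 < D i powr s + \<tau> * (1/2) ^ Suc i" for i
        using \<tau>0 by (intro add_nonneg_pos) auto
      have epos: "0 < e i" for i using base[of i] by (simp add: e_def)
      have es: "e i powr s = D i powr s + \<tau> * (1/2) ^ Suc i" for i
        using base[of i] s by (simp add: e_def powr_powr)
      have De: "D i \<le> e i" for i
      proof -
        have "(D i powr s) powr (1/s) \<le> e i"
          unfolding e_def using \<tau>0 s by (intro powr_mono2) auto
        then show ?thesis using D0[of i] s by (simp add: powr_powr)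
      qed
      define glue where "glue y w = (\<lambda>i. if i < d then y i else if i = d then w else 0)" for y :: "nat \<Rightarrow> real" and w :: real
      have glueRn: "glue y w \<in> Rn (Suc d)" for y w by (simp add: glue_def Rn_def)
      define Sl where "Sl y i = {w. glue y w \<in> U i}" for y i
      have Sldist: "\<bar>w - w'\<bar> \<le> D i" if "w \<in> Sl y i" "w' \<in> Sl y i" for y i w w'
      proof -
        have "\<bar>glue y w d - glue y w' d\<bar> \<le> distn (Suc d) (glue y w) (glue y w')"
          by (rule abs_diff_le_distn) simp
        also have "\<dots> \<le> D i" by (rule dist) (use that in \<open>auto simp: Sl_def\<close>)
        finally show ?thesis by (simp add: glue_def)
      qed
      define a where "a i = (SOME x. x \<in> U i)" for i
      \<comment> \<open>A measurable substitute for the set of all \<open>y\<close> whose slice of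
        \<open>U i\<close> is nonempty: a box of side \<open>2 * e i\<close> about a point of
        \<open>U i\<close>.\<close>
      define Bx where "Bx i = (if U i = {} then {} else PiE {..<d} (\<lambda>j. {a i j - e i..a i j + e i}))" for i
      have aU: "a i \<in> U i" if "U i \<noteq> {}" for i using that unfolding a_def by (simp add: some_in_eq)
      have SlBx: "y \<in> Bx i" if ne: "Sl y i \<noteq> {}" and y: "y \<in> extensional {..<d}" for y i
      proof -
        obtain w where w: "glue y w \<in> U i" using ne by (auto simp: Sl_def)
        have "\<bar>y j - a i j\<bar> \<le> e i" if "j < d" for j
        proof -
          have "\<bar>glue y w j - a i j\<bar> \<le> distn (Suc d) (glue y w) (a i)"
            by (rule abs_diff_le_distn) (use that in simp)
          also have "\<dots> \<le> D i" by (rule dist) (use w aU in auto)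
          finally show ?thesis using De[of i] that by (simp add: glue_def)
        qed
        then have "\<bar>y j - a i j\<bar> \<le> e i" if "j \<in> {..<d}" for j using that by simp
        then have "a i j - e i \<le> y j \<and> y j \<le> a i j + e i" if "j \<in> {..<d}" for j using that by force
        then show ?thesis using w y by (auto simp: Bx_def PiE_def Pi_def)
      qed
      define blk where "blk j = {real j / K..real j / K + 1 / (2 * real K)}" for j :: nat
      have uniq: "j = j'" if jj: "Sl y i \<inter> blk j \<noteq> {}" "Sl y i \<inter> blk j' \<noteq> {}" for y i j j'
      proof (rule ccontr)
        assume "j \<noteq> j'"
        obtain w w' where w: "w \<in> Sl y i" "w \<in> blk j" and w': "w' \<in> Sl y i" "w' \<in> blk j'" using jj by blast
        have "\<bar>w - w'\<bar> \<le> ?\<delta>" using Sldist[OF w(1) w'(1)] DK[of i] by linarith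
        then have "real K * \<bar>w - w'\<bar> \<le> real K * ?\<delta>" using K by (intro mult_left_mono) auto
        then have 1: "\<bar>real K * w - real K * w'\<bar> \<le> 1/4" using K by (simp add: abs_mult flip: right_diff_distrib)
        have Kw: "real j \<le> real K * w \<and> real K * w \<le> real j + 1/2" if "w \<in> blk j" for j w
          using that K by (auto simp: blk_def field_simps)
        show False using Kw[OF w(2)] Kw[OF w'(2)] 1 \<open>j \<noteq> j'\<close> by linarith
      qed
      have lower: "ennreal (K * (cc * (1 / (2 * real K)) powr \<sigma>)) \<le> (\<Sum>i. ennreal (e i powr \<sigma>) * indicator (Bx i) y)"
        if good: "\<forall>\<^sub>F m in sequentially. \<not> well_approx d (129 ^ m) y" and y: "y \<in> extensional {..<d}" for y
      proof -
        interpret ub: ubiquitous "\<lambda>m. resonant d y (129 ^ m)" X \<rho> "1/16" \<sigma> by (rule ubi[OF good])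
        let ?t = "\<lambda>j i. if Sl y i \<inter> blk j \<noteq> {} then ennreal (e i powr \<sigma>) else 0"
        \<comment> \<open>On a cheap block the sliced cover would be light and would miss a limsup
          point of the fibre; glued to \<open>y\<close>, that point lies in \<open>A\<close> but in
          no \<open>U i\<close>.\<close>
        have blkge: "ennreal (cc * (1 / (2 * real K)) powr \<sigma>) \<le> (\<Sum>i. ?t j i)" for j
        proof (rule ccontr)
          assume "\<not> ?thesis"
          then have L: "light (Sl y) e \<sigma> (content_const (1/16) \<sigma>) (real j / K) (real j / K + 1 / (2 * real K))"
            by (simp add: light_def blk_def not_le cc_def)
          have lt: "real j / K < real j / K + 1 / (2 * real K)" using K by simp
          have Sle: "\<bar>w - w'\<bar> \<le> e i" if "w \<in> Sl y i" "w' \<in> Sl y i" for i w w'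
            using Sldist[OF that] De[of i] by linarith
          obtain x where x: "\<forall>M. \<exists>m\<ge>M. \<exists>z\<in>resonant d y (129 ^ m). \<bar>x - z\<bar> \<le> \<rho> m" "\<forall>i. x \<notin> Sl y i"
            using ub.light_limsup_point[OF L lt epos Sle] by blast
          have "resonant d (glue y x) Q = resonant d y Q" for Q
            by (simp add: resonant_def glue_def)
          then have "glue y x \<in> A" using x(1) by (intro A glueRn) (simp add: glue_def)
          then show False using cov x(2) by (auto simp: Sl_def)
        qed
        have "ennreal (K * (cc * (1 / (2 * real K)) powr \<sigma>)) = (\<Sum>j<K. ennreal (cc * (1 / (2 * real K)) powr \<sigma>))"
          using content_const[of "1/16" \<sigma>] by (simp add: cc_def ennreal_mult ennreal_of_nat_eq_real_of_nat)
        also have "\<dots> \<le> (\<Sum>j<K. \<Sum>i. ?t j i)" by (intro sum_mono blkge)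
        also have "\<dots> = (\<Sum>i. \<Sum>j<K. ?t j i)" by (rule suminf_sum[symmetric]) auto
        also have "\<dots> \<le> (\<Sum>i. ennreal (e i powr \<sigma>) * indicator (Bx i) y)"
        proof (rule suminf_le)
          fix i
          show "(\<Sum>j<K. ?t j i) \<le> ennreal (e i powr \<sigma>) * indicator (Bx i) y"
          proof (cases "\<exists>j<K. Sl y i \<inter> blk j \<noteq> {}")
            case True
            then obtain j where j: "j < K" "Sl y i \<inter> blk j \<noteq> {}" by blast
            have "(\<Sum>j'<K. ?t j' i) = (\<Sum>j'\<in>{j}. ?t j' i)"
            proof (rule sum.mono_neutral_right)
              have "Sl y i \<inter> blk j' = {}" if "j' \<noteq> j" for j' using uniq[OF _ j(2)] that by blast
              then show "\<forall>j'\<in>{..<K} - {j}. ?t j' i = 0" by simp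
            qed (use j in simp_all)
            also have "\<dots> = ennreal (e i powr \<sigma>)" using j by simp
            also have "\<dots> = ennreal (e i powr \<sigma>) * indicator (Bx i) y" 
            proof -
              have "Sl y i \<noteq> {}" using j(2) by blast
              then show ?thesis using SlBx[OF _ y] by simp
            qed
            finally show ?thesis by simp
          next
            case False
            then show ?thesis by simp
          qed
        qed auto
        finally show ?thesis .
      qed
      have Bm: "Bx i \<in> sets ?M" for i unfolding Bx_def by auto
      have eBx: "emeasure ?M (Bx i) \<le> ennreal ((2 * e i) ^ d)" for i
      proof (cases "U i = {}")
        case False
        then show ?thesis
          using emeasure_PiE_box[of "{..<d}" "\<lambda>j. a i j - e i" "\<lambda>j. a i j + e i"] epos[of i]
          by (simp add: Bx_def less_imp_le)
      qed (simp add: Bx_def)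
      have "ennreal (K * (cc * (1 / (2 * real K)) powr \<sigma>)) = (\<integral>\<^sup>+ y. ennreal (K * (cc * (1 / (2 * real K)) powr \<sigma>)) * indicator ?Y y \<partial>?M)"
        using emeasure_PiE_box[of "{..<d}" "\<lambda>_. 0" "\<lambda>_. 1"] by (subst nn_integral_cmult_indicator) auto
      also have "\<dots> \<le> (\<integral>\<^sup>+ y. (\<Sum>i. ennreal (e i powr \<sigma>) * indicator (Bx i) y) \<partial>?M)"
      proof (rule nn_integral_mono_AE)
        show "AE y in ?M. ennreal (K * (cc * (1 / (2 * real K)) powr \<sigma>)) * indicator ?Y y \<le> (\<Sum>i. ennreal (e i powr \<sigma>) * indicator (Bx i) y)"
          using AEgood
        proof eventually_elim
          case (elim y)
          show ?case
          proof (cases "y \<in> ?Y")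
            case True
            then show ?thesis using lower[of y] elim by (simp add: PiE_def)
          qed simp
        qed
      qed
      also have "\<dots> = (\<Sum>i. \<integral>\<^sup>+ y. ennreal (e i powr \<sigma>) * indicator (Bx i) y \<partial>?M)"
        by (rule nn_integral_suminf) (intro borel_measurable_times_ennreal borel_measurable_const borel_measurable_indicator Bm)
      also have "\<dots> = (\<Sum>i. ennreal (e i powr \<sigma>) * emeasure ?M (Bx i))"
        using Bm by (simp add: nn_integral_cmult_indicator)
      \<comment> \<open>The volume \<open>(2 * e i) ^ d\<close> of the box raises the exponent from
        \<sigma> on the fibre to \<open>s\<close>.\<close>
      also have "\<dots> \<le> (\<Sum>i. ennreal (2 ^ d) * ennreal (e i powr s))"
      proof (intro suminf_le allI)
        fix i
        have "ennreal (e i powr \<sigma>) * emeasure ?M (Bx i) \<le> ennreal (e i powr \<sigma>) * ennreal ((2 * e i) ^ d)"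
          by (intro mult_left_mono eBx) auto
        also have "\<dots> = ennreal (2 ^ d) * ennreal (e i powr s)"
          using epos[of i] by (simp add: s_def powr_add powr_realpow power_mult_distrib ennreal_mult[symmetric] mult_ac)
        finally show "ennreal (e i powr \<sigma>) * emeasure ?M (Bx i) \<le> ennreal (2 ^ d) * ennreal (e i powr s)" .
      qed auto
      also have "\<dots> = ennreal (2 ^ d) * (\<Sum>i. ennreal (e i powr s))" by (rule ennreal_suminf_cmult)
      also have "(\<Sum>i. ennreal (e i powr s)) = (\<Sum>i. ennreal (D i powr s)) + ennreal \<tau>"
      proof -
        have "(\<lambda>i. \<tau> * (1/2) ^ Suc i) sums (\<tau> * 1)"
          by (intro sums_mult power_half_series)
        then have "(\<Sum>i. ennreal (\<tau> * (1/2) ^ Suc i)) = ennreal \<tau>"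
          using \<tau>0 by (subst suminf_ennreal2) (auto simp: sums_iff)
        moreover have "(\<Sum>i. ennreal (e i powr s)) = (\<Sum>i. ennreal (D i powr s) + ennreal (\<tau> * (1/2) ^ Suc i))"
          unfolding es using \<tau>0 by (intro suminf_cong ennreal_plus) auto
        moreover have "\<dots> = (\<Sum>i. ennreal (D i powr s)) + (\<Sum>i. ennreal (\<tau> * (1/2) ^ Suc i))"
          by (rule suminf_add[symmetric]) auto
        ultimately show ?thesis by simp
      qed
      finally have fin: "ennreal (K * (cc * (1 / (2 * real K)) powr \<sigma>)) \<le> ennreal (2 ^ d) * ((\<Sum>i. ennreal (D i powr s)) + ennreal \<tau>)" .
      have "K * (cc * (1 / (2 * real K)) powr \<sigma>) = 2 ^ d * (C * real K powr (1 - \<sigma>))"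
        using K by (simp add: C_def powr_divide powr_mult powr_diff field_simps)
      then have "ennreal (K * (cc * (1 / (2 * real K)) powr \<sigma>)) = ennreal (2 ^ d) * ennreal (C * real K powr (1 - \<sigma>))"
        by (simp add: ennreal_mult')
      with fin have "ennreal (2 ^ d) * ennreal (C * real K powr (1 - \<sigma>)) \<le> ennreal (2 ^ d) * ((\<Sum>i. ennreal (D i powr s)) + ennreal \<tau>)"
        by simp
      then have "ennreal (C * real K powr (1 - \<sigma>)) \<le> (\<Sum>i. ennreal (D i powr s)) + ennreal \<tau>"
        by (subst (asm) ennreal_mult_le_mult_iff) auto
      then show ?thesis by (simp add: D_def ennreal_minus_le_iff add.commute)
    qed
    then have "ennreal (C * real K powr (1 - \<sigma>)) - ennreal \<tau> \<le> hausdorff_delta (distn (Suc d)) s ?\<delta> A"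
      unfolding hausdorff_delta_def by (intro INF_greatest) auto
    then show ?thesis by (simp add: ennreal_minus_le_iff add.commute)
  qed
  have CK: "ennreal (C * real K powr (1 - \<sigma>)) \<le> hausdorff_measure (distn (Suc d)) s A + 1" if K: "0 < K" for K :: nat
  proof -
    define \<tau> where "\<tau> = min 1 ((1 / (2 * real K)) powr s - (1 / (4 * real K)) powr s)"
    have "(1 / (4 * real K)) powr s < (1 / (2 * real K)) powr s"
      using K s by (intro powr_less_mono2) (auto simp: field_simps)
    then have \<tau>: "0 < \<tau>" "\<tau> \<le> 1" by (auto simp: \<tau>_def)
    have "ennreal (C * real K powr (1 - \<sigma>)) \<le> hausdorff_delta (distn (Suc d)) s (1 / (4 * real K)) A + ennreal \<tau>"
      by (rule main[OF K \<tau>(1)]) (simp add: \<tau>_def)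
    also have "\<dots> \<le> hausdorff_measure (distn (Suc d)) s A + 1"
      unfolding hausdorff_measure_def using K \<tau> by (intro add_mono SUP_upper) (auto simp: ennreal_le_1)
    finally show ?thesis .
  qed
  have ccpos: "0 < cc"
    by (simp add: cc_def content_const)
  have Cpos: "0 < C" using ccpos by (simp add: C_def)
  have "hausdorff_measure (distn (Suc d)) s A = \<infinity>"
  proof (rule ccontr)
    assume "\<not> ?thesis"
    then obtain B where B: "hausdorff_measure (distn (Suc d)) s A + 1 = ennreal B" "0 \<le> B"
      by (cases "hausdorff_measure (distn (Suc d)) s A + 1") auto
    have "filterlim (\<lambda>K::nat. C * real K powr (1 - \<sigma>)) at_top sequentially"
      using Cpos \<sigma> by real_asymp
    then have "eventually (\<lambda>K::nat. B + 1 \<le> C * real K powr (1 - \<sigma>)) sequentially"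
      by (simp add: filterlim_at_top)
    then obtain K :: nat where K: "0 < K" "B + 1 \<le> C * real K powr (1 - \<sigma>)"
      unfolding eventually_sequentially by (metis gr0I le_eq_less_or_eq less_Suc_eq_0_disj nat_le_linear)
    have "ennreal (C * real K powr (1 - \<sigma>)) \<le> ennreal B" using CK[OF K(1)] B by simp
    then have "C * real K powr (1 - \<sigma>) \<le> B" using B(2) by (simp add: ennreal_le_iff)
    then show False using K(2) by simp
  qed
  then show ?thesis by (simp add: s_def)
qed

section \<open>Covering and measure zero\<close>

lemma diamd_empty [simp]: "diamd d {} = 0"
  by (simp add: diamd_def bot_ennreal)

text \<open>Covers are sequences by definition, whereas the covers used below have one family for
  each level; pairs are encoded as naturals.\<close>

lemma hausdorff_delta_le_suminf2:
  fixes U :: "nat \<Rightarrow> nat \<Rightarrow> 'a set"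
  assumes "A \<subseteq> (\<Union>k. \<Union>j. U k j)" "\<And>k j. diamd d (U k j) \<le> ennreal \<delta>"
  shows "hausdorff_delta d s \<delta> A \<le> (\<Sum>k. \<Sum>j. ennreal (enn2real (diamd d (U k j)) powr s))"
proof -
  let ?V = "\<lambda>i. case prod_decode i of (k, j) \<Rightarrow> U k j"
  have "A \<subseteq> (\<Union>i. ?V i)"
  proof
    fix x assume "x \<in> A"
    then obtain k j where "x \<in> U k j" using assms(1) by blast
    then show "x \<in> (\<Union>i. ?V i)" by (intro UN_I[of "prod_encode (k, j)"]) auto
  qed
  moreover have "diamd d (?V i) \<le> ennreal \<delta>" for i using assms(2) by (auto split: prod.split)
  ultimately have "hausdorff_delta d s \<delta> A \<le> (\<Sum>i. ennreal (enn2real (diamd d (?V i)) powr s))"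
    unfolding hausdorff_delta_def by (intro INF_lower) auto
  also have "\<dots> = (\<Sum>i. (\<lambda>(k, j). ennreal (enn2real (diamd d (U k j)) powr s)) (prod_decode i))"
    by (intro suminf_cong) (auto split: prod.split)
  also have "\<dots> = (\<Sum>k. \<Sum>j. ennreal (enn2real (diamd d (U k j)) powr s))"
    by (intro suminf_ennreal_2dimen) auto
  finally show ?thesis .
qed

lemma hausdorff_delta_UN_null:
  fixes A :: "nat \<Rightarrow> 'a set"
  assumes null: "\<And>k. hausdorff_delta d s \<delta> (A k) = 0"
  shows "hausdorff_delta d s \<delta> (\<Union>k. A k) = 0"
proof -
  have "hausdorff_delta d s \<delta> (\<Union>k. A k) \<le> 0 + ennreal \<epsilon>" if \<epsilon>: "0 < \<epsilon>" for \<epsilon> :: real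
  proof -
    have "\<exists>U :: nat \<Rightarrow> 'a set. A k \<subseteq> (\<Union>i. U i) \<and> (\<forall>i. diamd d (U i) \<le> ennreal \<delta>) \<and>
        (\<Sum>i. ennreal (enn2real (diamd d (U i)) powr s)) < ennreal (\<epsilon> * (1/2) ^ Suc k)" for k
    proof -
      have "hausdorff_delta d s \<delta> (A k) < ennreal (\<epsilon> * (1/2) ^ Suc k)" using null[of k] \<epsilon> by simp
      then show ?thesis unfolding hausdorff_delta_def INF_less_iff by auto
    qed
    then obtain U :: "nat \<Rightarrow> nat \<Rightarrow> 'a set" where U: "\<And>k. A k \<subseteq> (\<Union>i. U k i)" "\<And>k i. diamd d (U k i) \<le> ennreal \<delta>"
      "\<And>k. (\<Sum>i. ennreal (enn2real (diamd d (U k i)) powr s)) < ennreal (\<epsilon> * (1/2) ^ Suc k)" by metis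
    have "hausdorff_delta d s \<delta> (\<Union>k. A k) \<le> (\<Sum>k. \<Sum>j. ennreal (enn2real (diamd d (U k j)) powr s))"
    proof (rule hausdorff_delta_le_suminf2)
      show "(\<Union>k. A k) \<subseteq> (\<Union>k. \<Union>j. U k j)" using U(1) by (intro UN_mono) auto
    qed (rule U(2))
    also have "\<dots> \<le> (\<Sum>k. ennreal (\<epsilon> * (1/2) ^ Suc k))"
      using U(3) by (intro suminf_le less_imp_le) auto
    also have "\<dots> = ennreal \<epsilon>"
    proof -
      have "(\<lambda>i. \<epsilon> * (1/2) ^ Suc i) sums (\<epsilon> * 1)" by (intro sums_mult power_half_series)
      then have sum: "summable (\<lambda>i. \<epsilon> * (1/2) ^ Suc i)" "(\<Sum>i. \<epsilon> * (1/2) ^ Suc i) = \<epsilon>" by (simp_all only: sums_iff mult_1_right)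
      have "(\<Sum>k. ennreal (\<epsilon> * (1/2) ^ Suc k)) = ennreal (\<Sum>k. \<epsilon> * (1/2) ^ Suc k)"
        by (rule suminf_ennreal2[OF _ sum(1)]) (use \<epsilon> in simp)
      then show ?thesis by (simp only: sum(2))
    qed
    finally show ?thesis by simp
  qed
  then have "hausdorff_delta d s \<delta> (\<Union>k. A k) \<le> 0" using ennreal_le_epsilon[of 0] by blast
  then show ?thesis by simp
qed

lemma diamd_le: "(\<And>x y. x \<in> U \<Longrightarrow> y \<in> U \<Longrightarrow> d x y \<le> \<delta>) \<Longrightarrow> diamd d U \<le> ennreal \<delta>"
  unfolding diamd_def by (intro SUP_least ennreal_leI) auto

lemma distn_le:
  assumes "\<And>i. i < n \<Longrightarrow> \<bar>x i - y i\<bar> \<le> h" "0 \<le> h"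
  shows "distn n x y \<le> real n * h"
proof -
  have "distn n x y \<le> (\<Sum>i<n. \<bar>x i - y i\<bar>)"
    unfolding distn_def using L2_set_le_sum_abs[of "\<lambda>i. x i - y i" "{..<n}"] by (simp add: L2_set_def)
  also have "\<dots> \<le> (\<Sum>i<n. h)" using assms(1) by (intro sum_mono) auto
  finally show ?thesis by simp
qed

text \<open>At level \<open>m\<close> the set is covered by the cubes of a mesh of width \<open>h m\<close>; their number is bounded by
  comparing volumes with slightly thickened strips.\<close>
lemma hausdorff_measure_zero:
  fixes A :: "(nat \<Rightarrow> real) set" and d :: nat and h :: "nat \<Rightarrow> real"
  assumes \<sigma>: "0 < \<sigma>" "\<sigma> < 1" and hpos: "\<And>m. 0 < h m"
    and sm: "summable (\<lambda>m. (2 ^ m) ^ (d+2) * h m powr \<sigma>)"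
    and ARn: "A \<subseteq> Rn (Suc d)"
    and A: "\<And>x M. x \<in> A \<Longrightarrow> \<exists>m\<ge>M. \<exists>(p :: int) (q :: nat \<Rightarrow> int). (p \<noteq> 0 \<or> (\<exists>i<Suc d. q i \<noteq> 0)) \<and>
        (\<forall>i<Suc d. \<bar>q i\<bar> \<le> 4 * 2 ^ m) \<and> \<bar>of_int p + (\<Sum>i<Suc d. of_int (q i) * x i)\<bar> \<le> 2 * 2 ^ m * h m"
  shows "hausdorff_measure (distn (Suc d)) (\<sigma> + d) A = 0"
proof -
  define n where "n = Suc d"
  define s where "s = \<sigma> + d"
  have s: "0 < s" using \<sigma> by (simp add: s_def)
  \<comment> \<open>Width of the thickened strip: \<open>2 * 2 ^ m * h m\<close> from the
    approximation, and moving each of the \<open>n\<close> coordinates by \<open>h m\<close> changes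
    the linear form by at most \<open>4 * 2 ^ m * h m\<close>.\<close>
  define r where "r m = (2 + 4 * real n) * (2 ^ m * h m)" for m
  have h0: "(\<lambda>m. 2 ^ m * h m) \<longlonglongrightarrow> 0"
  proof -
    have lim: "(\<lambda>m. ((2 ^ m) ^ (d+2) * h m powr \<sigma>) powr (1/\<sigma>)) \<longlonglongrightarrow> 0"
      by (rule tendsto_zero_powrI[OF summable_LIMSEQ_zero[OF sm] tendsto_const]) (use hpos \<sigma> in \<open>auto intro!: always_eventually mult_nonneg_nonneg\<close>)
    have le: "2 ^ m * h m \<le> ((2 ^ m) ^ (d+2) * h m powr \<sigma>) powr (1/\<sigma>)" for m
    proof -
      have one: "(1::real) \<le> 2 ^ m" by simp
      have "((2 ^ m) powr \<sigma> :: real) \<le> (2 ^ m) powr 1" using \<sigma> one by (intro powr_mono) auto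
      also have "\<dots> = (2 ^ m) ^ 1" by simp
      also have "\<dots> \<le> (2 ^ m) ^ (d+2)" using one by (intro power_increasing) auto
      finally have "(2 ^ m) powr \<sigma> * h m powr \<sigma> \<le> (2 ^ m) ^ (d+2) * h m powr \<sigma>" by (intro mult_right_mono) auto
      then have "(2 ^ m * h m) powr \<sigma> \<le> (2 ^ m) ^ (d+2) * h m powr \<sigma>"
        using hpos[of m] by (simp add: powr_mult)
      then have "((2 ^ m * h m) powr \<sigma>) powr (1/\<sigma>) \<le> ((2 ^ m) ^ (d+2) * h m powr \<sigma>) powr (1/\<sigma>)"
        using \<sigma> by (intro powr_mono2) auto
      then show ?thesis using \<sigma> hpos[of m] by (simp add: powr_powr)
    qed
    have ge: "0 \<le> 2 ^ m * h m" for m using hpos[of m] by simp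
    show ?thesis
      by (rule tendsto_sandwich[OF _ _ tendsto_const lim]) (intro always_eventually allI ge le)+
  qed
  define C where "C a = 9 ^ n * (2 * (2 + 4 * real n) * (2 * a + 5) * (2 * a + 2) ^ d)" for a :: real
  define P where "P m p q x \<longleftrightarrow> (p \<noteq> 0 \<or> (\<exists>i<n. q i \<noteq> 0)) \<and>
        (\<forall>i<n. \<bar>q i\<bar> \<le> 4 * 2 ^ m) \<and> \<bar>of_int p + (\<Sum>i<n. of_int (q i) * x i)\<bar> \<le> 2 * 2 ^ m * h m"
    for m and p :: int and q :: "nat \<Rightarrow> int" and x :: "nat \<Rightarrow> real"
  define S where "S a m = {x \<in> A. (\<forall>i<n. \<bar>x i\<bar> \<le> a) \<and> (\<exists>p q. P m p q x)}" for a :: real and m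
  define \<iota> where "\<iota> m x = restrict (\<lambda>i. \<lfloor>x i / h m\<rfloor>) {..<n}" for m and x :: "nat \<Rightarrow> real"
  have finI: "finite (\<iota> m ` S a m)" for m a
  proof (rule finite_subset)
    show "\<iota> m ` S a m \<subseteq> PiE {..<n} (\<lambda>_. {\<lfloor>- a / h m\<rfloor>..\<lfloor>a / h m\<rfloor>})"
    proof (intro image_subsetI PiE_I)
      fix x i assume "x \<in> S a m" "i \<in> {..<n}"
      then have "- a \<le> x i" "x i \<le> a" by (auto simp: S_def abs_le_iff minus_le_iff)
      then show "\<iota> m x i \<in> {\<lfloor>- a / h m\<rfloor>..\<lfloor>a / h m\<rfloor>}"
        using hpos[of m] \<open>i \<in> {..<n}\<close> by (auto simp: \<iota>_def intro!: floor_mono divide_right_mono simp del: divide_minus_left)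
    qed (simp add: \<iota>_def)
    show "finite (PiE {..<n} (\<lambda>_. {\<lfloor>- a / h m\<rfloor>..\<lfloor>a / h m\<rfloor>}))" by (intro finite_PiE) auto
  qed
  \<comment> \<open>The half-open cubes are disjoint, have volume \<open>h m ^ n\<close> and lie in
    at most \<open>(9 * 2 ^ m) ^ n\<close> strips of measure of order \<open>2 ^ m * h m\<close>.
    One factor \<open>h m\<close> cancels, and multiplying by \<open>h m powr \<sigma>\<close>
    produces the term of the series.\<close>
  have count: "real (card (\<iota> m ` S a m)) * h m powr s \<le> C a * ((2 ^ m) ^ (d+2) * h m powr \<sigma>)"
    if a: "0 \<le> a" and rm: "r m \<le> 1" for m a
  proof -
    let ?M = "PiM {..<n} (\<lambda>_. lborel :: real measure)"
    let ?I = "\<iota> m ` S a m"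
    let ?H = "h m"
    have H: "0 < ?H" by (rule hpos)
    have r0: "0 \<le> r m" using H by (simp add: r_def)
    have "2 ^ m * ?H \<le> r m" using H by (simp add: r_def algebra_simps)
    then have wm: "2 ^ m * ?H \<le> 1" using rm by simp
    have "1 * ?H \<le> 2 ^ m * ?H" using H by (intro mult_right_mono) auto
    then have H1: "?H \<le> 1" using wm by simp
    have "6 * (2 ^ m * ?H) \<le> r m" using H by (simp add: r_def n_def algebra_simps)
    then have w1: "2 * 2 ^ m * ?H < 1" using rm by linarith
    define B where "B \<nu> = PiE {..<n} (\<lambda>i. {of_int (\<nu> i) * ?H..<(of_int (\<nu> i) + 1) * ?H})" for \<nu> :: "nat \<Rightarrow> int"
    define Qs where "Qs = {q \<in> PiE {..<n} (\<lambda>_. {- (4 * 2 ^ m)..4 * 2 ^ m :: int}). \<exists>j<n. q j \<noteq> 0}"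
    define St where "St q = {y \<in> PiE {..<n} (\<lambda>_. {-(a+1)..a+1}). \<exists>p::int. \<bar>of_int p + (\<Sum>i\<in>{..<n}. of_int (q i) * y i)\<bar> \<le> r m}"
      for q :: "nat \<Rightarrow> int"
    have fQ: "finite Qs" unfolding Qs_def
      by (rule finite_subset[of _ "PiE {..<n} (\<lambda>_. {- (4 * 2 ^ m)..4 * 2 ^ m :: int})"]) (auto intro: finite_PiE)
    have Bm: "B \<nu> \<in> sets ?M" for \<nu> unfolding B_def by (intro sets_PiM_I_finite) auto
    have Stm: "St q \<in> sets ?M" for q unfolding St_def by (rule strip_box_sets) simp
    have eB: "emeasure ?M (B \<nu>) = ennreal (?H ^ n)" for \<nu>
    proof -
      have "emeasure ?M (B \<nu>) = (\<Prod>i<n. emeasure lborel {of_int (\<nu> i) * ?H..<(of_int (\<nu> i) + 1) * ?H})"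
        unfolding B_def by (intro lborel_product.emeasure_PiM) auto
      also have "\<dots> = (\<Prod>i<n. ennreal ?H)" using H by (intro prod.cong) (auto simp: algebra_simps)
      finally show ?thesis using H by (simp add: ennreal_power)
    qed
    have disj: "disjoint_family_on B ?I"
      unfolding disjoint_family_on_def
    proof (intro ballI impI)
      fix \<nu> \<nu>' assume "\<nu> \<in> ?I" "\<nu>' \<in> ?I" "\<nu> \<noteq> \<nu>'"
      show "B \<nu> \<inter> B \<nu>' = {}"
      proof (rule ccontr)
        assume "B \<nu> \<inter> B \<nu>' \<noteq> {}"
        then obtain y where y: "y \<in> B \<nu>" "y \<in> B \<nu>'" by blast
        have fl: "\<mu> i = \<lfloor>y i / ?H\<rfloor>" if "y \<in> B \<mu>" "i < n" for \<mu> i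
        proof -
          have "of_int (\<mu> i) * ?H \<le> y i" "y i < (of_int (\<mu> i) + 1) * ?H" using that by (auto simp: B_def PiE_def Pi_def)
          then have "of_int (\<mu> i) \<le> y i / ?H" "y i / ?H < of_int (\<mu> i) + 1" using H by (simp_all add: field_simps)
          then show ?thesis by linarith
        qed
        have "\<nu> i = \<nu>' i" for i
        proof (cases "i < n")
          case True then show ?thesis using fl[OF y(1)] fl[OF y(2)] by simp
        next
          case False then show ?thesis using \<open>\<nu> \<in> ?I\<close> \<open>\<nu>' \<in> ?I\<close> by (auto simp: \<iota>_def)
        qed
        then show False using \<open>\<nu> \<noteq> \<nu>'\<close> by blast
      qed
    qed
    have sub: "(\<Union>\<nu>\<in>?I. B \<nu>) \<subseteq> (\<Union>q\<in>Qs. St q)"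
    proof
      fix y assume "y \<in> (\<Union>\<nu>\<in>?I. B \<nu>)"
      then obtain x where x: "x \<in> S a m" "y \<in> B (\<iota> m x)" by blast
      then obtain p q where P: "P m p q x" and xa: "\<forall>i<n. \<bar>x i\<bar> \<le> a" by (auto simp: S_def)
      have yx: "\<bar>y i - x i\<bar> \<le> ?H" if "i < n" for i
      proof -
        have y: "of_int \<lfloor>x i / ?H\<rfloor> * ?H \<le> y i" "y i < (of_int \<lfloor>x i / ?H\<rfloor> + 1) * ?H"
          using x(2) that by (auto simp: B_def \<iota>_def PiE_def Pi_def)
        have "of_int \<lfloor>x i / ?H\<rfloor> \<le> x i / ?H" "x i / ?H < of_int \<lfloor>x i / ?H\<rfloor> + 1" by linarith+
        then have "of_int \<lfloor>x i / ?H\<rfloor> * ?H \<le> x i" "x i < (of_int \<lfloor>x i / ?H\<rfloor> + 1) * ?H"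
          by (simp_all only: pos_le_divide_eq[OF H] pos_divide_less_eq[OF H])
        then show ?thesis using y by (simp add: algebra_simps abs_le_iff)
      qed
      \<comment> \<open>With \<open>q = 0\<close> the inequality would leave a nonzero integer
        \<open>p\<close> of absolute value below 1. A nonzero coefficient is what makes the strip
        small.\<close>
      have q0: "\<exists>j<n. q j \<noteq> 0"
      proof (rule ccontr)
        assume "\<not> (\<exists>j<n. q j \<noteq> 0)"
        then have "p \<noteq> 0" "\<bar>real_of_int p\<bar> \<le> 2 * 2 ^ m * ?H" using P by (auto simp: P_def)
        then have "\<bar>real_of_int p\<bar> < 1" "1 \<le> \<bar>real_of_int p\<bar>" using w1 by linarith+
        then show False by linarith
      qed
      define q' where "q' = restrict q {..<n}"
      have "q' \<in> Qs" using P q0 by (auto simp: q'_def Qs_def P_def abs_le_iff minus_le_iff)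
      moreover have "y \<in> St q'"
      proof -
        have "y \<in> PiE {..<n} (\<lambda>_. {-(a+1)..a+1})"
        proof (rule PiE_I)
          fix i assume "i \<in> {..<n}"
          then have i: "i < n" by simp
          then have "\<bar>x i\<bar> \<le> a" using xa by blast
          then show "y i \<in> {-(a+1)..a+1}" using yx[OF i] H1 by (auto simp: abs_le_iff)
        next
          fix i assume "i \<notin> {..<n}" then show "y i = undefined" using x(2) by (auto simp: B_def)
        qed
        moreover have "\<bar>of_int p + (\<Sum>i<n. of_int (q' i) * y i)\<bar> \<le> r m"
        proof -
          have "of_int p + (\<Sum>i<n. of_int (q' i) * y i) = (of_int p + (\<Sum>i<n. of_int (q i) * x i)) + (\<Sum>i<n. of_int (q i) * (y i - x i))"
            by (simp add: q'_def sum.distrib[symmetric] algebra_simps)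
          moreover have "\<bar>\<Sum>i<n. of_int (q i) * (y i - x i)\<bar> \<le> (\<Sum>i<n. 4 * 2 ^ m * ?H)"
          proof (rule order_trans[OF sum_abs sum_mono])
            fix i assume "i \<in> {..<n}"
            then have "\<bar>real_of_int (q i)\<bar> \<le> 4 * 2 ^ m" "\<bar>y i - x i\<bar> \<le> ?H"
              using P yx[of i] of_int_le_iff[where 'a = real, of "\<bar>q i\<bar>" "4 * 2 ^ m"] by (auto simp: P_def)
            then show "\<bar>real_of_int (q i) * (y i - x i)\<bar> \<le> 4 * 2 ^ m * ?H"
              unfolding abs_mult by (intro mult_mono) auto
          qed
          moreover have "(\<Sum>i<n. 4 * 2 ^ m * ?H) + 2 * 2 ^ m * ?H = r m" by (simp add: r_def algebra_simps)
          moreover have "\<bar>of_int p + (\<Sum>i<n. of_int (q i) * x i)\<bar> \<le> 2 * 2 ^ m * ?H" using P by (simp add: P_def)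
          ultimately show ?thesis by linarith
        qed
        ultimately show ?thesis unfolding St_def by blast
      qed
      ultimately show "y \<in> (\<Union>q\<in>Qs. St q)" by blast
    qed
    have "ennreal (real (card ?I) * ?H ^ n) = (\<Sum>\<nu>\<in>?I. emeasure ?M (B \<nu>))"
      using H by (simp add: eB ennreal_mult ennreal_of_nat_eq_real_of_nat)
    also have "\<dots> = emeasure ?M (\<Union>\<nu>\<in>?I. B \<nu>)"
      using Bm by (intro sum_emeasure disj finI) auto
    also have "\<dots> \<le> emeasure ?M (\<Union>q\<in>Qs. St q)"
      using sub fQ Stm by (intro emeasure_mono) auto
    also have "\<dots> \<le> (\<Sum>q\<in>Qs. emeasure ?M (St q))" using fQ Stm by (intro emeasure_subadditive_finite) auto
    also have "\<dots> \<le> (\<Sum>q\<in>Qs. ennreal (2 * r m * (2 * a + 5) * (2 * a + 2) ^ d))"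
    proof (rule sum_mono)
      fix q assume "q \<in> Qs"
      then obtain j where "j \<in> {..<n}" "q j \<noteq> 0" by (auto simp: Qs_def)
      with emeasure_strip_box[of "{..<n}" j q "-(a+1)" "a+1" "r m"] r0 rm a
      show "emeasure ?M (St q) \<le> ennreal (2 * r m * (2 * a + 5) * (2 * a + 2) ^ d)"
        by (simp add: St_def n_def algebra_simps)
    qed
    also have "\<dots> = ennreal (real (card Qs) * (2 * r m * (2 * a + 5) * (2 * a + 2) ^ d))"
      using r0 a by (simp add: ennreal_mult ennreal_of_nat_eq_real_of_nat)
    also have "\<dots> \<le> ennreal ((9 * 2 ^ m) ^ n * (2 * r m * (2 * a + 5) * (2 * a + 2) ^ d))"
    proof (rule ennreal_leI[OF mult_right_mono])
      have "card Qs \<le> card (PiE {..<n} (\<lambda>_. {- (4 * 2 ^ m)..4 * 2 ^ m :: int}))"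
        unfolding Qs_def by (intro card_mono finite_PiE) auto
      also have "\<dots> = (8 * 2 ^ m + 1) ^ n"
      proof -
        have "(4 * 2 ^ m :: int) - - (4 * 2 ^ m) + 1 = int (8 * 2 ^ m + 1)" by simp
        then show ?thesis by (simp only: card_PiE finite_lessThan prod_constant card_atLeastAtMost_int nat_int card_lessThan)
      qed
      finally have "real (card Qs) \<le> real ((8 * 2 ^ m + 1) ^ n)" by (simp only: of_nat_le_iff)
      also have "\<dots> = (8 * 2 ^ m + 1) ^ n" by (simp add: add.commute)
      also have "\<dots> \<le> (9 * 2 ^ m) ^ n" by (intro power_mono) auto
      finally show "real (card Qs) \<le> (9 * 2 ^ m) ^ n" .
      show "0 \<le> 2 * r m * (2 * a + 5) * (2 * a + 2) ^ d" using r0 a by simp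
    qed
    finally have "real (card ?I) * ?H ^ n \<le> (9 * 2 ^ m) ^ n * (2 * r m * (2 * a + 5) * (2 * a + 2) ^ d)"
      using r0 a by (subst (asm) ennreal_le_iff) auto
    also have "\<dots> = C a * (2 ^ m) ^ (d+2) * ?H"
      by (simp add: C_def r_def n_def power_mult_distrib algebra_simps)
    finally have "real (card ?I) * ?H ^ d * ?H \<le> C a * (2 ^ m) ^ (d+2) * ?H"
      by (simp add: n_def mult.assoc mult.commute[of ?H])
    then have "real (card ?I) * ?H ^ d \<le> C a * (2 ^ m) ^ (d+2)" using H by simp
    then have "real (card ?I) * ?H ^ d * ?H powr \<sigma> \<le> C a * (2 ^ m) ^ (d+2) * ?H powr \<sigma>" by (intro mult_right_mono) auto
    then show ?thesis using H by (simp add: s_def powr_add powr_realpow mult_ac)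
  qed
  \<comment> \<open>On a bounded part the cover by all levels from \<open>M\<close> on costs a tail
    of the convergent series.\<close>
  have null: "hausdorff_delta (distn n) s \<delta> {x \<in> A. \<forall>i<n. \<bar>x i\<bar> \<le> a} = 0" if \<delta>: "0 < \<delta>" and a: "0 \<le> a" for \<delta> a :: real
  proof -
    have "hausdorff_delta (distn n) s \<delta> {x \<in> A. \<forall>i<n. \<bar>x i\<bar> \<le> a} \<le> 0 + ennreal \<epsilon>" if \<epsilon>: "0 < \<epsilon>" for \<epsilon> :: real
    proof -
      define c where "c m = real n powr s * C a * ((2 ^ m) ^ (d+2) * h m powr \<sigma>)" for m
      have c0: "0 \<le> c m" for m using a by (simp add: c_def C_def)
      have sc: "summable c" unfolding c_def by (intro summable_mult sm)
      have "(\<lambda>M. \<Sum>k. c (k + M)) \<longlonglongrightarrow> 0" by (rule suminf_exist_split2[OF sc])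
      then have "eventually (\<lambda>M. (\<Sum>k. c (k + M)) < \<epsilon>) sequentially" using \<epsilon> by (rule order_tendstoD)
      moreover have "eventually (\<lambda>M. 2 ^ M * h M < min (1 / (2 + 4 * real n)) (\<delta> / real n)) sequentially"
        using h0 \<delta> by (intro order_tendstoD(2)[OF h0]) (auto simp: n_def)
      ultimately have "eventually (\<lambda>M. (\<Sum>k. c (k + M)) < \<epsilon> \<and> (\<forall>m\<ge>M. 2 ^ m * h m < min (1 / (2 + 4 * real n)) (\<delta> / real n))) sequentially"
        by (intro eventually_conj) (auto simp: eventually_all_ge_at_top)
      then obtain M where M: "(\<Sum>k. c (k + M)) < \<epsilon>" "\<And>m. M \<le> m \<Longrightarrow> 2 ^ m * h m < min (1 / (2 + 4 * real n)) (\<delta> / real n)"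
        unfolding eventually_sequentially by blast
      have rM: "r m \<le> 1" if "M \<le> m" for m
      proof -
        have "2 ^ m * h m < 1 / (2 + 4 * real n)" using M(2)[OF that] by simp
        then show ?thesis by (simp add: r_def field_simps)
      qed
      have hM: "real n * h m \<le> \<delta>" if "M \<le> m" for m
      proof -
        have "2 ^ m * h m < \<delta> / real n" using M(2)[OF that] by simp
        moreover have "1 * h m \<le> 2 ^ m * h m" using hpos[of m] by (intro mult_right_mono) auto
        ultimately have "h m \<le> \<delta> / real n" by simp
        then show ?thesis by (simp add: n_def field_simps)
      qed
      define cube where "cube m \<nu> = {x. \<forall>i<n. \<nu> i = \<lfloor>x i / h m\<rfloor>}" for m and \<nu> :: "nat \<Rightarrow> int"
      have dc: "diamd (distn n) (cube m \<nu>) \<le> ennreal (real n * h m)" for m \<nu>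
      proof (rule diamd_le, rule distn_le)
        fix x y i assume "x \<in> cube m \<nu>" "y \<in> cube m \<nu>" "i < n"
        then have "\<lfloor>x i / h m\<rfloor> = \<lfloor>y i / h m\<rfloor>" by (auto simp: cube_def)
        then have "\<bar>x i / h m - y i / h m\<bar> \<le> 1" by linarith
        then show "\<bar>x i - y i\<bar> \<le> h m" using hpos[of m] by (simp add: field_simps flip: diff_divide_distrib)
      qed (use hpos[of m] in simp)
      have "\<exists>e. bij_betw e {0..<card (\<iota> m ` S a m)} (\<iota> m ` S a m)" for m
        by (rule ex_bij_betw_nat_finite[OF finI])
      then obtain e where e: "\<And>m. bij_betw (e m) {0..<card (\<iota> m ` S a m)} (\<iota> m ` S a m)" by metis
      define U where "U k j = (if j < card (\<iota> (k+M) ` S a (k+M)) then cube (k+M) (e (k+M) j) else {})" for k j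
      have "hausdorff_delta (distn n) s \<delta> {x \<in> A. \<forall>i<n. \<bar>x i\<bar> \<le> a} \<le> (\<Sum>k. \<Sum>j. ennreal (enn2real (diamd (distn n) (U k j)) powr s))"
      proof (rule hausdorff_delta_le_suminf2)
        show "{x \<in> A. \<forall>i<n. \<bar>x i\<bar> \<le> a} \<subseteq> (\<Union>k. \<Union>j. U k j)"
        proof
          fix x assume x: "x \<in> {x \<in> A. \<forall>i<n. \<bar>x i\<bar> \<le> a}"
          then obtain m p q where m: "M \<le> m" "P m p q x" using A[of x M] unfolding P_def n_def by blast
          then have "\<iota> m x \<in> \<iota> m ` S a m" using x by (auto simp: S_def)
          then obtain j where j: "j < card (\<iota> m ` S a m)" "e m j = \<iota> m x"
            using e[of m] unfolding bij_betw_def by (metis (no_types, lifting) imageE atLeastLessThan_iff)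
          have "x \<in> cube m (e m j)" unfolding j(2) by (simp add: cube_def \<iota>_def)
          then have "x \<in> U (m - M) j" using j(1) m(1) by (simp add: U_def)
          then show "x \<in> (\<Union>k. \<Union>j. U k j)" by blast
        qed
        show "diamd (distn n) (U k j) \<le> ennreal \<delta>" for k j
          using order_trans[OF dc ennreal_leI[OF hM[of "k+M"]]] by (simp add: U_def)
      qed
      also have "\<dots> \<le> (\<Sum>k. ennreal (c (k + M)))"
      proof (rule suminf_le)
        fix k
        let ?m = "k + M"
        let ?N = "card (\<iota> ?m ` S a ?m)"
        have "(\<Sum>j. ennreal (enn2real (diamd (distn n) (U k j)) powr s)) = (\<Sum>j<?N. ennreal (enn2real (diamd (distn n) (U k j)) powr s))"
          by (rule suminf_finite) (use s in \<open>auto simp: U_def\<close>)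
        also have "\<dots> \<le> (\<Sum>j<?N. ennreal ((real n * h ?m) powr s))"
        proof (intro sum_mono ennreal_leI powr_mono2)
          fix j assume "j \<in> {..<?N}"
          then show "enn2real (diamd (distn n) (U k j)) \<le> real n * h ?m"
            using dc hpos[of ?m] by (intro enn2real_leI) (auto simp: U_def)
        qed (use s in auto)
        also have "\<dots> = ennreal (real ?N * (real n * h ?m) powr s)" by (simp add: ennreal_mult ennreal_of_nat_eq_real_of_nat)
        also have "\<dots> \<le> ennreal (c ?m)"
        proof (rule ennreal_leI)
          have "real ?N * (real n * h ?m) powr s = real n powr s * (real ?N * h ?m powr s)"
            using hpos[of ?m] by (simp add: powr_mult)
          also have "\<dots> \<le> real n powr s * (C a * ((2 ^ ?m) ^ (d+2) * h ?m powr \<sigma>))"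
            by (intro mult_left_mono count a rM) auto
          finally show "real ?N * (real n * h ?m) powr s \<le> c ?m" by (simp add: c_def mult.assoc)
        qed
        finally show "(\<Sum>j. ennreal (enn2real (diamd (distn n) (U k j)) powr s)) \<le> ennreal (c (k + M))" .
      qed auto
      also have "\<dots> = ennreal (\<Sum>k. c (k + M))"
        by (rule suminf_ennreal2) (use c0 sc in \<open>auto simp: summable_iff_shift\<close>)
      also have "\<dots> \<le> ennreal \<epsilon>" using M(1) by (intro ennreal_leI) simp
      finally show ?thesis by simp
    qed
    then have "hausdorff_delta (distn n) s \<delta> {x \<in> A. \<forall>i<n. \<bar>x i\<bar> \<le> a} \<le> 0" using ennreal_le_epsilon[of 0] by blast
    then show ?thesis by simp
  qed
  have "hausdorff_delta (distn n) s \<delta> A = 0" if \<delta>: "0 < \<delta>" for \<delta> :: real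
  proof -
    have "A = (\<Union>k. {x \<in> A. \<forall>i<n. \<bar>x i\<bar> \<le> real k})"
    proof
      show "A \<subseteq> (\<Union>k. {x \<in> A. \<forall>i<n. \<bar>x i\<bar> \<le> real k})"
      proof
        fix x assume x: "x \<in> A"
        obtain k :: nat where k: "(\<Sum>i<n. \<bar>x i\<bar>) \<le> real k" using real_arch_simple by blast
        have "\<bar>x i\<bar> \<le> real k" if "i < n" for i
          using member_le_sum[of i "{..<n}" "\<lambda>i. \<bar>x i\<bar>"] that k by simp
        then show "x \<in> (\<Union>k. {x \<in> A. \<forall>i<n. \<bar>x i\<bar> \<le> real k})" using x by blast
      qed
    qed auto
    moreover have "hausdorff_delta (distn n) s \<delta> (\<Union>k. {x \<in> A. \<forall>i<n. \<bar>x i\<bar> \<le> real k}) = 0"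
      by (intro hausdorff_delta_UN_null null \<delta>) simp
    ultimately show ?thesis by simp
  qed
  then have "hausdorff_measure (distn n) s A = 0" unfolding hausdorff_measure_def by (simp add: SUP_eq_const)
  then show ?thesis by (simp add: n_def s_def)
qed

section \<open>Simultaneous diagonalisation of quadratic forms\<close>

text \<open>Passage to matrices that carry their dimension. Entries outside the block are forgotten,
  so equality of \<open>mt\<close> is equality of the blocks.\<close>

definition mt :: "nat \<Rightarrow> (nat \<Rightarrow> nat \<Rightarrow> 'a) \<Rightarrow> 'a mat" where
  "mt N A = mat N N (\<lambda>(i, j). A i j)"

definition bil :: "nat \<Rightarrow> (nat \<Rightarrow> nat \<Rightarrow> real) \<Rightarrow> (nat \<Rightarrow> real) \<Rightarrow> (nat \<Rightarrow> real) \<Rightarrow> real" where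
  "bil N Q v w = (\<Sum>i<N. \<Sum>j<N. v i * Q i j * w j)"

lemma mt_carrier [simp]: "mt N A \<in> carrier_mat N N"
  by (simp add: mt_def)

lemma detN_eq_det: "detN N A = Determinant.det (mt N A)"
proof -
  have "(\<Prod>i<N. A i (p i)) = (\<Prod>i = 0..<N. mt N A $$ (i, p i))" if "p permutes {..<N}" for p
  proof -
    have "p i < N" if "i < N" for i using permutes_in_image[OF \<open>p permutes {..<N}\<close>, of i] that by simp
    then show ?thesis by (intro prod.cong) (auto simp: mt_def)
  qed
  then show ?thesis
    unfolding detN_def det_def'[OF mt_carrier] by (intro sum.cong) (auto simp: lessThan_atLeast0)
qed

lemma mt_mult:
  fixes A B :: "nat \<Rightarrow> nat \<Rightarrow> 'a :: comm_ring_1"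
  shows "mt N A * mt N B = mt N (\<lambda>i j. \<Sum>k<N. A i k * B k j)"
proof (rule eq_matI)
  fix i j assume "i < dim_row (mt N (\<lambda>i j. \<Sum>k<N. A i k * B k j))" "j < dim_col (mt N (\<lambda>i j. \<Sum>k<N. A i k * B k j))"
  then have ij: "i < N" "j < N" by (simp_all add: mt_def)
  have r: "row (mt N A) i = vec N (A i)" using ij by (intro eq_vecI) (simp_all add: mt_def)
  have c: "col (mt N B) j = vec N (\<lambda>k. B k j)" using ij by (intro eq_vecI) (simp_all add: mt_def)
  have "(mt N A * mt N B) $$ (i, j) = row (mt N A) i \<bullet> col (mt N B) j"
    using ij by (intro index_mult_mat(1)) (simp_all add: mt_def)
  also have "\<dots> = (\<Sum>k<N. A i k * B k j)"
    unfolding r c scalar_prod_def dim_vec lessThan_atLeast0 by (intro sum.cong) simp_all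
  finally show "(mt N A * mt N B) $$ (i, j) = mt N (\<lambda>i j. \<Sum>k<N. A i k * B k j) $$ (i, j)"
    using ij by (simp add: mt_def)
qed (simp_all add: mt_def)

lemma mt_transpose: "transpose_mat (mt N A) = mt N (\<lambda>i j. A j i)"
  by (rule eq_matI) (auto simp: mt_def)

lemma mt_cong: "(\<And>i j. i < N \<Longrightarrow> j < N \<Longrightarrow> A i j = B i j) \<Longrightarrow> mt N A = mt N B"
  by (rule eq_matI) (auto simp: mt_def)

lemma mt_eqD: "mt N A = mt N B \<Longrightarrow> i < N \<Longrightarrow> j < N \<Longrightarrow> A i j = B i j"
  unfolding mt_def by (metis (no_types, lifting) index_mat(1) old.prod.case)

lemma mt_one: "1\<^sub>m N = mt N (\<lambda>i j. if i = j then 1 else 0)"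
  by (rule eq_matI) (auto simp: mt_def)

lemma detN_mult:
  "detN N (\<lambda>i j. \<Sum>k<N. A i k * B k j) = detN N A * detN N B"
  by (simp add: detN_eq_det mt_mult[symmetric] det_mult[OF mt_carrier mt_carrier])

lemma detN_transpose: "detN N (\<lambda>i j. A j i) = detN N A"
  unfolding detN_eq_det mt_transpose[of N A, symmetric] by (rule det_transpose[OF mt_carrier])

lemma detN_cong: "(\<And>i j. i < N \<Longrightarrow> j < N \<Longrightarrow> A i j = B i j) \<Longrightarrow> detN N A = detN N B"
  unfolding detN_eq_det by (simp cong: mt_cong)

lemma bil_add: "bil N Q v (\<lambda>i. w i + u i) = bil N Q v w + bil N Q v u"
  by (simp add: bil_def sum.distrib[symmetric] algebra_simps)

lemma bil_scale: "bil N Q v (\<lambda>i. c * w i) = c * bil N Q v w"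
  by (simp add: bil_def sum_distrib_left mult_ac)

lemma bil_diff: "bil N Q v (\<lambda>i. w i - u i) = bil N Q v w - bil N Q v u"
  by (simp add: bil_def sum_subtractf[symmetric] algebra_simps)

lemma bil_sum: "finite S \<Longrightarrow> bil N Q v (\<lambda>i. \<Sum>s\<in>S. c s * f s i) = (\<Sum>s\<in>S. c s * bil N Q v (f s))"
proof (induction S rule: finite_induct)
  case empty show ?case by (simp add: bil_def)
next
  case (insert x S)
  then show ?case by (simp add: bil_add bil_scale)
qed

lemma bil_commute:
  assumes "\<And>i j. i < N \<Longrightarrow> j < N \<Longrightarrow> Q i j = Q j i"
  shows "bil N Q v w = bil N Q w v"
proof -
  have "bil N Q v w = (\<Sum>j<N. \<Sum>i<N. v i * Q i j * w j)" unfolding bil_def by (rule sum.swap)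
  also have "\<dots> = bil N Q w v" unfolding bil_def using assms by (intro sum.cong) auto
  finally show ?thesis .
qed

lemma bil_cong:
  assumes "\<And>i. i < N \<Longrightarrow> v i = v' i" "\<And>i. i < N \<Longrightarrow> w i = w' i"
  shows "bil N Q v w = bil N Q v' w'"
  unfolding bil_def using assms by (intro sum.cong) auto

lemma act_eq_bil: "i < N \<Longrightarrow> j < N \<Longrightarrow> act N Q B i j = bil N Q (\<lambda>k. B k i) (\<lambda>k. B k j)"
  by (simp add: act_def bil_def)

lemma mt_act: "mt N (act N Q B) = transpose_mat (mt N B) * mt N Q * mt N B"
proof -
  have "act N Q B i j = (\<Sum>l<N. (\<Sum>k<N. B k i * Q k l) * B l j)" if "i < N" "j < N" for i j
    using that by (simp add: act_def sum_distrib_right) (rule sum.swap)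
  then show ?thesis by (simp add: mt_transpose mt_mult cong: mt_cong)
qed

text \<open>Padding with zero rows gives a square matrix whose transpose kills the unit vector
  \<open>k\<close>; it is singular and so has a nontrivial kernel.\<close>

lemma homogeneous_system:
  fixes a :: "nat \<Rightarrow> nat \<Rightarrow> real"
  assumes "k < N"
  shows "\<exists>v. (\<exists>j<N. v j \<noteq> 0) \<and> (\<forall>i<k. (\<Sum>j<N. a i j * v j) = 0)"
proof -
  define A where "A = mt N (\<lambda>i j. if i < k then a i j else 0)"
  have A: "A \<in> carrier_mat N N" by (simp add: A_def)
  have "transpose_mat A *\<^sub>v unit_vec N k = 0\<^sub>v N"
    using assms by (intro eq_vecI) (auto simp: A_def mt_def)
  moreover have "unit_vec N k \<noteq> (0\<^sub>v N :: real vec)"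
    using assms by (metis index_unit_vec(1) index_zero_vec(1) zero_neq_one)
  ultimately have "Determinant.det (transpose_mat A) = 0"
    using A det_0_iff_vec_prod_zero_field[of "transpose_mat A" N] by (metis transpose_carrier_mat unit_vec_carrier)
  then have "Determinant.det A = 0" by (simp add: det_transpose[OF A])
  then obtain v where v: "v \<in> carrier_vec N" "v \<noteq> 0\<^sub>v N" "A *\<^sub>v v = 0\<^sub>v N"
    using det_0_iff_vec_prod_zero_field[OF A] by blast
  have dv: "dim_vec v = N" using v(1) by simp
  have "\<exists>j<N. vec_index v j \<noteq> 0"
  proof (rule ccontr)
    assume "\<not> (\<exists>j<N. vec_index v j \<noteq> 0)"
    then have "v = 0\<^sub>v N" using dv by (intro eq_vecI) auto
    then show False using v(2) by simp
  qed
  moreover have "(\<Sum>j<N. a i j * vec_index v j) = 0" if "i < k" for i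
  proof -
    have "vec_index (A *\<^sub>v v) i = 0" using v(3) that assms by simp
    then show ?thesis using that assms dv by (simp add: A_def mt_def scalar_prod_def lessThan_atLeast0)
  qed
  ultimately show ?thesis by blast
qed

text \<open>Vectors are functions on all naturals that vanish from \<open>N\<close> on, so the set
  is closed in a product of compact intervals and Tychonoff's theorem applies.\<close>

lemma compact_sphere:
  fixes a :: "nat \<Rightarrow> nat \<Rightarrow> real"
  shows "compact {v :: nat \<Rightarrow> real. (\<forall>j\<ge>N. v j = 0) \<and> (\<Sum>j<N. (v j)\<^sup>2) = 1 \<and> (\<forall>i<k. (\<Sum>j<N. a i j * v j) = 0)}"
    (is "compact ?S")
proof -
  let ?K = "PiE UNIV (\<lambda>j. if j < N then {-1..1} else {0}) :: (nat \<Rightarrow> real) set"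
  have "compactin (product_topology (\<lambda>_. euclidean) UNIV) ?K"
    by (subst compactin_PiE) auto
  then have K: "compact ?K" by (simp add: euclidean_product_topology)
  have cc: "continuous_on UNIV (\<lambda>v :: nat \<Rightarrow> real. v j)" for j by simp
  have "closed {v :: nat \<Rightarrow> real. (\<Sum>j<N. (v j)\<^sup>2) = 1}"
    by (intro closed_Collect_eq continuous_intros cc)
  moreover have "closed {v :: nat \<Rightarrow> real. \<forall>i<k. (\<Sum>j<N. a i j * v j) = 0}"
    by (intro closed_Collect_all closed_Collect_imp open_Collect_const closed_Collect_eq continuous_intros cc)
  moreover have "?S = ?K \<inter> {v. (\<Sum>j<N. (v j)\<^sup>2) = 1} \<inter> {v. \<forall>i<k. (\<Sum>j<N. a i j * v j) = 0}"
  proof -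
    have "v \<in> ?K" if "\<forall>j\<ge>N. v j = 0" "(\<Sum>j<N. (v j)\<^sup>2) = 1" for v :: "nat \<Rightarrow> real"
    proof -
      have "\<bar>v j\<bar> \<le> 1" if "j < N" for j
      proof -
        have "(v j)\<^sup>2 \<le> (\<Sum>j<N. (v j)\<^sup>2)" using that by (intro member_le_sum) auto
        then have "(v j)\<^sup>2 \<le> 1" using \<open>(\<Sum>j<N. (v j)\<^sup>2) = 1\<close> by simp
        then show ?thesis by (simp add: abs_square_le_1)
      qed
      then show ?thesis using that(1) by (auto simp: PiE_def Pi_def abs_le_iff minus_le_iff not_less)
    qed
    moreover have "v j = 0" if "v \<in> ?K" "N \<le> j" for v j
      using PiE_mem[OF that(1), of j] that(2) by simp
    ultimately show ?thesis by blast
  qed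
  ultimately show ?thesis using K by (simp add: compact_Int_closed)
qed

lemma bil_continuous [continuous_intros]: "continuous_on UNIV (\<lambda>v. bil N Q v v)"
proof -
  have cc: "continuous_on UNIV (\<lambda>v :: nat \<Rightarrow> real. v j)" for j by simp
  show ?thesis unfolding bil_def by (intro continuous_intros cc)
qed

text \<open>Positive definiteness seen on the block alone, unlike \<open>posdef_form\<close>; this
  suits forms obtained from products and inverses of matrices.\<close>

definition pd :: "nat \<Rightarrow> (nat \<Rightarrow> nat \<Rightarrow> real) \<Rightarrow> bool" where
  "pd N Q \<longleftrightarrow> (\<forall>i<N. \<forall>j<N. Q i j = Q j i) \<and> (\<forall>v. (\<exists>i<N. v i \<noteq> 0) \<longrightarrow> 0 < bil N Q v v)"

text \<open>The eigenvector is a maximiser of the Rayleigh quotient on the orthogonal complement of the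
  previously constructed eigenvectors.\<close>
lemma next_eigenvector:
  assumes Q: "pd N Q" and D: "\<forall>i<N. \<forall>j<N. D i j = D j i" and k: "k < N"
    and b: "\<forall>i<k. \<forall>j<k. bil N Q (b i) (b j) = (if i = j then 1 else 0)"
    and eig: "\<forall>i<k. \<forall>w. bil N D (b i) w = l i * bil N Q (b i) w"
  shows "\<exists>v c. bil N Q v v = 1 \<and> (\<forall>i<k. bil N Q (b i) v = 0) \<and> (\<forall>w. bil N D v w = c * bil N Q v w)"
proof -
  note Qs = Q[unfolded pd_def, THEN conjunct1, rule_format] and Qp = Q[unfolded pd_def, THEN conjunct2, rule_format]
  define a where "a i j = (\<Sum>m<N. b i m * Q m j)" for i j
  have a: "(\<Sum>j<N. a i j * v j) = bil N Q (b i) v" for i v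
    unfolding a_def bil_def sum_distrib_right by (rule sum.swap)
  let ?S = "{v :: nat \<Rightarrow> real. (\<forall>j\<ge>N. v j = 0) \<and> (\<Sum>j<N. (v j)\<^sup>2) = 1 \<and> (\<forall>i<k. (\<Sum>j<N. a i j * v j) = 0)}"
  have nz: "\<exists>i<N. v i \<noteq> 0" if "v \<in> ?S" for v
    using that by (metis (mono_tags, lifting) lessThan_iff mem_Collect_eq power_zero_numeral sum.neutral zero_neq_one)
  have toS: "\<exists>c>0. (\<lambda>j. if j < N then c * u j else 0) \<in> ?S" if u: "\<exists>i<N. u i \<noteq> 0" "\<forall>i<k. bil N Q (b i) u = 0" for u
  proof -
    define c where "c = 1 / sqrt (\<Sum>j<N. (u j)\<^sup>2)"
    obtain i where "i < N" "u i \<noteq> 0" using u(1) by blast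
    then have pos: "0 < (\<Sum>j<N. (u j)\<^sup>2)" by (intro sum_pos2[of _ i]) auto
    have "(\<Sum>j<N. (c * u j)\<^sup>2) = c\<^sup>2 * (\<Sum>j<N. (u j)\<^sup>2)" by (simp add: power_mult_distrib sum_distrib_left)
    also have "\<dots> = 1" using pos by (simp add: c_def power_divide)
    finally have 1: "(\<Sum>j<N. (c * u j)\<^sup>2) = 1" .
    have 2: "bil N Q (b i) (\<lambda>j. if j < N then c * u j else 0) = 0" if "i < k" for i
    proof -
      have "bil N Q (b i) (\<lambda>j. if j < N then c * u j else 0) = bil N Q (b i) (\<lambda>j. c * u j)" by (rule bil_cong) auto
      then show ?thesis using u(2) that by (simp add: bil_scale)
    qed
    have "0 < c" using pos by (simp add: c_def)
    then show ?thesis using 1 2 by (intro exI[of _ c]) (simp add: a)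
  qed
  obtain u where "\<exists>j<N. u j \<noteq> 0" "\<forall>i<k. (\<Sum>j<N. a i j * u j) = 0" using homogeneous_system[OF k] by blast
  then obtain c0 where "(\<lambda>j. if j < N then c0 * u j else 0) \<in> ?S" using toS[of u] unfolding a by metis
  then have ne: "?S \<noteq> {}" by (metis empty_iff)
  have "continuous_on ?S (\<lambda>v. bil N D v v / bil N Q v v)"
  proof (intro continuous_on_divide ballI)
    show "continuous_on ?S (\<lambda>v. bil N D v v)" "continuous_on ?S (\<lambda>v. bil N Q v v)"
      by (rule continuous_on_subset[OF bil_continuous subset_UNIV])+
    fix v assume "v \<in> ?S"
    from Qp[OF nz[OF this]] show "bil N Q v v \<noteq> 0" by simp
  qed
  from continuous_attains_sup[OF compact_sphere ne this] obtain x where x: "x \<in> ?S"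
    and xmax: "\<And>v. v \<in> ?S \<Longrightarrow> bil N D v v / bil N Q v v \<le> bil N D x x / bil N Q x x" by blast
  define c where "c = bil N D x x / bil N Q x x"
  have Qx: "0 < bil N Q x x" using Qp nz[OF x] by blast
  have xort: "bil N Q (b i) x = 0" if "i < k" for i using x that by (simp add: a)
  \<comment> \<open>By maximality \<open>F\<close> is nonnegative on the orthogonal complement and
    vanishes at \<open>x\<close>; the first variation then puts \<open>x\<close> into its radical,
    which is the eigenvector equation.\<close>
  define F where "F u w = c * bil N Q u w - bil N D u w" for u w
  have Fsym: "F u w = F w u" for u w
    unfolding F_def using bil_commute[of N Q, OF Qs] bil_commute[of N D] D by metis
  have Fadd: "F u (\<lambda>i. w i + e * w' i) = F u w + e * F u w'" for u w w' e
    by (simp add: F_def bil_add bil_scale algebra_simps)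
  have Fnn: "0 \<le> F u u" if u: "\<forall>i<k. bil N Q (b i) u = 0" for u
  proof (cases "\<exists>i<N. u i \<noteq> 0")
    case True
    from toS[OF this u] obtain e where e: "0 < e" "(\<lambda>j. if j < N then e * u j else 0) \<in> ?S" by blast
    have sc: "bil N P (\<lambda>j. if j < N then e * u j else 0) (\<lambda>j. if j < N then e * u j else 0) = e\<^sup>2 * bil N P u u" for P
    proof -
      have "bil N P (\<lambda>j. if j < N then e * u j else 0) (\<lambda>j. if j < N then e * u j else 0) = bil N P (\<lambda>j. e * u j) (\<lambda>j. e * u j)"
        by (rule bil_cong) auto
      then show ?thesis by (simp add: bil_def sum_distrib_left power2_eq_square mult_ac)
    qed
    have "bil N D u u / bil N Q u u \<le> c" using xmax[OF e(2)] e(1) unfolding sc c_def by simp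
    moreover have "0 < bil N Q u u" using Qp True by blast
    ultimately show ?thesis by (simp add: F_def field_simps)
  next
    case False
    then have "bil N P u u = 0" for P by (simp add: bil_def)
    then show ?thesis by (simp add: F_def)
  qed
  have Fx: "F x x = 0" using Qx by (simp add: F_def c_def)
  have Fort: "F x w = 0" if w: "\<forall>i<k. bil N Q (b i) w = 0" for w
  proof -
    have ge: "0 \<le> 2 * e * F x w + e\<^sup>2 * F w w" for e
    proof -
      have "0 \<le> F (\<lambda>i. x i + e * w i) (\<lambda>i. x i + e * w i)"
        by (rule Fnn) (use w xort in \<open>simp add: bil_add bil_scale\<close>)
      also have "\<dots> = 2 * e * F x w + e\<^sup>2 * F w w"
        using Fx by (simp add: Fadd Fsym[of "\<lambda>i. x i + e * w i"] Fsym[of w x] power2_eq_square algebra_simps)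
      finally show ?thesis .
    qed
    show ?thesis
    proof (rule ccontr)
      assume nz: "F x w \<noteq> 0"
      have Fw: "0 \<le> F w w" by (rule Fnn[OF w])
      \<comment> \<open>A small positive multiple of \<open>- F x w\<close>; the denominator
        \<open>F w w + 1\<close> makes the quadratic negative also when
        \<open>F w w = 0\<close>.\<close>
      define e where "e = - F x w / (F w w + 1)"
      have "2 * e * F x w + e\<^sup>2 * F w w = - (F x w)\<^sup>2 * (F w w + 2) / (F w w + 1)\<^sup>2"
        using Fw unfolding e_def by (simp add: field_simps power2_eq_square add_nonneg_eq_0_iff)
      also have "\<dots> < 0" using nz Fw by (intro divide_neg_pos mult_neg_pos) auto
      finally show False using ge[of e] by simp
    qed
  qed
  \<comment> \<open>Subtract from \<open>w\<close> its projection to the earlier eigenvectors; on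
    these \<open>F x\<close> vanishes by their own eigenvector equations and their orthogonality to
    \<open>x\<close>.\<close>
  have Fall: "F x w = 0" for w
  proof -
    define w' where "w' j = w j - (\<Sum>i<k. bil N Q (b i) w * b i j)" for j
    have "bil N Q (b m) w' = 0" if "m < k" for m
    proof -
      have "bil N Q (b m) w' = bil N Q (b m) w - (\<Sum>i<k. bil N Q (b i) w * bil N Q (b m) (b i))"
        unfolding w'_def by (simp add: bil_diff bil_sum)
      also have "(\<Sum>i<k. bil N Q (b i) w * bil N Q (b m) (b i)) = (\<Sum>i<k. if i = m then bil N Q (b i) w else 0)"
        using that b by (intro sum.cong) auto
      finally show ?thesis using that by simp
    qed
    then have 0: "F x w' = 0" by (intro Fort) blast
    have Fb: "F x (b i) = 0" if "i < k" for i
      using xort[OF that] eig that by (subst Fsym) (simp add: F_def)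
    have "F x w' = F x w - (\<Sum>i<k. bil N Q (b i) w * F x (b i))"
    proof -
      have "bil N P x w' = bil N P x w - (\<Sum>i<k. bil N Q (b i) w * bil N P x (b i))" for P
        unfolding w'_def bil_diff bil_sum[of "{..<k}" N P x "\<lambda>i. bil N Q (b i) w" b, OF finite_lessThan] ..
      then show ?thesis
        by (simp add: F_def right_diff_distrib sum_distrib_left sum_subtractf mult.left_commute)
    qed
    then show ?thesis using 0 Fb by simp
  qed
  define v where "v j = 1 / sqrt (bil N Q x x) * x j" for j
  have com: "bil N P v w = 1 / sqrt (bil N Q x x) * bil N P x w" for P w
    unfolding v_def by (simp add: bil_def sum_distrib_left mult.assoc)
  show ?thesis
  proof (intro exI[of _ v] exI[of _ c] conjI allI impI)
    have "bil N Q v v = 1 / sqrt (bil N Q x x) * (1 / sqrt (bil N Q x x) * bil N Q x x)"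
    proof -
      have "bil N Q x v = 1 / sqrt (bil N Q x x) * bil N Q x x" unfolding v_def by (rule bil_scale)
      then show ?thesis by (simp only: com)
    qed
    then show "bil N Q v v = 1" using Qx by (simp add: real_div_sqrt)
    show "bil N Q (b i) v = 0" if "i < k" for i unfolding v_def bil_scale using xort[OF that] by simp
    show "bil N D v w = c * bil N Q v w" for w unfolding com using Fall[of w] by (simp add: F_def)
  qed
qed

lemma eigenbasis:
  assumes Q: "pd N Q" and D: "\<forall>i<N. \<forall>j<N. D i j = D j i" and k: "k \<le> N"
  shows "\<exists>b l. (\<forall>i<k. \<forall>j<k. bil N Q (b i) (b j) = (if i = j then 1 else 0)) \<and>
           (\<forall>i<k. \<forall>w. bil N D (b i) w = l i * bil N Q (b i) w)"
  using k
proof (induction k)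
  case 0 show ?case by simp
next
  case (Suc k)
  from Suc.IH[OF Suc_leD[OF Suc.prems]] obtain b l where
    "(\<forall>i<k. \<forall>j<k. bil N Q (b i) (b j) = (if i = j then 1 else 0)) \<and> (\<forall>i<k. \<forall>w. bil N D (b i) w = l i * bil N Q (b i) w)"
    by (elim exE)
  then have b: "\<forall>i<k. \<forall>j<k. bil N Q (b i) (b j) = (if i = j then 1 else 0)"
    "\<forall>i<k. \<forall>w. bil N D (b i) w = l i * bil N Q (b i) w" by simp_all
  obtain v c where v: "bil N Q v v = 1" "\<forall>i<k. bil N Q (b i) v = 0" "\<forall>w. bil N D v w = c * bil N Q v w"
    using next_eigenvector[OF Q D Suc_le_lessD[OF Suc.prems] b] by blast
  have Qc: "bil N Q u w = bil N Q w u" for u w by (rule bil_commute) (use Q in \<open>simp add: pd_def\<close>)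
  show ?case
    by (rule exI[of _ "b(k := v)"], rule exI[of _ "l(k := c)"]) (use b v Qc in \<open>auto simp: less_Suc_eq\<close>)
qed

text \<open>The columns of \<open>B\<close> are a \<open>Q\<close>-orthonormal basis of eigenvectors
  and \<open>l\<close> are the eigenvalues of \<open>D\<close> relative to \<open>Q\<close>. In
  matrix form, congruences and inverses become pure algebra.\<close>

definition simdiag :: "nat \<Rightarrow> (nat \<Rightarrow> nat \<Rightarrow> real) \<Rightarrow> (nat \<Rightarrow> nat \<Rightarrow> real) \<Rightarrow> (nat \<Rightarrow> nat \<Rightarrow> real) \<Rightarrow> (nat \<Rightarrow> real) \<Rightarrow> bool" where
  "simdiag N Q D B l \<longleftrightarrow> transpose_mat (mt N B) * mt N Q * mt N B = 1\<^sub>m N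
     \<and> transpose_mat (mt N B) * mt N D * mt N B = mt N (\<lambda>i j. if i = j then l i else 0)"

lemma simdiag_exists:
  assumes Q: "pd N Q" and D: "\<forall>i<N. \<forall>j<N. D i j = D j i"
  shows "\<exists>B l. simdiag N Q D B l"
proof -
  from eigenbasis[OF Q D order_refl] obtain b l where
    b: "(\<forall>i<N. \<forall>j<N. bil N Q (b i) (b j) = (if i = j then 1 else 0)) \<and> (\<forall>i<N. \<forall>w. bil N D (b i) w = l i * bil N Q (b i) w)"
    by (elim exE)
  have "simdiag N Q D (\<lambda>k i. b i k) l"
    unfolding simdiag_def mt_act[symmetric] mt_one
    using b by (auto intro!: mt_cong simp: act_eq_bil)
  then show ?thesis by blast
qed

text \<open>Multiplicities of roots become counts of indices, which turns the sum over roots in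
  \<open>pdist\<close> into a sum over the eigenvalues.\<close>

lemma order_prod_linear:
  fixes l :: "'i \<Rightarrow> real"
  assumes "finite S"
  shows "(\<Prod>i\<in>S. [:l i, -1:]) \<noteq> 0 \<and> order \<mu> (\<Prod>i\<in>S. [:l i, -1:]) = card {i\<in>S. l i = \<mu>}"
  using assms
proof (induction S rule: finite_induct)
  case empty
  then show ?case by simp
next
  case (insert x S)
  have o: "order \<mu> [:l x, -1:] = (if l x = \<mu> then 1 else 0)"
  proof (cases "l x = \<mu>")
    case True
    have "[:l x, -1:] = Polynomial.smult (-1) [:-\<mu>, 1:]" using True by simp
    then have "order \<mu> [:l x, -1:] = order \<mu> [:-\<mu>, 1:]" by (simp only: order_smult)
    also have "\<dots> = 1" using order_power_n_n[of \<mu> 1] by simp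
    finally show ?thesis using True by simp
  next
    case False
    then show ?thesis by (simp add: order_0I)
  qed
  have nz: "[:l x, -1:] * (\<Prod>i\<in>S. [:l i, -1:]) \<noteq> 0"
    by (rule no_zero_divisors) (use insert.IH in simp_all)
  have "{i \<in> insert x S. l i = \<mu>} = (if l x = \<mu> then insert x {i\<in>S. l i = \<mu>} else {i\<in>S. l i = \<mu>})" by auto
  then have "card {i \<in> insert x S. l i = \<mu>} = (if l x = \<mu> then 1 else 0) + card {i\<in>S. l i = \<mu>}"
    using insert.hyps by simp
  then show ?case
    unfolding prod.insert[OF insert.hyps] using nz order_mult[OF nz, of \<mu>] o insert.IH by (simp only: simp_thms)
qed

lemma sum_two_coeffs: "(\<Sum>k\<in>S. [:f k, g k:]) = [:\<Sum>k\<in>S. f k, \<Sum>k\<in>S. g k:]"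
  by (induction S rule: infinite_finite_induct) auto

lemma det_mt_diag:
  fixes f :: "nat \<Rightarrow> 'a :: comm_ring_1"
  shows "Determinant.det (mt N (\<lambda>i j. if i = j then f i else 0)) = (\<Prod>i<N. f i)"
proof -
  let ?A = "mt N (\<lambda>i j. if i = j then f i else 0)"
  have "Determinant.det ?A = prod_list (diag_mat ?A)"
    by (rule det_upper_triangular[of _ N]) (auto simp: mt_def upper_triangular_def)
  also have "diag_mat ?A = map f [0..<N]" by (auto simp: diag_mat_def mt_def)
  also have "prod_list (map f [0..<N]) = (\<Prod>i<N. f i)"
    using prod.distinct_set_conv_list[of "[0..<N]" f] by (simp add: atLeast0LessThan)
  finally show ?thesis .
qed

interpretation const_poly_hom: comm_ring_hom "\<lambda>x :: real. [:x:]"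
  by unfold_locales (auto simp: one_pCons)

lemma det_congruence:
  fixes B P :: "nat \<Rightarrow> nat \<Rightarrow> 'a :: comm_ring_1"
  shows "Determinant.det (transpose_mat (mt N B) * mt N P * mt N B)
    = (Determinant.det (mt N B))\<^sup>2 * Determinant.det (mt N P)"
proof -
  have 1: "transpose_mat (mt N B) \<in> carrier_mat N N" by simp
  have 2: "transpose_mat (mt N B) * mt N P \<in> carrier_mat N N" by (rule mult_carrier_mat[OF 1 mt_carrier])
  show ?thesis
    unfolding det_mult[OF 2 mt_carrier] det_mult[OF 1 mt_carrier] det_transpose[OF mt_carrier]
    by (simp add: power2_eq_square mult_ac)
qed

lemma mt_one_mult [simp]: "1\<^sub>m N * mt N A = mt N (A :: nat \<Rightarrow> nat \<Rightarrow> real)" "mt N A * 1\<^sub>m N = mt N A"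
  by (rule left_mult_one_mat[OF mt_carrier], rule right_mult_one_mat[OF mt_carrier])

context
  fixes N :: nat and Q D B :: "nat \<Rightarrow> nat \<Rightarrow> real" and l :: "nat \<Rightarrow> real"
  assumes sd: "simdiag N Q D B l"
begin

lemma simdiag_Q: "i < N \<Longrightarrow> j < N \<Longrightarrow> bil N Q (\<lambda>k. B k i) (\<lambda>k. B k j) = (if i = j then 1 else 0)"
  using sd mt_eqD[of N "act N Q B" "\<lambda>i j. if i = j then 1 else 0" i j]
  by (simp add: simdiag_def mt_act[symmetric] mt_one act_eq_bil)

lemma simdiag_D: "i < N \<Longrightarrow> j < N \<Longrightarrow> bil N D (\<lambda>k. B k i) (\<lambda>k. B k j) = (if i = j then l i else 0)"
  using sd mt_eqD[of N "act N D B" "\<lambda>i j. if i = j then l i else 0" i j]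
  by (simp add: simdiag_def mt_act[symmetric] act_eq_bil)

lemma simdiag_det_Q: "(detN N B)\<^sup>2 * detN N Q = 1"
proof -
  have "Determinant.det (transpose_mat (mt N B) * mt N Q * mt N B) = 1" using sd by (simp add: simdiag_def)
  then show ?thesis by (simp only: det_congruence detN_eq_det)
qed

lemma simdiag_det_D: "(detN N B)\<^sup>2 * detN N D = (\<Prod>i<N. l i)"
proof -
  have "Determinant.det (transpose_mat (mt N B) * mt N D * mt N B) = (\<Prod>i<N. l i)"
    using sd by (simp add: simdiag_def det_mt_diag)
  then show ?thesis by (simp only: det_congruence detN_eq_det)
qed

text \<open>The congruence by \<open>B\<close> is carried out over the polynomial ring, with the
  entries of \<open>B\<close> as constants; the determinant picks up the square of
  \<open>detN N B\<close>.\<close>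

lemma simdiag_charpoly: "Polynomial.smult ((detN N B)\<^sup>2) (rel_charpoly N Q D) = (\<Prod>i<N. [:l i, -1:])"
proof -
  let ?P = "\<lambda>i j. [:D i j, - Q i j:]" and ?B = "\<lambda>i j. [:B i j:]"
  have entry: "(\<Sum>k<N. (\<Sum>m<N. ?B m i * ?P m k) * ?B k j) = (if i = j then [:l i, -1:] else 0)" if ij: "i < N" "j < N" for i j
  proof -
    have "(\<Sum>k<N. (\<Sum>m<N. ?B m i * ?P m k) * ?B k j) = (\<Sum>k<N. \<Sum>m<N. [:B m i * D m k * B k j, B m i * (- Q m k) * B k j:])"
      unfolding sum_distrib_right by (intro sum.cong refl) (simp add: mult_ac)
    also have "\<dots> = [:bil N D (\<lambda>k. B k i) (\<lambda>k. B k j), - bil N Q (\<lambda>k. B k i) (\<lambda>k. B k j):]"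
    proof -
      have 1: "(\<Sum>k<N. \<Sum>m<N. B m i * D m k * B k j) = bil N D (\<lambda>k. B k i) (\<lambda>k. B k j)"
        unfolding bil_def by (rule sum.swap)
      have "(\<Sum>k<N. \<Sum>m<N. B m i * Q m k * B k j) = bil N Q (\<lambda>k. B k i) (\<lambda>k. B k j)"
        unfolding bil_def by (rule sum.swap)
      then have 2: "(\<Sum>k<N. \<Sum>m<N. B m i * (- Q m k) * B k j) = - bil N Q (\<lambda>k. B k i) (\<lambda>k. B k j)"
        by (simp add: sum_negf)
      show ?thesis by (simp only: sum_two_coeffs 1 2)
    qed
    also have "\<dots> = (if i = j then [:l i, -1:] else 0)" using simdiag_Q[OF ij] simdiag_D[OF ij] by simp
    finally show ?thesis .
  qed
  have "transpose_mat (mt N ?B) * mt N ?P * mt N ?B = mt N (\<lambda>i j. if i = j then [:l i, -1:] else 0)"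
    unfolding mt_transpose mt_mult using entry by (intro mt_cong)
  then have "Determinant.det (transpose_mat (mt N ?B) * mt N ?P * mt N ?B) = (\<Prod>i<N. [:l i, -1:])"
    by (simp only: det_mt_diag)
  moreover have "Determinant.det (mt N ?B) = [:Determinant.det (mt N B):]"
  proof -
    have "mt N ?B = map_mat (\<lambda>x. [:x:]) (mt N B)" by (rule eq_matI) (auto simp: mt_def)
    then show ?thesis by (simp only: const_poly_hom.hom_det)
  qed
  moreover have "rel_charpoly N Q D = Determinant.det (mt N ?P)" by (simp only: rel_charpoly_def detN_eq_det)
  ultimately have "[:Determinant.det (mt N B):]\<^sup>2 * rel_charpoly N Q D = (\<Prod>i<N. [:l i, -1:])"
    by (simp only: det_congruence)
  then show ?thesis by (simp add: detN_eq_det power2_eq_square)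
qed

lemma simdiag_pdist: "pdist N Q D = sqrt (\<Sum>i<N. (ln (l i))\<^sup>2)"
proof -
  have b: "(detN N B)\<^sup>2 \<noteq> 0" using simdiag_det_Q by auto
  have ord: "order \<mu> (rel_charpoly N Q D) = card {i\<in>{..<N}. l i = \<mu>}" for \<mu>
    using order_smult[OF b, of \<mu> "rel_charpoly N Q D"] order_prod_linear[of "{..<N}" l \<mu>] by (simp add: simdiag_charpoly)
  have roots: "{\<mu>. poly (rel_charpoly N Q D) \<mu> = 0} = l ` {..<N}"
  proof -
    have "poly (rel_charpoly N Q D) \<mu> = 0 \<longleftrightarrow> poly (Polynomial.smult ((detN N B)\<^sup>2) (rel_charpoly N Q D)) \<mu> = 0" for \<mu> using b by simp
    then show ?thesis unfolding simdiag_charpoly by (auto simp: poly_prod)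
  qed
  have "(\<Sum>i<N. (ln (l i))\<^sup>2) = (\<Sum>\<mu>\<in>l ` {..<N}. \<Sum>i\<in>{i\<in>{..<N}. l i = \<mu>}. (ln (l i))\<^sup>2)"
    by (rule sum.image_gen) simp
  also have "\<dots> = (\<Sum>\<mu>\<in>l ` {..<N}. real (card {i\<in>{..<N}. l i = \<mu>}) * (ln \<mu>)\<^sup>2)" by (intro sum.cong) auto
  finally show ?thesis unfolding pdist_def roots ord by simp
qed

text \<open>A one-sided inverse of a square matrix is two-sided; in this order the identity expands
  a vector in the columns of \<open>B\<close>.\<close>

lemma simdiag_inverse: "mt N B * (transpose_mat (mt N B) * mt N Q) = 1\<^sub>m N"
proof -
  have "transpose_mat (mt N B) * mt N Q \<in> carrier_mat N N" by (rule mult_carrier_mat[of _ N N _ N]) simp_all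
  from mat_mult_left_right_inverse[OF this mt_carrier] show ?thesis using sd by (simp add: simdiag_def)
qed

lemma simdiag_expand:
  assumes "\<forall>i<N. \<forall>j<N. Q i j = Q j i" "\<forall>i<N. \<forall>j<N. D i j = D j i"
  shows "\<exists>c. bil N Q v v = (\<Sum>i<N. (c i)\<^sup>2) \<and> bil N D v v = (\<Sum>i<N. l i * (c i)\<^sup>2)"
proof -
  define b where "b i k = B k i" for i k
  have bi: "b i = (\<lambda>k. B k i)" for i by (simp add: b_def fun_eq_iff)
  define c where "c i = bil N Q (b i) v" for i
  have v: "v k = (\<Sum>i<N. c i * b i k)" if k: "k < N" for k
  proof -
    have inv: "(\<Sum>i<N. B k i * (\<Sum>m<N. B m i * Q m j)) = (if k = j then 1 else 0)" if "j < N" for j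
      using mt_eqD[OF simdiag_inverse[unfolded mt_transpose mt_mult mt_one] k that] .
    have "(\<Sum>i<N. c i * b i k) = (\<Sum>i<N. \<Sum>j<N. B k i * (\<Sum>m<N. B m i * Q m j) * v j)"
    proof (rule sum.cong)
      fix i
      have "c i = (\<Sum>j<N. (\<Sum>m<N. B m i * Q m j) * v j)"
        unfolding c_def b_def bil_def sum_distrib_right by (rule sum.swap)
      then show "c i * b i k = (\<Sum>j<N. B k i * (\<Sum>m<N. B m i * Q m j) * v j)"
        by (simp add: b_def sum_distrib_left mult_ac)
    qed simp
    also have "\<dots> = (\<Sum>j<N. (\<Sum>i<N. B k i * (\<Sum>m<N. B m i * Q m j)) * v j)"
      by (subst sum.swap) (simp add: sum_distrib_right)
    also have "\<dots> = (\<Sum>j<N. (if k = j then 1 else 0) * v j)" using inv by (intro sum.cong) auto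
    also have "\<dots> = (\<Sum>j<N. if k = j then v j else 0)" by (intro sum.cong) auto
    also have "\<dots> = v k" using k by simp
    finally show ?thesis by simp
  qed
  have expand: "bil N P v v = (\<Sum>i<N. m i * (c i)\<^sup>2)"
    if P: "\<forall>i<N. \<forall>j<N. P i j = P j i" "\<And>i j. i < N \<Longrightarrow> j < N \<Longrightarrow> bil N P (b i) (b j) = (if i = j then m i else 0)" for P m
  proof -
    let ?u = "\<lambda>k. \<Sum>i<N. c i * b i k"
    have com: "bil N P x y = bil N P y x" for x y by (rule bil_commute) (use P(1) in blast)
    have "bil N P v v = bil N P ?u ?u" using v by (intro bil_cong)
    also have "\<dots> = (\<Sum>i<N. c i * bil N P ?u (b i))" by (rule bil_sum) simp
    also have "\<dots> = (\<Sum>i<N. c i * (\<Sum>j<N. c j * bil N P (b i) (b j)))"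
      by (subst com, subst bil_sum) simp_all
    also have "\<dots> = (\<Sum>i<N. m i * (c i)\<^sup>2)"
    proof (intro sum.cong refl)
      fix i assume "i \<in> {..<N}"
      then have "(\<Sum>j<N. c j * bil N P (b i) (b j)) = (\<Sum>j<N. if i = j then c j * m i else 0)"
        using P(2) by (intro sum.cong) auto
      also have "\<dots> = c i * m i" using \<open>i \<in> {..<N}\<close> by simp
      finally show "c i * (\<Sum>j<N. c j * bil N P (b i) (b j)) = m i * (c i)\<^sup>2" by (simp add: power2_eq_square)
    qed
    finally show ?thesis .
  qed
  have "bil N Q v v = (\<Sum>i<N. 1 * (c i)\<^sup>2)" by (rule expand) (use assms simdiag_Q in \<open>auto simp: bi\<close>)
  moreover have "bil N D v v = (\<Sum>i<N. l i * (c i)\<^sup>2)" by (rule expand) (use assms simdiag_D in \<open>auto simp: bi\<close>)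
  ultimately show ?thesis by auto
qed

lemma simdiag_pos:
  assumes "pd N D" "i < N"
  shows "0 < l i"
proof -
  have "bil N Q (\<lambda>k. B k i) (\<lambda>k. B k i) = 1" using simdiag_Q[of i i] assms(2) by simp
  then have "\<exists>k<N. B k i \<noteq> 0" by (auto simp: bil_def intro: ccontr)
  then have "0 < bil N D (\<lambda>k. B k i) (\<lambda>k. B k i)" using assms(1) by (auto simp: pd_def)
  then show ?thesis using simdiag_D[of i i] assms(2) by simp
qed

text \<open>The basis \<open>g' * B\<close> diagonalises the transformed pair with the same
  eigenvalues, so the action is isometric.\<close>

lemma simdiag_act:
  assumes g: "mt N g * mt N g' = 1\<^sub>m N"
  shows "\<exists>B'. simdiag N (act N Q g) (act N D g) B' l"
proof -
  define B' where "B' i j = (\<Sum>k<N. g' i k * B k j)" for i j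
  have B': "mt N B' = mt N g' * mt N B" unfolding B'_def by (simp only: mt_mult)
  have gB: "mt N g * (mt N g' * mt N B) = mt N B"
    using g by (simp add: assoc_mult_mat[symmetric, of _ N N _ N _ N])
  have "transpose_mat (mt N B') * (transpose_mat (mt N g) * mt N P * mt N g) * mt N B'
      = transpose_mat (mt N B) * mt N P * mt N B" for P :: "nat \<Rightarrow> nat \<Rightarrow> real"
  proof -
    let ?G = "mt N g" and ?C = "mt N B'" and ?P = "mt N P"
    have GC: "?G * ?C = mt N B" using gB by (simp only: B')
    have "transpose_mat ?C * (transpose_mat ?G * ?P * ?G) * ?C = (transpose_mat ?C * transpose_mat ?G) * ?P * (?G * ?C)"
      by (simp add: assoc_mult_mat[of _ N N _ N _ N] mult_carrier_mat[of _ N N _ N])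
    also have "transpose_mat ?C * transpose_mat ?G = transpose_mat (?G * ?C)"
      by (simp add: transpose_mult[of _ N N _ N])
    finally show ?thesis by (simp only: GC)
  qed
  then have "simdiag N (act N Q g) (act N D g) B' l" using sd by (simp add: simdiag_def mt_act)
  then show ?thesis by blast
qed

text \<open>\<open>Q * B\<close> is the inverse transpose of \<open>B\<close>, that is the dual
  basis; it diagonalises the inverse forms, with reciprocal eigenvalues.\<close>

lemma simdiag_dual:
  assumes P: "mt N Q * mt N P = 1\<^sub>m N" and E: "mt N D * mt N E = 1\<^sub>m N" and l: "\<And>i. i < N \<Longrightarrow> l i \<noteq> 0"
    and Qs: "transpose_mat (mt N Q) = mt N Q"
  shows "\<exists>C. simdiag N P E C (\<lambda>i. 1 / l i)"
proof -
  let ?B = "mt N B" and ?Q = "mt N Q" and ?P = "mt N P" and ?D = "mt N D" and ?E = "mt N E"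
  let ?L = "mt N (\<lambda>i j. if i = j then l i else 0)" and ?L' = "mt N (\<lambda>i j. if i = j then 1 / l i else 0)"
  note as = assoc_mult_mat[of _ N N _ N _ N] mult_carrier_mat[of _ N N _ N]
  define C where "C i j = (\<Sum>k<N. Q i k * B k j)" for i j
  have C: "mt N C = ?Q * ?B" unfolding C_def by (simp only: mt_mult)
  have CT: "transpose_mat (mt N C) = transpose_mat ?B * ?Q"
    unfolding C by (subst transpose_mult[of _ N N _ N]) (simp_all add: Qs)
  have BC: "transpose_mat (mt N C) * ?B = 1\<^sub>m N" using sd by (simp add: CT simdiag_def)
  have CB: "?B * transpose_mat (mt N C) = 1\<^sub>m N" using simdiag_inverse by (simp add: CT)
  have BtC: "transpose_mat ?B * mt N C = 1\<^sub>m N" unfolding C using sd by (simp add: simdiag_def as)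
  have PQ: "?P * ?Q = 1\<^sub>m N" by (rule mat_mult_left_right_inverse[OF mt_carrier mt_carrier P])
  have 1: "transpose_mat (mt N C) * ?P * mt N C = 1\<^sub>m N"
  proof -
    have "transpose_mat (mt N C) * ?P * mt N C = transpose_mat (mt N C) * ((?P * ?Q) * ?B)" unfolding C by (simp add: as)
    then show ?thesis using BC by (simp add: PQ)
  qed
  have LL: "?L * ?L' = 1\<^sub>m N"
    unfolding mt_mult mt_one
  proof (rule mt_cong)
    fix i j assume ij: "i < N" "j < N"
    have "(\<Sum>k<N. (if i = k then l i else 0) * (if k = j then 1 / l k else 0)) = (\<Sum>k<N. if i = k then (if k = j then l i * (1 / l k) else 0) else 0)"
      by (intro sum.cong) auto
    then show "(\<Sum>k<N. (if i = k then l i else 0) * (if k = j then 1 / l k else 0)) = (if i = j then 1 else 0)"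
      using ij l by simp
  qed
  have DB: "?D * ?B = mt N C * ?L"
  proof -
    have "mt N C * ?L = (mt N C * transpose_mat ?B) * (?D * ?B)" using sd by (simp add: simdiag_def as)
    moreover have "mt N C * transpose_mat ?B = 1\<^sub>m N"
      by (rule mat_mult_left_right_inverse[OF _ mt_carrier BtC]) simp
    ultimately show ?thesis by (simp add: left_mult_one_mat[of _ N N] as(2))
  qed
  have ED: "?E * ?D = 1\<^sub>m N" by (rule mat_mult_left_right_inverse[OF mt_carrier mt_carrier E])
  have EC: "?E * mt N C = ?B * ?L'"
  proof -
    have "?B = ?E * ?D * ?B" by (simp add: ED)
    also have "\<dots> = ?E * mt N C * ?L" by (simp add: as DB)
    finally have e: "?B = ?E * mt N C * ?L" .
    have "?B * ?L' = (?E * mt N C * ?L) * ?L'" by (rule arg_cong[OF e])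
    also have "\<dots> = ?E * mt N C * (?L * ?L')" by (simp add: as)
    finally show ?thesis by (simp add: LL right_mult_one_mat[of _ N N] as(2))
  qed
  have 2: "transpose_mat (mt N C) * ?E * mt N C = ?L'"
  proof -
    have "transpose_mat (mt N C) * ?E * mt N C = (transpose_mat (mt N C) * ?B) * ?L'"
      by (simp add: as EC)
    then show ?thesis by (simp add: BC left_mult_one_mat[of _ N N])
  qed
  show ?thesis using 1 2 unfolding simdiag_def by blast
qed

end

section \<open>Integer matrices and the quotient metric\<close>

lemma Ints_det:
  fixes A :: "nat \<Rightarrow> nat \<Rightarrow> real"
  assumes "\<And>i j. i < N \<Longrightarrow> j < N \<Longrightarrow> A i j \<in> \<int>"
  shows "detN N A \<in> \<int>"
  unfolding detN_def
proof (intro Ints_sum Ints_mult Ints_prod)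
  fix p i assume "p \<in> {p. p permutes {..<N}}" "i \<in> {..<N}"
  then show "A i (p i) \<in> \<int>" using permutes_in_image[of p "{..<N}" i] by (intro assms) auto
qed simp

text \<open>With determinant one the adjugate is the inverse, and its entries are, up to sign,
  minors of an integer matrix.\<close>

lemma SLZ_inverse:
  assumes g: "g \<in> SLZ N"
  shows "\<exists>g'\<in>SLZ N. mt N g * mt N g' = 1\<^sub>m N \<and> mt N g' * mt N g = 1\<^sub>m N"
proof -
  have gi: "\<And>i j. i < N \<Longrightarrow> j < N \<Longrightarrow> g i j \<in> \<int>" and gd: "Determinant.det (mt N g) = 1"
    using g by (auto simp: SLZ_def detN_eq_det)
  define g' where "g' i j = adj_mat (mt N g) $$ (i, j)" for i j
  note adj = adj_mat[OF mt_carrier[of N g]]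
  have eq: "adj_mat (mt N g) = mt N g'"
    using adj(1) by (intro eq_matI) (auto simp: g'_def mt_def)
  have one_smult: "(1::real) \<cdot>\<^sub>m 1\<^sub>m N = 1\<^sub>m N" by (rule eq_matI) auto
  have inv: "mt N g * mt N g' = 1\<^sub>m N" "mt N g' * mt N g = 1\<^sub>m N"
    using adj(2,3) by (simp_all add: eq[symmetric] gd one_smult)
  have "g' i j \<in> \<int>" if ij: "i < N" "j < N" for i j
  proof -
    have dim: "mat_delete (mt N g) j i = mt (N - 1) (\<lambda>a b. g (if a < j then a else Suc a) (if b < i then b else Suc b))"
      unfolding mat_delete_def mt_def by (rule eq_matI) auto
    have "detN (N - 1) (\<lambda>a b. g (if a < j then a else Suc a) (if b < i then b else Suc b)) \<in> \<int>"
      by (rule Ints_det) (auto intro!: gi)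
    then have "cofactor (mt N g) j i \<in> \<int>"
      by (auto simp: cofactor_def dim detN_eq_det intro!: Ints_mult Ints_power)
    then show ?thesis using ij by (simp add: g'_def adj_mat_def mt_def)
  qed
  moreover have "detN N g' = 1"
  proof -
    have "Determinant.det (mt N g) * Determinant.det (mt N g') = 1"
      using inv(1) by (simp add: det_mult[OF mt_carrier mt_carrier, symmetric])
    then show ?thesis by (simp add: gd detN_eq_det)
  qed
  ultimately have "g' \<in> SLZ N" by (simp add: SLZ_def)
  then show ?thesis using inv by blast
qed

lemma SLZ_transpose: "g \<in> SLZ N \<Longrightarrow> (\<lambda>i j. g j i) \<in> SLZ N"
  by (simp add: SLZ_def detN_transpose[of N g])

lemma SLZ_mult: "g \<in> SLZ N \<Longrightarrow> h \<in> SLZ N \<Longrightarrow> (\<lambda>i j. \<Sum>k<N. g i k * h k j) \<in> SLZ N"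
  by (auto simp: SLZ_def detN_mult intro!: Ints_sum Ints_mult)

lemma SLZ_id: "(\<lambda>i j. if i = j then 1 else 0) \<in> SLZ N"
  by (simp add: SLZ_def detN_eq_det det_mt_diag)

section \<open>Primitive vectors as columns of unimodular matrices\<close>

definition primitive :: "nat \<Rightarrow> (nat \<Rightarrow> int) \<Rightarrow> bool" where
  "primitive N v \<longleftrightarrow> (\<forall>d. (\<forall>i<N. d dvd v i) \<longrightarrow> d dvd 1)"

text \<open>A diagonal entry of \<open>act N P g\<close> is the value of \<open>P\<close> at that
  column of \<open>g\<close>, so these are the vectors that the Busemann functions see.\<close>

definition column :: "nat \<Rightarrow> nat \<Rightarrow> (nat \<Rightarrow> int) \<Rightarrow> bool" where
  "column N k v \<longleftrightarrow> (\<exists>g\<in>SLZ N. \<forall>i<N. g i k = of_int (v i))"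

lemma column_addrow:
  assumes col: "column N k v" and ij: "i < N" "j < N" "i \<noteq> j" and w: "\<And>a. a < N \<Longrightarrow> w a = (if a = i then v i + c * v j else v a)"
  shows "column N k w"
proof -
  obtain g where g: "g \<in> SLZ N" "\<forall>i<N. g i k = of_int (v i)" using col by (auto simp: column_def)
  define h where "h a b = (if a = i then g i b + of_int c * g j b else g a b)" for a b
  have "mt N h = addrow (of_int c) i j (mt N g)"
    by (rule eq_matI) (use ij in \<open>auto simp: mt_def h_def\<close>)
  then have "detN N h = detN N g"
    using det_addrow[of j N i "mt N g" "of_int c"] ij by (simp add: detN_eq_det)
  then have "h \<in> SLZ N" using g(1) ij by (auto simp: SLZ_def h_def intro!: Ints_add Ints_mult)
  moreover have "\<forall>a<N. h a k = of_int (w a)" using g(2) w ij by (auto simp: h_def)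
  ultimately show ?thesis unfolding column_def by blast
qed

lemma column_cong: "column N k v \<Longrightarrow> (\<And>i. i < N \<Longrightarrow> w i = v i) \<Longrightarrow> column N k w"
  by (simp add: column_def)

text \<open>Determinant one forbids bare swaps and sign changes, but one row addition creates the
  new entry, with either sign, and another clears the old one. A sign change in place detours over a
  second index, hence \<open>2 \<le> N\<close>.\<close>

lemma column_unit:
  assumes N: "2 \<le> N" and k: "k < N" and m: "m < N" and e: "e = 1 \<or> e = - 1"
  shows "column N k (\<lambda>i. if i = m then e else 0)"
proof -
  have id: "column N k (\<lambda>i. if i = k then 1 else 0)"
    unfolding column_def by (rule bexI[OF _ SLZ_id]) auto
  have move: "column N k (\<lambda>i. if i = b then e' else 0)"
    if "column N k (\<lambda>i. if i = a then e else 0)" "a < N" "b < N" "a \<noteq> b" "e = 1 \<or> e = -1" "e' = 1 \<or> e' = -1" for a b :: nat and e e' :: int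
  proof -
    have ee: "e * e = 1" "e' * e' = 1" using that by auto
    have "column N k (\<lambda>i. if i = a then e else if i = b then e' else 0)"
      by (rule column_addrow[OF that(1) that(3,2), where c = "e' * e"]) (use that ee in \<open>auto simp: mult.assoc\<close>)
    then show ?thesis
      by (rule column_addrow[OF _ that(2,3), where c = "- (e * e')"]) (use that ee in \<open>auto simp: mult.assoc\<close>)
  qed
  show ?thesis
  proof (cases "m = k")
    case False
    then show ?thesis using move[OF id k m _ _ e] by simp
  next
    case True
    define b where "b = (if k = 0 then 1 else 0 :: nat)"
    have b: "b < N" "b \<noteq> k" using N by (auto simp: b_def)
    from move[OF id k b(1)] b(2) have "column N k (\<lambda>i. if i = b then 1 else 0)" by auto
    from move[OF this b(1) m] e b(2) True show ?thesis by auto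
  qed
qed

text \<open>Euclid's algorithm by elementary row operations.\<close>
lemma primitive_column:
  assumes N: "2 \<le> N" and k: "k < N" and v: "primitive N v"
  shows "column N k v"
  using v
proof (induction "\<Sum>i<N. nat \<bar>v i\<bar>" arbitrary: v rule: less_induct)
  case less
  show ?case
  proof (cases "\<exists>i j. i < N \<and> j < N \<and> i \<noteq> j \<and> v i \<noteq> 0 \<and> v j \<noteq> 0")
    case True
    then obtain a where "\<exists>b. a < N \<and> b < N \<and> a \<noteq> b \<and> v a \<noteq> 0 \<and> v b \<noteq> 0" ..
    then obtain b where "a < N \<and> b < N \<and> a \<noteq> b \<and> v a \<noteq> 0 \<and> v b \<noteq> 0" ..
    then have ab: "a < N" "b < N" "a \<noteq> b" "v a \<noteq> 0" "v b \<noteq> 0" by simp_all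
    obtain i j where ij: "i < N" "j < N" "i \<noteq> j" "v j \<noteq> 0" "\<bar>v j\<bar> \<le> \<bar>v i\<bar>"
    proof (cases "\<bar>v b\<bar> \<le> \<bar>v a\<bar>")
      case True
      show ?thesis by (rule that[of a b]) (use ab True in simp_all)
    next
      case False
      show ?thesis by (rule that[of b a]) (use ab False in simp_all)
    qed
    define c where "c = sgn (v i) * sgn (v j)"
    define w where "w a = (if a = i then v i - c * v j else v a)" for a
    have small: "\<bar>v i - c * v j\<bar> < \<bar>v i\<bar>"
      using ij(4,5) by (auto simp: c_def sgn_if abs_if split: if_splits)
    have "(\<Sum>i<N. nat \<bar>w i\<bar>) < (\<Sum>i<N. nat \<bar>v i\<bar>)"
      by (rule sum_strict_mono_ex1) (use small ij in \<open>auto simp: w_def intro!: bexI[of _ i]\<close>)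
    moreover have "primitive N w"
      unfolding primitive_def
    proof (intro allI impI)
      fix d assume d: "\<forall>i<N. d dvd w i"
      have "d dvd v a" if "a < N" for a
      proof (cases "a = i")
        case True
        have "d dvd w i" "d dvd w j" using d ij by auto
        then have "d dvd v i - c * v j" "d dvd v j" using ij by (auto simp: w_def)
        then have "d dvd (v i - c * v j) + c * v j" by (intro dvd_add dvd_mult)
        then show ?thesis using True by simp
      next
        case False then show ?thesis using d that by (metis w_def)
      qed
      then show "d dvd 1" using less.prems by (simp add: primitive_def)
    qed
    ultimately have "column N k w" by (rule less.hyps)
    then show ?thesis
      by (rule column_addrow[OF _ ij(1-3), where c = c]) (use ij in \<open>auto simp: w_def\<close>)
  next
    case False
    have "\<exists>m<N. v m \<noteq> 0"
    proof (rule ccontr)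
      assume "\<not> (\<exists>m<N. v m \<noteq> 0)"
      then have "2 dvd (1::int)" using less.prems unfolding primitive_def by (metis dvd_0_right)
      then show False by simp
    qed
    then obtain m where m: "m < N" "v m \<noteq> 0" by blast
    then have z: "v a = 0" if "a < N" "a \<noteq> m" for a using False that by metis
    then have "\<forall>i<N. v m dvd v i" by (metis dvd_0_right dvd_refl)
    then have "v m dvd 1" using less.prems by (simp add: primitive_def)
    then have "v m = 1 \<or> v m = -1" by (simp add: zdvd1_eq abs_eq_iff')
    from column_unit[OF N k m(1) this] show ?thesis
      by (rule column_cong) (use z in auto)
  qed
qed

lemma primitive_quotient:
  assumes "\<exists>i<N. v i \<noteq> (0::int)"
  shows "\<exists>d w. d \<noteq> 0 \<and> (\<forall>i<N. v i = d * w i) \<and> primitive N w"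
proof -
  define d where "d = Gcd (v ` {..<N})"
  have d0: "d \<noteq> 0" using assms by (auto simp: d_def Gcd_0_iff)
  define w where "w i = v i div d" for i
  have w: "v i = d * w i" if "i < N" for i
    using that by (simp add: w_def d_def)
  have "primitive N w"
    unfolding primitive_def
  proof (intro allI impI)
    fix c assume c: "\<forall>i<N. c dvd w i"
    have "d * c dvd d"
      unfolding d_def by (rule Gcd_greatest) (use c w d_def in \<open>auto intro: mult_dvd_mono\<close>)
    then show "c dvd 1" using d0 by (metis dvd_times_left_cancel_iff mult.right_neutral)
  qed
  then show ?thesis using d0 w by blast
qed

section \<open>Orbits and the quotient distance\<close>

lemma act_act: "act N (act N Q g) h = act N Q (\<lambda>i j. \<Sum>k<N. g i k * h k j)"
proof -
  have "mt N (act N (act N Q g) h) = mt N (act N Q (\<lambda>i j. \<Sum>k<N. g i k * h k j))"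
    unfolding mt_act mt_mult[symmetric]
    by (simp add: transpose_mult[of _ N N _ N] assoc_mult_mat[of _ N N _ N _ N] mult_carrier_mat[of _ N N _ N])
  from mt_eqD[OF this] show ?thesis by (intro ext) (auto simp: act_def)
qed

lemma act_cong: "mt N g = mt N h \<Longrightarrow> act N Q g = act N Q h"
  using mt_eqD[of N g h] by (intro ext) (auto simp: act_def intro!: sum.cong)

lemma pdist_cong: "mt N Q = mt N Q' \<Longrightarrow> mt N D = mt N D' \<Longrightarrow> pdist N Q D = pdist N Q' D'"
proof -
  assume "mt N Q = mt N Q'" "mt N D = mt N D'"
  then have "rel_charpoly N Q D = rel_charpoly N Q' D'"
    unfolding rel_charpoly_def using mt_eqD[of N Q Q'] mt_eqD[of N D D'] by (intro detN_cong) auto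
  then show ?thesis by (simp add: pdist_def)
qed

lemma pdist_nonneg: "0 \<le> pdist N Q D"
  unfolding pdist_def by (intro real_sqrt_ge_zero sum_nonneg mult_nonneg_nonneg) auto

lemma pdist_act:
  assumes "pd N Q" "\<forall>i<N. \<forall>j<N. D i j = D j i" "g \<in> SLZ N"
  shows "pdist N (act N Q g) (act N D g) = pdist N Q D"
proof -
  obtain B l where sd: "simdiag N Q D B l" using simdiag_exists[OF assms(1,2)] by blast
  obtain g' where "mt N g * mt N g' = 1\<^sub>m N" using SLZ_inverse[OF assms(3)] by blast
  then obtain B' where "simdiag N (act N Q g) (act N D g) B' l" using simdiag_act[OF sd] by blast
  then show ?thesis using simdiag_pdist sd by simp
qed

lemma bil_act:
  assumes Q: "\<forall>i<N. \<forall>j<N. Q i j = Q j i"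
  shows "bil N (act N Q g) v v = bil N Q (\<lambda>k. \<Sum>i<N. v i * g k i) (\<lambda>k. \<Sum>i<N. v i * g k i)"
proof -
  have Qs: "bil N Q u w = bil N Q w u" for u w by (rule bil_commute) (use Q in simp)
  let ?u = "\<lambda>k. \<Sum>i<N. v i * g k i"
  have "bil N Q ?u ?u = (\<Sum>j<N. v j * bil N Q ?u (\<lambda>k. g k j))" by (rule bil_sum) simp
  also have "\<dots> = (\<Sum>j<N. v j * (\<Sum>i<N. v i * bil N Q (\<lambda>k. g k j) (\<lambda>k. g k i)))"
    by (subst Qs, subst bil_sum) simp_all
  also have "\<dots> = (\<Sum>j<N. \<Sum>i<N. v j * act N Q g j i * v i)"
    by (intro sum.cong) (simp_all add: act_eq_bil sum_distrib_left mult_ac)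
  finally show ?thesis by (simp add: bil_def)
qed

lemma pd_act:
  assumes Q: "pd N Q" and g: "mt N g' * mt N g = 1\<^sub>m N"
  shows "pd N (act N Q g)"
proof -
  have Qs: "bil N Q u w = bil N Q w u" for u w by (rule bil_commute) (use Q in \<open>simp add: pd_def\<close>)
  have bil_act: "bil N (act N Q g) v v = bil N Q (\<lambda>k. \<Sum>i<N. v i * g k i) (\<lambda>k. \<Sum>i<N. v i * g k i)" for v
    by (rule bil_act) (use Q in \<open>simp add: pd_def\<close>)
  have nz: "\<exists>k<N. (\<Sum>i<N. v i * g k i) \<noteq> 0" if "\<exists>i<N. v i \<noteq> 0" for v :: "nat \<Rightarrow> real"
  proof (rule ccontr)
    assume z: "\<not> (\<exists>k<N. (\<Sum>i<N. v i * g k i) \<noteq> 0)"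
    have "v j = 0" if j: "j < N" for j
    proof -
      have inv: "(\<Sum>k<N. g' j k * g k i) = (if j = i then 1 else 0)" if "i < N" for i
        using mt_eqD[OF g[unfolded mt_mult mt_one] j that] .
      have "0 = (\<Sum>k<N. g' j k * (\<Sum>i<N. v i * g k i))" using z by simp
      also have "\<dots> = (\<Sum>i<N. \<Sum>k<N. g' j k * g k i * v i)"
        by (simp add: sum_distrib_left mult_ac) (rule sum.swap)
      also have "\<dots> = (\<Sum>i<N. (if j = i then 1 else 0) * v i)"
        using inv by (intro sum.cong) (simp_all flip: sum_distrib_right)
      also have "\<dots> = (\<Sum>i<N. if j = i then v i else 0)" by (intro sum.cong) auto
      also have "\<dots> = v j" using j by simp
      finally show ?thesis by simp
    qed
    then show False using that by blast
  qed
  show ?thesis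
    unfolding pd_def
  proof (intro conjI allI impI)
    fix i j assume "i < N" "j < N"
    then show "act N Q g i j = act N Q g j i" using Qs by (simp add: act_eq_bil)
  next
    fix v :: "nat \<Rightarrow> real" assume "\<exists>i<N. v i \<noteq> 0"
    note ne = nz[OF this]
    have pos: "0 < bil N Q u u" if "\<exists>i<N. u i \<noteq> 0" for u using Q that by (simp add: pd_def)
    show "0 < bil N (act N Q g) v v" unfolding bil_act by (rule pos[OF ne])
  qed
qed

lemma pr_ne: "pr N Q \<noteq> {}" using SLZ_id[of N] by (auto simp: pr_def)

text \<open>The infimum over two orbits reduces to one: applying the inverse of the element that
  moved \<open>D\<close> preserves the distance and only changes the element acting on
  \<open>Q\<close>.\<close>

lemma tdist_greatest:
  assumes Q: "pd N Q" and D: "pd N D" and le: "\<And>g. g \<in> SLZ N \<Longrightarrow> m \<le> pdist N (act N Q g) D"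
  shows "m \<le> tdist N (pr N Q) (pr N D)"
  unfolding tdist_def
proof (intro cINF_greatest pr_ne)
  fix Q1 D1 assume "Q1 \<in> pr N Q" "D1 \<in> pr N D"
  then obtain g h where g: "g \<in> SLZ N" "Q1 = act N Q g" and h: "h \<in> SLZ N" "D1 = act N D h" by (auto simp: pr_def)
  obtain h' where h': "h' \<in> SLZ N" "mt N h * mt N h' = 1\<^sub>m N" "mt N h' * mt N h = 1\<^sub>m N" using SLZ_inverse[OF h(1)] by blast
  obtain g' where g': "mt N g' * mt N g = 1\<^sub>m N" using SLZ_inverse[OF g(1)] by blast
  have D1: "pd N D1" unfolding h(2) by (rule pd_act[OF D h'(3)])
  have "pdist N Q1 D1 = pdist N (act N Q1 h') (act N D1 h')"
    by (rule pdist_act[symmetric]) (use pd_act[OF Q g'] g D1 h' in \<open>auto simp: pd_def\<close>)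
  also have "\<dots> = pdist N (act N Q1 h') D"
  proof (rule pdist_cong)
    have "mt N (\<lambda>i j. \<Sum>k<N. h i k * h' k j) = mt N (\<lambda>i j. if i = j then 1 else 0)"
      using h'(2) by (simp only: mt_mult mt_one)
    from act_cong[OF this, of D] have "mt N (act N D1 h') = mt N (act N D (\<lambda>i j. if i = j then 1 else 0))"
      unfolding h(2) act_act by (rule arg_cong)
    also have "\<dots> = mt N D" unfolding mt_act mt_one[symmetric] by simp
    finally show "mt N (act N D1 h') = mt N D" .
  qed simp
  also have "act N Q1 h' = act N Q (\<lambda>i j. \<Sum>k<N. g i k * h' k j)" unfolding g(2) by (rule act_act)
  finally show "m \<le> pdist N Q1 D1" using le[OF SLZ_mult[OF g(1) h'(1)]] by simp
qed

lemma tdist_le: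
  assumes g: "g \<in> SLZ N" and D: "\<And>i j. \<not> (i < N \<and> j < N) \<Longrightarrow> D i j = 0"
  shows "tdist N (pr N Q) (pr N D) \<le> pdist N (act N Q g) D"
proof -
  have "act N D (\<lambda>i j. if i = j then 1 else 0) = D"
  proof -
    have "mt N (act N D (\<lambda>i j. if i = j then 1 else 0)) = mt N D" unfolding mt_act mt_one[symmetric] by simp
    from mt_eqD[OF this] show ?thesis using D by (intro ext) (auto simp: act_def)
  qed
  \<comment> \<open>\<open>act\<close> returns zero outside the block, so \<open>D\<close> has to
    vanish there to belong to its own orbit.\<close>
  then have DD: "D \<in> pr N D" using SLZ_id[of N] unfolding pr_def by force
  have bdd: "bdd_below ((\<lambda>Q2. pdist N Q1 Q2) ` pr N D)" for Q1 by (rule bdd_belowI2[of _ 0]) (rule pdist_nonneg)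
  have "tdist N (pr N Q) (pr N D) \<le> (INF Q2\<in>pr N D. pdist N (act N Q g) Q2)"
    unfolding tdist_def
  proof (rule cINF_lower)
    show "bdd_below ((\<lambda>Q1. INF Q2\<in>pr N D. pdist N Q1 Q2) ` pr N Q)"
      by (rule bdd_belowI2[of _ 0]) (rule cINF_greatest[OF pr_ne], rule pdist_nonneg)
    show "act N Q g \<in> pr N Q" using g by (auto simp: pr_def)
  qed
  also have "\<dots> \<le> pdist N (act N Q g) D" by (rule cINF_lower[OF bdd DD])
  finally show ?thesis .
qed

section \<open>Busemann functions\<close>

text \<open>Diagonalise the identity relative to \<open>Q\<close>; a bound for the eigenvalues is
  the constant.\<close>

lemma pd_lower_bound:
  assumes Q: "pd N Q"
  shows "\<exists>C>0. \<forall>v. (\<Sum>i<N. (v i)\<^sup>2) \<le> C * bil N Q v v"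
proof -
  define Id where "Id = (\<lambda>i j :: nat. if i = j then 1 else 0 :: real)"
  have Ids: "\<forall>i<N. \<forall>j<N. Id i j = Id j i" by (simp add: Id_def)
  from simdiag_exists[OF Q this] obtain B l where sd: "simdiag N Q Id B l" by blast
  have bI: "bil N Id v v = (\<Sum>i<N. (v i)\<^sup>2)" for v
  proof -
    have "(\<Sum>j<N. v i * Id i j * v j) = (\<Sum>j<N. if i = j then (v i)\<^sup>2 else 0)" for i
      by (intro sum.cong) (auto simp: Id_def power2_eq_square)
    then show ?thesis unfolding bil_def by (intro sum.cong) auto
  qed
  define C where "C = 1 + (\<Sum>i<N. \<bar>l i\<bar>)"
  have "(\<Sum>i<N. (v i)\<^sup>2) \<le> C * bil N Q v v" for v
  proof -
    obtain c where c: "bil N Q v v = (\<Sum>i<N. (c i)\<^sup>2)" "bil N Id v v = (\<Sum>i<N. l i * (c i)\<^sup>2)"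
      using simdiag_expand[OF sd _ Ids, of v] Q unfolding pd_def by blast
    have "(\<Sum>i<N. l i * (c i)\<^sup>2) \<le> (\<Sum>i<N. C * (c i)\<^sup>2)"
    proof (intro sum_mono mult_right_mono)
      fix i assume "i \<in> {..<N}"
      then have "\<bar>l i\<bar> \<le> (\<Sum>i<N. \<bar>l i\<bar>)" by (intro member_le_sum) auto
      then show "l i \<le> C" by (simp add: C_def)
    qed simp
    then show ?thesis using c bI by (simp add: sum_distrib_left)
  qed
  moreover have "0 < C" unfolding C_def by (intro add_pos_nonneg sum_nonneg) auto
  ultimately show ?thesis by blast
qed

lemma bil_upper_bound: "bil N Q v v \<le> (\<Sum>i<N. \<Sum>j<N. \<bar>Q i j\<bar>) * (\<Sum>i<N. (v i)\<^sup>2)"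
proof -
  have "v i * Q i j * v j \<le> \<bar>Q i j\<bar> * (\<Sum>i<N. (v i)\<^sup>2)" if "i < N" "j < N" for i j
  proof -
    have "\<bar>v i * v j\<bar> \<le> ((v i)\<^sup>2 + (v j)\<^sup>2) / 2"
      using sum_squares_bound[of "\<bar>v i\<bar>" "\<bar>v j\<bar>"] by (simp add: abs_mult)
    also have "\<dots> \<le> (\<Sum>i<N. (v i)\<^sup>2)"
    proof -
      have "(v i)\<^sup>2 \<le> (\<Sum>i<N. (v i)\<^sup>2)" "(v j)\<^sup>2 \<le> (\<Sum>i<N. (v i)\<^sup>2)"
        using that by (auto intro!: member_le_sum)
      from add_mono[OF this] show ?thesis by simp
    qed
    finally have "\<bar>v i * v j\<bar> \<le> (\<Sum>i<N. (v i)\<^sup>2)" .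
    then have "\<bar>Q i j\<bar> * \<bar>v i * v j\<bar> \<le> \<bar>Q i j\<bar> * (\<Sum>i<N. (v i)\<^sup>2)" by (intro mult_left_mono) auto
    moreover have "v i * Q i j * v j \<le> \<bar>Q i j\<bar> * \<bar>v i * v j\<bar>"
      using abs_ge_self[of "v i * Q i j * v j"] by (simp add: abs_mult mult_ac)
    ultimately show ?thesis by linarith
  qed
  then show ?thesis unfolding bil_def sum_distrib_right by (intro sum_mono) auto
qed

lemma bil_basis: "k < N \<Longrightarrow> bil N Q (\<lambda>i. if i = k then 1 else 0) (\<lambda>i. if i = k then 1 else 0) = Q k k"
proof -
  assume k: "k < N"
  have "(\<Sum>j<N. (if i = k then 1 else 0) * Q i j * (if j = k then 1 else 0)) = (if i = k then Q k k else 0)" for i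
  proof -
    have "(\<Sum>j<N. (if i = k then 1 else 0) * Q i j * (if j = k then 1 else 0)) = (\<Sum>j<N. if j = k then (if i = k then Q k k else 0) else 0)"
      by (intro sum.cong) auto
    then show ?thesis using k by simp
  qed
  then show ?thesis using k by (simp add: bil_def)
qed

lemma bil_diagm: "bil N (diagm N f) v v = (\<Sum>i<N. f i * (v i)\<^sup>2)"
proof -
  have "(\<Sum>j<N. v i * diagm N f i j * v j) = f i * (v i)\<^sup>2" if "i < N" for i
  proof -
    have "(\<Sum>j<N. v i * diagm N f i j * v j) = (\<Sum>j<N. if j = i then f i * (v i)\<^sup>2 else 0)"
      using that by (intro sum.cong) (auto simp: diagm_def power2_eq_square)
    then show ?thesis using that by simp
  qed
  then show ?thesis by (simp add: bil_def)
qed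

lemma pd_diagm: "(\<And>i. i < N \<Longrightarrow> 0 < f i) \<Longrightarrow> pd N (diagm N f)"
  unfolding pd_def bil_diagm
proof (intro conjI allI impI)
  fix v :: "nat \<Rightarrow> real" assume f: "\<And>i. i < N \<Longrightarrow> 0 < f i" and "\<exists>i<N. v i \<noteq> 0"
  then obtain i where "i < N" "v i \<noteq> 0" by blast
  then show "0 < (\<Sum>i<N. f i * (v i)\<^sup>2)"
    using f by (intro sum_pos2[of _ i] mult_pos_pos mult_nonneg_nonneg) (auto intro: less_imp_le)
qed (auto simp: diagm_def)

lemma detN_diagm: "detN N (diagm N f) = (\<Prod>i<N. f i)"
proof -
  have "mt N (diagm N f) = mt N (\<lambda>i j. if i = j then f i else 0)" by (rule mt_cong) (auto simp: diagm_def)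
  then show ?thesis by (simp only: detN_eq_det det_mt_diag)
qed

section \<open>The two rays and the distance to their points\<close>

definition ray_a :: "nat \<Rightarrow> real" where "ray_a n = 1 / sqrt (real n * (real n + 1))"
definition ray_b :: "nat \<Rightarrow> real" where "ray_b n = sqrt (real n / (real n + 1))"
definition ray_eta :: "nat \<Rightarrow> real" where "ray_eta n = sqrt ((real n + 1) / real n)"

text \<open>For the logarithmic speeds a and b, the relation b = n a is determinant one, b^2 + n a^2
  = 1 is unit speed, a + b = \<eta> is the spread between the two scales, and \<eta> b = 1 converts
  decay of the small eigenvalue into time.\<close>

lemma ray_constants:
  assumes "1 \<le> n"
  shows "0 < ray_a n" "0 < ray_b n" "0 < ray_eta n" "ray_b n = real n * ray_a n" "ray_eta n = ray_a n + ray_b n"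
    "ray_eta n * ray_b n = 1" "(ray_b n)\<^sup>2 + real n * (ray_a n)\<^sup>2 = 1"
proof -
  define x y where "x = sqrt (real n)" and "y = sqrt (real n + 1)"
  have xy: "0 < x" "0 < y" "real n = x\<^sup>2" "x\<^sup>2 + 1 = y\<^sup>2" using assms by (auto simp: x_def y_def)
  have a: "ray_a n = 1 / (x * y)" by (simp add: ray_a_def x_def y_def real_sqrt_mult)
  have b: "ray_b n = x / y" by (simp add: ray_b_def x_def y_def real_sqrt_divide)
  have e: "ray_eta n = y / x" by (simp add: ray_eta_def x_def y_def real_sqrt_divide)
  show "0 < ray_a n" "0 < ray_b n" "0 < ray_eta n" using xy by (auto simp: a b e)
  show "ray_b n = real n * ray_a n" using xy(1,2) unfolding xy(3) a b by (simp add: field_simps power2_eq_square)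
  have "ray_a n + ray_b n = (x\<^sup>2 + 1) / (x * y)" using xy(1,2) unfolding a b by (simp add: field_simps power2_eq_square)
  also have "\<dots> = y / x" using xy(1,2) unfolding xy(4) by (simp add: power2_eq_square)
  finally show "ray_eta n = ray_a n + ray_b n" by (simp add: e)
  show "ray_eta n * ray_b n = 1" using xy(1,2) by (simp add: e b)
  have "(ray_b n)\<^sup>2 + real n * (ray_a n)\<^sup>2 = (x\<^sup>2 + 1) / y\<^sup>2"
    using xy(1,2) unfolding xy(3) a b by (simp add: field_simps power2_eq_square)
  then show "(ray_b n)\<^sup>2 + real n * (ray_a n)\<^sup>2 = 1" using xy(2) unfolding xy(4) by simp
qed

text \<open>Both rays have this shape: \<open>ray1 n\<close> is \<open>Dk n n\<close>, and \<open>rayn n t\<close> is the inverse of \<open>Dk n 0 t\<close>.\<close>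
definition Dk :: "nat \<Rightarrow> nat \<Rightarrow> real \<Rightarrow> nat \<Rightarrow> nat \<Rightarrow> real" where
  "Dk n k t = diagm (n+1) (\<lambda>i. if i = k then exp (- (ray_b n * t)) else exp (ray_a n * t))"

lemma sum_split_at: "finite S \<Longrightarrow> k \<in> S \<Longrightarrow> (\<Sum>i\<in>S. f i) = f k + (\<Sum>i\<in>S - {k}. f i :: real)"
  by (rule sum.remove)

lemma detN_Dk:
  assumes "1 \<le> n" "k < n + 1"
  shows "detN (n+1) (Dk n k t) = 1"
proof -
  have "(\<Prod>i<n+1. if i = k then exp (- (ray_b n * t)) else exp (ray_a n * t))
      = exp (- (ray_b n * t)) * (\<Prod>i\<in>{..<n+1}-{k}. if i = k then exp (- (ray_b n * t)) else exp (ray_a n * t))"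
    by (subst prod.remove[of "{..<n+1}" k]) (use assms(2) in simp_all)
  also have "(\<Prod>i\<in>{..<n+1}-{k}. if i = k then exp (- (ray_b n * t)) else exp (ray_a n * t)) = (\<Prod>i\<in>{..<n+1}-{k}. exp (ray_a n * t))"
    by (intro prod.cong) auto
  also have "\<dots> = exp (real n * (ray_a n * t))" using assms(2) by (simp add: exp_of_nat_mult[symmetric])
  also have "exp (- (ray_b n * t)) * \<dots> = 1"
    using ray_constants(4)[OF assms(1)] by (simp add: exp_add[symmetric])
  finally show ?thesis by (simp only: Dk_def detN_diagm)
qed

lemma pd_Dk: "pd (n+1) (Dk n k t)"
  unfolding Dk_def by (rule pd_diagm) auto

text \<open>The smallest eigenvalue \<open>l i0\<close> is at most the Rayleigh quotient at the
  basis vector \<open>k\<close>, the direction contracted by the ray. It is split off because the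
  direction of the ray also has one exceptional coordinate.\<close>

lemma relative_eigenvalues:
  assumes n: "1 \<le> n" and k: "k < n + 1" and Q: "pd (n+1) Q" "detN (n+1) Q = 1"
  obtains B l i0 where "simdiag (n+1) Q (Dk n k t) B l" "\<And>i. i < n+1 \<Longrightarrow> 0 < l i" "i0 < n+1"
    "pdist (n+1) Q (Dk n k t) = sqrt ((ln (l i0))\<^sup>2 + (\<Sum>i\<in>{..<n+1}-{i0}. (ln (l i))\<^sup>2))"
    "ln (l i0) + (\<Sum>i\<in>{..<n+1}-{i0}. ln (l i)) = 0"
    "l i0 * Q k k \<le> exp (- (ray_b n * t))"
proof -
  let ?N = "n + 1"
  let ?D = "Dk n k t"
  have Ds: "\<forall>i<?N. \<forall>j<?N. ?D i j = ?D j i" using pd_Dk by (simp add: pd_def)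
  have Qs: "\<forall>i<?N. \<forall>j<?N. Q i j = Q j i" using Q(1) by (simp add: pd_def)
  obtain B l where sd: "simdiag ?N Q ?D B l" using simdiag_exists[OF Q(1) Ds] by blast
  have lpos: "0 < l i" if "i < ?N" for i by (rule simdiag_pos[OF sd pd_Dk that])
  have "(\<Prod>i<?N. l i) = 1"
    using simdiag_det_D[OF sd] simdiag_det_Q[OF sd] Q(2) detN_Dk[OF n k] by simp
  then have "ln (\<Prod>i<?N. l i) = 0" by simp
  moreover have lnz: "l i \<noteq> 0" if "i < ?N" for i using lpos[OF that] by simp
  ultimately have sum0: "(\<Sum>i<?N. ln (l i)) = 0" using lnz by (subst (asm) ln_prod) auto
  have "\<exists>i0\<in>{..<?N}. \<forall>i\<in>{..<?N}. l i0 \<le> l i"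
    using ex_min_if_finite[of "l ` {..<?N}"] by (force simp: not_less)
  then obtain i0 where i0: "i0 < ?N" "\<And>i. i < ?N \<Longrightarrow> l i0 \<le> l i" by auto
  let ?e = "\<lambda>i. if i = k then 1 else 0 :: real"
  obtain c where c: "bil ?N Q ?e ?e = (\<Sum>i<?N. (c i)\<^sup>2)" "bil ?N ?D ?e ?e = (\<Sum>i<?N. l i * (c i)\<^sup>2)"
    using simdiag_expand[OF sd Qs Ds, of ?e] by blast
  have "l i0 * Q k k = (\<Sum>i<?N. l i0 * (c i)\<^sup>2)"
    using c(1) unfolding bil_basis[OF k] by (simp only: sum_distrib_left)
  also have "\<dots> \<le> (\<Sum>i<?N. l i * (c i)\<^sup>2)" using i0(2) by (intro sum_mono mult_right_mono) auto
  also have "\<dots> = exp (- (ray_b n * t))" using c(2) k unfolding bil_basis[OF k] by (simp add: Dk_def diagm_def)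
  finally have ray: "l i0 * Q k k \<le> exp (- (ray_b n * t))" .
  show ?thesis
  proof (rule that[OF sd lpos i0(1) _ _ ray])
    show "pdist ?N Q ?D = sqrt ((ln (l i0))\<^sup>2 + (\<Sum>i\<in>{..<?N}-{i0}. (ln (l i))\<^sup>2))"
      unfolding simdiag_pdist[OF sd] using i0(1) by (subst sum_split_at[of _ i0]) auto
    show "ln (l i0) + (\<Sum>i\<in>{..<?N}-{i0}. ln (l i)) = 0"
      using sum0 i0(1) sum_split_at[of "{..<?N}" i0 "\<lambda>i. ln (l i)"] by simp
  qed
qed

lemma pd_diag_pos: "pd N Q \<Longrightarrow> k < N \<Longrightarrow> 0 < Q k k"
  using bil_basis[of k N Q] unfolding pd_def by (metis (mono_tags, lifting) zero_neq_one)

text \<open>Pair the vector of logarithms of the eigenvalues with the unit direction (-b, a, ..., a)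
  of the ray. As the logarithms sum to zero, the pairing is \<open>- ray_eta n * ln (l i0)\<close>,
  which the Rayleigh bound makes large; Cauchy-Schwarz compares it with the distance.\<close>

lemma ray_dist_lower:
  assumes n: "1 \<le> n" and k: "k < n + 1" and Q: "pd (n+1) Q" "detN (n+1) Q = 1"
  shows "t + ray_eta n * ln (Q k k) \<le> pdist (n+1) Q (Dk n k t)"
proof -
  note rc = ray_constants[OF n]
  obtain B l i0 where l: "\<And>i. i < n+1 \<Longrightarrow> 0 < l i" "i0 < n+1"
    "pdist (n+1) Q (Dk n k t) = sqrt ((ln (l i0))\<^sup>2 + (\<Sum>i\<in>{..<n+1}-{i0}. (ln (l i))\<^sup>2))"
    "ln (l i0) + (\<Sum>i\<in>{..<n+1}-{i0}. ln (l i)) = 0"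
    "l i0 * Q k k \<le> exp (- (ray_b n * t))"
    using relative_eigenvalues[OF n k Q, of t] by metis
  let ?R = "{..<n+1}-{i0}"
  have cR: "real (card ?R) = real n" using l(2) by simp
  have Qk: "0 < Q k k" by (rule pd_diag_pos[OF Q(1) k])
  define X where "X = - ray_b n * ln (l i0) + ray_a n * (\<Sum>i\<in>?R. ln (l i))"
  have "ln (l i0 * Q k k) \<le> - (ray_b n * t)"
  proof -
    have "ln (l i0 * Q k k) \<le> ln (exp (- (ray_b n * t)))"
      using l(5) l(1)[OF l(2)] Qk by (subst ln_le_cancel_iff) auto
    then show ?thesis by simp
  qed
  then have lb: "ln (l i0) + ln (Q k k) \<le> - (ray_b n * t)" using l(1)[OF l(2)] Qk by (simp add: ln_mult)
  have "t + ray_eta n * ln (Q k k) = ray_eta n * (ray_b n * t + ln (Q k k))"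
    using rc(6) by (simp add: algebra_simps)
  also have "\<dots> \<le> ray_eta n * (- ln (l i0))" using lb rc(3) by (intro mult_left_mono) auto
  also have "\<dots> = X" unfolding X_def using l(4) rc(5) by (simp add: add_eq_0_iff algebra_simps)
  also have "X \<le> sqrt ((ln (l i0))\<^sup>2 + (\<Sum>i\<in>?R. (ln (l i))\<^sup>2))"
  proof (rule real_le_rsqrt)
    define S where "S = (ln (l i0))\<^sup>2 + (\<Sum>i\<in>?R. (ln (l i))\<^sup>2)"
    \<comment> \<open>Cauchy-Schwarz, written as the squared distance of the vector from its
      projection to the unit direction.\<close>
    have "0 \<le> (ln (l i0) - X * - ray_b n)\<^sup>2 + (\<Sum>i\<in>?R. (ln (l i) - X * ray_a n)\<^sup>2)"
      by (intro add_nonneg_nonneg sum_nonneg) auto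
    also have "\<dots> = S - 2 * X * X + X\<^sup>2 * ((ray_b n)\<^sup>2 + real n * (ray_a n)\<^sup>2)"
    proof -
      have "(\<Sum>i\<in>?R. (ln (l i) - X * ray_a n)\<^sup>2) = (\<Sum>i\<in>?R. (ln (l i))\<^sup>2 - 2 * X * ray_a n * ln (l i) + X\<^sup>2 * (ray_a n)\<^sup>2)"
        by (intro sum.cong) (auto simp: power2_eq_square algebra_simps)
      also have "\<dots> = (\<Sum>i\<in>?R. (ln (l i))\<^sup>2) - 2 * X * ray_a n * (\<Sum>i\<in>?R. ln (l i)) + real n * (X\<^sup>2 * (ray_a n)\<^sup>2)"
        using cR by (simp only: sum.distrib sum_subtractf sum_distrib_left sum_constant)
      finally have "(ln (l i0) - X * - ray_b n)\<^sup>2 + (\<Sum>i\<in>?R. (ln (l i) - X * ray_a n)\<^sup>2)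
         = S - 2 * X * (- ray_b n * ln (l i0) + ray_a n * (\<Sum>i\<in>?R. ln (l i))) + X\<^sup>2 * ((ray_b n)\<^sup>2 + real n * (ray_a n)\<^sup>2)"
        by (simp add: S_def power2_eq_square algebra_simps)
      then show ?thesis by (simp only: X_def[symmetric])
    qed
    also have "\<dots> = S - X\<^sup>2" by (simp only: rc(7)) (simp add: power2_eq_square)
    finally show "X\<^sup>2 \<le> (ln (l i0))\<^sup>2 + (\<Sum>i\<in>?R. (ln (l i))\<^sup>2)" by (simp add: S_def)
  qed
  finally show ?thesis using l(3) by simp
qed

text \<open>The mixed term is absorbed by a weighted arithmetic-geometric inequality: an arbitrarily
  small extra weight \<delta> on the axis is paid for by a large constant on the complement.\<close>

lemma bil_le_near_axis:
  assumes Q: "pd N Q" and k: "k < N" and \<delta>: "0 < \<delta>"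
  shows "\<exists>C>0. \<forall>v. bil N Q v v \<le> (Q k k + \<delta>) * (v k)\<^sup>2 + C * (\<Sum>i\<in>{..<N}-{k}. (v i)\<^sup>2)"
proof -
  define q where "q = Q k k"
  have q: "0 < q" unfolding q_def by (rule pd_diag_pos[OF Q k])
  define M where "M = (\<Sum>i<N. \<Sum>j<N. \<bar>Q i j\<bar>)"
  have Qs: "bil N Q u w = bil N Q w u" for u w by (rule bil_commute) (use Q in \<open>simp add: pd_def\<close>)
  have Qnn: "0 \<le> bil N Q u u" for u
  proof (cases "\<exists>i<N. u i \<noteq> 0")
    case True
    then show ?thesis using Q by (auto simp: pd_def intro: less_imp_le)
  next
    case False
    then show ?thesis by (simp add: bil_def)
  qed
  define C where "C = (1 + q / \<delta>) * M + 1"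
  have "bil N Q v v \<le> (q + \<delta>) * (v k)\<^sup>2 + C * (\<Sum>i\<in>{..<N}-{k}. (v i)\<^sup>2)" for v
  proof -
    let ?e = "\<lambda>i. if i = k then 1 else 0 :: real"
    define u where "u i = (if i = k then 0 else v i)" for i
    define x where "x = v k"
    define b where "b = bil N Q ?e u"
    define w where "w = bil N Q u u"
    have comb: "bil N Q (\<lambda>i. y * ?e i + z * u i) (\<lambda>i. y * ?e i + z * u i) = y\<^sup>2 * q + 2 * y * z * b + z\<^sup>2 * w" for y z
    proof -
      let ?f = "\<lambda>i. y * ?e i + z * u i"
      have "bil N Q ?f ?f = y * bil N Q ?f ?e + z * bil N Q ?f u" by (simp only: bil_add bil_scale)
      also have "bil N Q ?f ?e = y * bil N Q ?e ?e + z * bil N Q ?e u" by (subst Qs) (simp only: bil_add bil_scale)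
      also have "bil N Q ?f u = y * bil N Q u ?e + z * bil N Q u u" by (subst Qs) (simp only: bil_add bil_scale)
      also have "bil N Q u ?e = b" unfolding b_def by (rule Qs)
      finally show ?thesis unfolding bil_basis[OF k] b_def[symmetric] w_def[symmetric] q_def[symmetric]
        by (simp add: power2_eq_square algebra_simps)
    qed
    \<comment> \<open>Balances the axis vector against \<open>u\<close> so that the axis part of the
      nonnegative value is exactly \<open>\<delta> * x\<^sup>2\<close>.\<close>
    define s where "s = sqrt (\<delta> / q)"
    have s: "0 < s" "s\<^sup>2 = \<delta> / q" using q \<delta> by (auto simp: s_def)
    have "0 \<le> (s * x)\<^sup>2 * q + 2 * (s * x) * (- 1 / s) * b + (- 1 / s)\<^sup>2 * w" 
      using Qnn[of "\<lambda>i. (s * x) * ?e i + (- 1 / s) * u i"] unfolding comb .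
    also have "\<dots> = \<delta> * x\<^sup>2 - 2 * x * b + (q / \<delta>) * w"
      using s q \<delta> by (simp add: power_mult_distrib power_divide)
    finally have 1: "2 * x * b \<le> \<delta> * x\<^sup>2 + (q / \<delta>) * w" by simp
    have "bil N Q v v = bil N Q (\<lambda>i. x * ?e i + 1 * u i) (\<lambda>i. x * ?e i + 1 * u i)"
      by (rule bil_cong) (auto simp: u_def x_def)
    also have "\<dots> = x\<^sup>2 * q + 2 * x * b + w" using comb[of x 1] by simp
    also have "\<dots> \<le> (q + \<delta>) * x\<^sup>2 + (1 + q / \<delta>) * w" using 1 by (simp add: algebra_simps)
    also have "(1 + q / \<delta>) * w \<le> (1 + q / \<delta>) * (M * (\<Sum>i<N. (u i)\<^sup>2))"
      unfolding w_def M_def using q \<delta> by (intro mult_left_mono bil_upper_bound) auto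
    also have "(\<Sum>i<N. (u i)\<^sup>2) = (\<Sum>i\<in>{..<N}-{k}. (v i)\<^sup>2)"
    proof -
      have "(\<Sum>i<N. (u i)\<^sup>2) = (u k)\<^sup>2 + (\<Sum>i\<in>{..<N}-{k}. (u i)\<^sup>2)" using k by (intro sum_split_at) auto
      then show ?thesis by (simp add: u_def)
    qed
    also have "(1 + q / \<delta>) * (M * (\<Sum>i\<in>{..<N}-{k}. (v i)\<^sup>2)) \<le> C * (\<Sum>i\<in>{..<N}-{k}. (v i)\<^sup>2)"
      unfolding C_def mult.assoc[symmetric] by (intro mult_right_mono sum_nonneg) auto
    finally show ?thesis by (simp add: x_def)
  qed
  moreover have "0 \<le> M" unfolding M_def by (intro sum_nonneg) auto
  then have "0 < C" using q \<delta> unfolding C_def by (intro add_nonneg_pos mult_nonneg_nonneg) auto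
  ultimately show ?thesis unfolding q_def by blast
qed

lemma sqrt_le_linear:
  fixes t X :: real
  assumes "0 < t" "0 \<le> t\<^sup>2 + X"
  shows "sqrt (t\<^sup>2 + X) \<le> t + X / (2 * t)"
proof (rule real_le_lsqrt)
  have "- (t\<^sup>2) \<le> X" using assms(2) by simp
  then have "- (t\<^sup>2) / (2 * t) \<le> X / (2 * t)" using assms(1) by (intro divide_right_mono) auto
  moreover have "- (t\<^sup>2) / (2 * t) = - t / 2" using assms(1) by (simp add: power2_eq_square)
  ultimately show "0 \<le> t + X / (2 * t)" using assms(1) by linarith
  have "(t + X / (2 * t))\<^sup>2 = t\<^sup>2 + X + (X / (2 * t))\<^sup>2" using assms(1) by (simp add: power2_sum)
  then show "t\<^sup>2 + X \<le> (t + X / (2 * t))\<^sup>2" by simp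
qed

text \<open>For large t the eigenvalues are exp(- b t - m) once and exp(a t + c i) otherwise, where
  \<open>m\<close> lies between \<open>ln (Q k k)\<close> and \<open>ln (Q k k + \<delta>)\<close>
  and the \<open>c i\<close> are bounded with sum \<open>m\<close>. The squared distance is then t^2
  + 2 t \<eta> m plus a bounded term, whose effect on the root vanishes.\<close>

lemma ray_dist_upper:
  assumes n: "1 \<le> n" and k: "k < n + 1" and Q: "pd (n+1) Q" "detN (n+1) Q = 1" and \<delta>: "0 < \<delta>"
  shows "\<forall>\<^sub>F t in at_top. pdist (n+1) Q (Dk n k t) \<le> t + ray_eta n * ln (Q k k + \<delta>) + \<delta>"
proof -
  note rc = ray_constants[OF n]
  define q where "q = Q k k"
  have q: "0 < q" unfolding q_def by (rule pd_diag_pos[OF Q(1) k])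
  obtain C0 where C0: "0 < C0" "\<And>v. (\<Sum>i<n+1. (v i)\<^sup>2) \<le> C0 * bil (n+1) Q v v" using pd_lower_bound[OF Q(1)] by blast
  obtain C1 where C1: "0 < C1" "\<And>v. bil (n+1) Q v v \<le> (q + \<delta>) * (v k)\<^sup>2 + C1 * (\<Sum>i\<in>{..<n+1}-{k}. (v i)\<^sup>2)"
    using bil_le_near_axis[OF Q(1) k \<delta>] unfolding q_def by blast
  define m1 where "m1 = \<bar>ln q\<bar> + \<bar>ln (q + \<delta>)\<bar>"
  define K where "K = m1 + real n * \<bar>ln C0\<bar>"
  define K2 where "K2 = m1\<^sup>2 + real n * K\<^sup>2"
  have "((\<lambda>t. K2 / (2 * t)) \<longlongrightarrow> 0) at_top" by real_asymp
  then have e1: "\<forall>\<^sub>F t in at_top. K2 / (2 * t) < \<delta>" using \<delta> by (rule order_tendstoD)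
  have "filterlim (\<lambda>t. (q + \<delta>) * exp (ray_b n * t)) at_top at_top" using q \<delta> rc(2) by real_asymp
  then have e2: "\<forall>\<^sub>F t in at_top. C1 \<le> (q + \<delta>) * exp (ray_b n * t)" by (simp add: filterlim_at_top)
  show ?thesis
    using e1 e2 eventually_gt_at_top[of 0]
  proof eventually_elim
    case (elim t)
    obtain B l i0 where l: "simdiag (n+1) Q (Dk n k t) B l" "\<And>i. i < n+1 \<Longrightarrow> 0 < l i" "i0 < n+1"
      "pdist (n+1) Q (Dk n k t) = sqrt ((ln (l i0))\<^sup>2 + (\<Sum>i\<in>{..<n+1}-{i0}. (ln (l i))\<^sup>2))"
      "ln (l i0) + (\<Sum>i\<in>{..<n+1}-{i0}. ln (l i)) = 0"
      "l i0 * Q k k \<le> exp (- (ray_b n * t))"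
      using relative_eigenvalues[OF n k Q, of t] by metis
    let ?R = "{..<n+1}-{i0}"
    have cR: "card ?R = n" using l(3) by simp
    have Qb: "bil (n+1) Q (\<lambda>j. B j i) (\<lambda>j. B j i) = 1" and Db: "bil (n+1) (Dk n k t) (\<lambda>j. B j i) (\<lambda>j. B j i) = l i" if "i < n+1" for i
      using simdiag_Q[OF l(1) that that] simdiag_D[OF l(1) that that] by simp_all
    have Dsplit: "bil (n+1) (Dk n k t) v v = exp (- (ray_b n * t)) * (v k)\<^sup>2 + exp (ray_a n * t) * (\<Sum>i\<in>{..<n+1}-{k}. (v i)\<^sup>2)" for v
    proof -
      have "bil (n+1) (Dk n k t) v v = (\<Sum>i<n+1. (if i = k then exp (- (ray_b n * t)) else exp (ray_a n * t)) * (v i)\<^sup>2)"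
        by (simp only: Dk_def bil_diagm)
      also have "\<dots> = exp (- (ray_b n * t)) * (v k)\<^sup>2 + (\<Sum>i\<in>{..<n+1}-{k}. (if i = k then exp (- (ray_b n * t)) else exp (ray_a n * t)) * (v i)\<^sup>2)"
        using k sum_split_at[of "{..<n+1}" k "\<lambda>i. (if i = k then exp (- (ray_b n * t)) else exp (ray_a n * t)) * (v i)\<^sup>2"] by simp
      also have "(\<Sum>i\<in>{..<n+1}-{k}. (if i = k then exp (- (ray_b n * t)) else exp (ray_a n * t)) * (v i)\<^sup>2) = exp (ray_a n * t) * (\<Sum>i\<in>{..<n+1}-{k}. (v i)\<^sup>2)"
        unfolding sum_distrib_left by (intro sum.cong) auto
      finally show ?thesis .
    qed
    have at: "0 \<le> ray_a n * t" "0 \<le> ray_b n * t" using elim rc by auto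
    have up: "ln (l i) \<le> ln C0 + ray_a n * t" if i: "i < n+1" for i
    proof -
      let ?v = "\<lambda>j. B j i"
      have "l i \<le> exp (ray_a n * t) * (?v k)\<^sup>2 + exp (ray_a n * t) * (\<Sum>i\<in>{..<n+1}-{k}. (?v i)\<^sup>2)"
        unfolding Db[OF i, symmetric] Dsplit using at by (intro add_right_mono mult_right_mono) auto
      also have "\<dots> = exp (ray_a n * t) * (\<Sum>i<n+1. (?v i)\<^sup>2)"
        using k sum_split_at[of "{..<n+1}" k "\<lambda>i. (?v i)\<^sup>2"] by (simp add: distrib_left)
      also have "\<dots> \<le> exp (ray_a n * t) * (C0 * 1)" using C0(2)[of ?v] Qb[OF i] by (intro mult_left_mono) auto
      finally have "l i \<le> exp (ray_a n * t) * C0" by simp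
      then have "ln (l i) \<le> ln (exp (ray_a n * t) * C0)" using l(2)[OF i] C0(1) by simp
      then show ?thesis using C0(1) by (simp add: ln_mult)
    qed
    define m where "m = - ln (l i0) - ray_b n * t"
    have mlow: "ln q \<le> m"
    proof -
      have "ln (l i0 * q) \<le> ln (exp (- (ray_b n * t)))"
        using l(6) l(2)[OF l(3)] q unfolding q_def by (subst ln_le_cancel_iff) auto
      then show ?thesis using l(2)[OF l(3)] q by (simp add: ln_mult m_def)
    qed
    \<comment> \<open>Once \<open>exp (ray_b n * t)\<close> dominates \<open>C1\<close>, the bound
      near the axis compares \<open>Q\<close> with a multiple of the ray point; evaluate it at the
      \<open>Q\<close>-normalised eigenvector of \<open>l i0\<close>.\<close>
    have mup: "m \<le> ln (q + \<delta>)"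
    proof -
      let ?v = "\<lambda>j. B j i0"
      have "1 \<le> (q + \<delta>) * (?v k)\<^sup>2 + C1 * (\<Sum>i\<in>{..<n+1}-{k}. (?v i)\<^sup>2)" using C1(2)[of ?v] Qb[OF l(3)] by simp
      also have "\<dots> \<le> (q + \<delta>) * exp (ray_b n * t) * bil (n+1) (Dk n k t) ?v ?v"
      proof -
        have 1: "exp (ray_b n * t) * exp (- (ray_b n * t)) = 1" by (simp add: exp_minus)
        have "C1 * 1 \<le> (q + \<delta>) * exp (ray_b n * t) * exp (ray_a n * t)"
          using elim(2) q \<delta> at C1(1) by (intro mult_mono) auto
        then have "C1 * (\<Sum>i\<in>{..<n+1}-{k}. (?v i)\<^sup>2) \<le> (q + \<delta>) * exp (ray_b n * t) * exp (ray_a n * t) * (\<Sum>i\<in>{..<n+1}-{k}. (?v i)\<^sup>2)"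
          by (intro mult_right_mono sum_nonneg) auto
        moreover have "(q + \<delta>) * (?v k)\<^sup>2 = (q + \<delta>) * exp (ray_b n * t) * (exp (- (ray_b n * t)) * (?v k)\<^sup>2)"
          using 1 by (simp add: mult.assoc[symmetric] mult.assoc[of "q + \<delta>"])
        moreover have "(q + \<delta>) * exp (ray_b n * t) * bil (n+1) (Dk n k t) ?v ?v
            = (q + \<delta>) * exp (ray_b n * t) * (exp (- (ray_b n * t)) * (?v k)\<^sup>2)
              + (q + \<delta>) * exp (ray_b n * t) * exp (ray_a n * t) * (\<Sum>i\<in>{..<n+1}-{k}. (?v i)\<^sup>2)"
          unfolding Dsplit by (simp only: distrib_left mult.assoc)
        ultimately show ?thesis by (simp only: add_left_mono)
      qed
      also have "\<dots> = (q + \<delta>) * exp (ray_b n * t) * l i0" by (simp only: Db[OF l(3)])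
      finally have "0 \<le> ln ((q + \<delta>) * exp (ray_b n * t) * l i0)" by simp
      also have "\<dots> = ln (q + \<delta>) + ray_b n * t + ln (l i0)" using q \<delta> l(2)[OF l(3)] by (simp add: ln_mult)
      finally show ?thesis by (simp add: m_def)
    qed
    have mm: "\<bar>m\<bar> \<le> m1" using mlow mup by (auto simp: m1_def)
    define c where "c i = ln (l i) - ray_a n * t" for i
    have sc: "(\<Sum>i\<in>?R. c i) = m"
    proof -
      have "(\<Sum>i\<in>?R. c i) = (\<Sum>i\<in>?R. ln (l i)) - real n * (ray_a n * t)" using cR by (simp add: c_def sum_subtractf)
      then show ?thesis using l(5) rc(4) by (simp add: m_def)
    qed
    \<comment> \<open>Each \<open>c i\<close> is bounded above, and below because the sum is
      \<open>m\<close> while the others are bounded above.\<close>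
    have cb: "\<bar>c i\<bar> \<le> K" if i: "i \<in> ?R" for i
    proof -
      have "c i \<le> ln C0" using up[of i] i by (simp add: c_def)
      moreover have "m - real n * \<bar>ln C0\<bar> \<le> c i"
      proof -
        have "(\<Sum>j\<in>?R - {i}. c j) \<le> (\<Sum>j\<in>?R - {i}. \<bar>ln C0\<bar>)"
          using up by (intro sum_mono) (force simp: c_def)
        also have "\<dots> \<le> real n * \<bar>ln C0\<bar>"
          using cR card_Diff_subset[of "{i}" ?R] i by (simp add: mult_right_mono)
        finally have "(\<Sum>j\<in>?R - {i}. c j) \<le> real n * \<bar>ln C0\<bar>" .
        moreover have "m = c i + (\<Sum>j\<in>?R - {i}. c j)" unfolding sc[symmetric] using i by (intro sum_split_at) auto
        ultimately show ?thesis by linarith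
      qed
      moreover have "\<bar>ln C0\<bar> \<le> real n * \<bar>ln C0\<bar>" using n by (simp add: mult_le_cancel_right1)
      moreover have "0 \<le> m1" by (simp add: m1_def)
      ultimately show ?thesis using mm unfolding K_def by linarith
    qed
    have "(ln (l i0))\<^sup>2 + (\<Sum>i\<in>?R. (ln (l i))\<^sup>2) = t\<^sup>2 + (2 * t * (ray_eta n * m) + (m\<^sup>2 + (\<Sum>i\<in>?R. (c i)\<^sup>2)))"
    proof -
      have "(\<Sum>i\<in>?R. (ln (l i))\<^sup>2) = (\<Sum>i\<in>?R. (ray_a n * t)\<^sup>2 + 2 * ray_a n * t * c i + (c i)\<^sup>2)"
        by (intro sum.cong) (auto simp: c_def power2_eq_square algebra_simps)
      also have "\<dots> = real n * (ray_a n * t)\<^sup>2 + 2 * ray_a n * t * m + (\<Sum>i\<in>?R. (c i)\<^sup>2)"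
        using cR sc by (simp add: sum.distrib sum_distrib_left[symmetric])
      finally have 1: "(\<Sum>i\<in>?R. (ln (l i))\<^sup>2) = real n * (ray_a n * t)\<^sup>2 + 2 * ray_a n * t * m + (\<Sum>i\<in>?R. (c i)\<^sup>2)" .
      have 2: "(ln (l i0))\<^sup>2 = (ray_b n * t)\<^sup>2 + 2 * ray_b n * t * m + m\<^sup>2" by (simp add: m_def power2_eq_square algebra_simps)
      have "(ray_b n * t)\<^sup>2 + real n * (ray_a n * t)\<^sup>2 = ((ray_b n)\<^sup>2 + real n * (ray_a n)\<^sup>2) * t\<^sup>2"
        by (simp add: power_mult_distrib algebra_simps)
      then have 3: "(ray_b n * t)\<^sup>2 + real n * (ray_a n * t)\<^sup>2 = t\<^sup>2" by (simp only: rc(7) mult_1)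
      show ?thesis unfolding 1 2 rc(5) using 3 by (simp add: algebra_simps)
    qed
    then have pd: "pdist (n+1) Q (Dk n k t) = sqrt (t\<^sup>2 + (2 * t * (ray_eta n * m) + (m\<^sup>2 + (\<Sum>i\<in>?R. (c i)\<^sup>2))))"
      using l(4) by simp
    have "pdist (n+1) Q (Dk n k t) \<le> t + (2 * t * (ray_eta n * m) + (m\<^sup>2 + (\<Sum>i\<in>?R. (c i)\<^sup>2))) / (2 * t)"
      unfolding pd
    proof (rule sqrt_le_linear)
      show "0 \<le> t\<^sup>2 + (2 * t * (ray_eta n * m) + (m\<^sup>2 + (\<Sum>i\<in>?R. (c i)\<^sup>2)))"
        unfolding \<open>_ = t\<^sup>2 + (2 * t * (ray_eta n * m) + (m\<^sup>2 + (\<Sum>i\<in>?R. (c i)\<^sup>2)))\<close>[symmetric]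
        by (intro add_nonneg_nonneg sum_nonneg) auto
    qed (use elim in simp)
    also have "\<dots> = t + ray_eta n * m + (m\<^sup>2 + (\<Sum>i\<in>?R. (c i)\<^sup>2)) / (2 * t)"
      using elim by (simp add: add_divide_distrib)
    also have "\<dots> \<le> t + ray_eta n * ln (q + \<delta>) + K2 / (2 * t)"
    proof (intro add_mono divide_right_mono order_refl mult_left_mono mup)
      have "m\<^sup>2 \<le> m1\<^sup>2" using mm by (simp add: abs_le_square_iff[symmetric] m1_def)
      moreover have "(\<Sum>i\<in>?R. (c i)\<^sup>2) \<le> (\<Sum>i\<in>?R. K\<^sup>2)"
      proof (rule sum_mono)
        fix i assume "i \<in> ?R"
        then have "\<bar>c i\<bar> \<le> \<bar>K\<bar>" using cb[of i] by simp
        then show "(c i)\<^sup>2 \<le> K\<^sup>2" by (simp add: abs_le_square_iff)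
      qed
      ultimately show "m\<^sup>2 + (\<Sum>i\<in>?R. (c i)\<^sup>2) \<le> K2" using cR by (simp add: K2_def)
    qed (use rc elim in auto)
    also have "\<dots> \<le> t + ray_eta n * ln (q + \<delta>) + \<delta>" using elim(1) by simp
    finally show ?case by (simp add: q_def)
  qed
qed

text \<open>The lower bound holds for all \<open>g\<close> and \<open>t\<close> at once and passes
  to the infimum. For the upper bound a single \<open>g\<close> that nearly attains the infimum
  suffices, so the time threshold may depend on it. This also shows that the limit behind
  \<open>Lim\<close> exists.\<close>

lemma busemann_eq:
  assumes Q: "pd N Q" and r: "\<And>t. pd N (r t)" "\<And>t i j. \<not> (i < N \<and> j < N) \<Longrightarrow> r t i j = 0"
    and c: "0 < c" "\<And>g. g \<in> SLZ N \<Longrightarrow> c \<le> f g" and \<eta>: "0 < \<eta>"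
    and lower: "\<And>g t. g \<in> SLZ N \<Longrightarrow> t + \<eta> * ln (f g) \<le> pdist N (act N Q g) (r t)"
    and upper: "\<And>g \<delta>. g \<in> SLZ N \<Longrightarrow> 0 < \<delta> \<Longrightarrow> \<forall>\<^sub>F t in at_top. pdist N (act N Q g) (r t) \<le> t + \<eta> * ln (f g + \<delta>) + \<delta>"
  shows "busemann N r (pr N Q) = \<eta> * ln (INF g\<in>SLZ N. f g)"
proof -
  define m where "m = (INF g\<in>SLZ N. f g)"
  have ne: "SLZ N \<noteq> {}" using SLZ_id by blast
  have cm: "c \<le> m" unfolding m_def using ne c(2) by (intro cINF_greatest)
  have bdd: "bdd_below (f ` SLZ N)" using c(2) by (rule bdd_belowI2)
  have mf: "m \<le> f g" if "g \<in> SLZ N" for g unfolding m_def by (rule cINF_lower[OF bdd that])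
  have m0: "0 < m" using cm c(1) by simp
  have "((\<lambda>t. tdist N (pr N Q) (pr N (r t)) - t) \<longlongrightarrow> \<eta> * ln m) at_top"
  proof (rule order_tendstoI)
    fix y assume y: "y < \<eta> * ln m"
    have "\<eta> * ln m \<le> tdist N (pr N Q) (pr N (r t)) - t" for t
    proof -
      have "t + \<eta> * ln m \<le> tdist N (pr N Q) (pr N (r t))"
      proof (rule tdist_greatest[OF Q r(1)])
        fix g assume g: "g \<in> SLZ N"
        have "ln m \<le> ln (f g)" using mf[OF g] m0 by simp
        then have "\<eta> * ln m \<le> \<eta> * ln (f g)" using \<eta> by simp
        then show "t + \<eta> * ln m \<le> pdist N (act N Q g) (r t)" using lower[OF g, of t] by linarith
      qed
      then show ?thesis by simp
    qed
    then show "\<forall>\<^sub>F t in at_top. y < tdist N (pr N Q) (pr N (r t)) - t" using y by (intro always_eventually) (auto intro: less_le_trans)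
  next
    fix y assume y: "\<eta> * ln m < y"
    have "((\<lambda>e. \<eta> * ln (m + 2 * e) + e) \<longlongrightarrow> \<eta> * ln (m + 2 * 0) + 0) (at_right 0)"
      using m0 by (intro tendsto_intros) auto
    then have "\<forall>\<^sub>F e in at_right 0. \<eta> * ln (m + 2 * e) + e < y" using y by (intro order_tendstoD(2)[of _ _ _ y]) auto
    then have "\<forall>\<^sub>F e in at_right 0. 0 < e \<and> \<eta> * ln (m + 2 * e) + e < y"
      using eventually_at_right_less[of "0::real"] by eventually_elim auto
    then obtain e :: real where e: "0 < e" "\<eta> * ln (m + 2 * e) + e < y"
      by (metis (mono_tags, lifting) eventually_happens' trivial_limit_at_right_real)
    have "(INF g\<in>SLZ N. f g) < m + e" using e(1) by (simp add: m_def)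
    then obtain g where g: "g \<in> SLZ N" "f g < m + e" using cINF_less_iff[OF ne bdd] by blast
    show "\<forall>\<^sub>F t in at_top. tdist N (pr N Q) (pr N (r t)) - t < y"
      using upper[OF g(1) e(1)]
    proof eventually_elim
      case (elim t)
      have "tdist N (pr N Q) (pr N (r t)) \<le> pdist N (act N Q g) (r t)" by (rule tdist_le[OF g(1) r(2)])
      also have "\<dots> \<le> t + \<eta> * ln (f g + e) + e" by (rule elim)
      also have "\<dots> \<le> t + \<eta> * ln (m + 2 * e) + e"
      proof -
        have "0 < f g" using c(1) c(2)[OF g(1)] by simp
        then have "ln (f g + e) \<le> ln (m + 2 * e)" using g(2) e(1) m0 by (subst ln_le_cancel_iff) auto
        then have "\<eta> * ln (f g + e) \<le> \<eta> * ln (m + 2 * e)" using \<eta> by simp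
        then show ?thesis by simp
      qed
      finally show ?case using e(2) by simp
    qed
  qed
  then show ?thesis unfolding busemann_def m_def by (intro tendsto_Lim) simp_all
qed

lemma detN_one_inverse:
  assumes "detN N g = (1 :: real)"
  shows "\<exists>g'. mt N g * mt N g' = 1\<^sub>m N \<and> mt N g' * mt N g = 1\<^sub>m N"
proof -
  have gd: "Determinant.det (mt N g) = 1" using assms by (simp add: detN_eq_det)
  define g' where "g' i j = adj_mat (mt N g) $$ (i, j)" for i j
  note adj = adj_mat[OF mt_carrier[of N g]]
  have eq: "adj_mat (mt N g) = mt N g'"
    using adj(1) by (intro eq_matI) (auto simp: g'_def mt_def)
  have one_smult: "(1::real) \<cdot>\<^sub>m 1\<^sub>m N = 1\<^sub>m N" by (rule eq_matI) auto
  show ?thesis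
    using adj(2,3) by (intro exI[of _ g']) (simp add: eq[symmetric] gd one_smult)
qed

lemma detN_act: "detN N (act N Q g) = (detN N g)\<^sup>2 * detN N Q"
  by (simp only: detN_eq_det mt_act det_congruence)

lemma pd_act_det:
  assumes "pd N Q" "detN N g = 1"
  shows "pd N (act N Q g)"
  using detN_one_inverse[OF assms(2)] pd_act[OF assms(1)] by blast

lemma SLZ_det: "g \<in> SLZ N \<Longrightarrow> detN N g = 1"
  by (simp add: SLZ_def)

section \<open>Minima of a form on integer vectors\<close>

lemma SLZ_column_nonzero:
  assumes h: "h \<in> SLZ N" and k: "k < N"
  obtains v :: "nat \<Rightarrow> int" where "\<And>i. i < N \<Longrightarrow> h i k = of_int (v i)" "\<exists>i<N. v i \<noteq> 0"
proof -
  define v where "v i = \<lfloor>h i k\<rfloor>" for i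
  have hv: "h i k = of_int (v i)" if "i < N" for i
    using h that k by (auto simp: SLZ_def v_def)
  have "\<exists>i<N. v i \<noteq> 0"
  proof (rule ccontr)
    assume z: "\<not> (\<exists>i<N. v i \<noteq> 0)"
    obtain h' where "mt N h' * mt N h = 1\<^sub>m N" using SLZ_inverse[OF h] by blast
    then have "(\<Sum>i<N. h' k i * h i k) = 1"
      using mt_eqD[of N "\<lambda>i j. \<Sum>m<N. h' i m * h m j" "\<lambda>i j. if i = j then 1 else 0" k k] k by (simp add: mt_mult mt_one)
    moreover have "(\<Sum>i<N. h' k i * h i k) = 0" using z hv by (intro sum.neutral) auto
    ultimately show False by simp
  qed
  then show ?thesis using that hv by blast
qed

text \<open>The infimum of \<open>P\<close> over the \<open>k\<close>-th columns of unimodular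
  matrices, that is over primitive vectors, in the shape in which the Busemann formula delivers
  it.\<close>

definition lattice_min :: "nat \<Rightarrow> (nat \<Rightarrow> nat \<Rightarrow> real) \<Rightarrow> nat \<Rightarrow> real" where
  "lattice_min N P k = (INF h\<in>SLZ N. act N P h k k)"

lemma act_column: "k < N \<Longrightarrow> act N P h k k = bil N P (\<lambda>i. h i k) (\<lambda>i. h i k)"
  by (simp add: act_eq_bil)

lemma act_diag_bounded_below:
  assumes P: "pd N P" and k: "k < N"
  shows "\<exists>c>0. \<forall>h\<in>SLZ N. c \<le> act N P h k k"
proof -
  obtain C where C: "0 < C" "\<And>v. (\<Sum>i<N. (v i)\<^sup>2) \<le> C * bil N P v v" using pd_lower_bound[OF P] by blast
  have "1 / C \<le> act N P h k k" if h: "h \<in> SLZ N" for h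
  proof -
    obtain v :: "nat \<Rightarrow> int" where v: "\<And>i. i < N \<Longrightarrow> h i k = of_int (v i)" "\<exists>i<N. v i \<noteq> 0"
      using SLZ_column_nonzero[OF h k] by blast
    then obtain i where i: "i < N" "v i \<noteq> 0" by blast
    have "1 \<le> \<bar>v i\<bar>" using i(2) by linarith
    then have "1 \<le> \<bar>h i k\<bar>" using v(1)[OF i(1)] by (simp flip: of_int_abs)
    then have "1 \<le> (h i k)\<^sup>2" using one_le_power[of "\<bar>h i k\<bar>" 2] by simp
    also have "\<dots> \<le> (\<Sum>i<N. (h i k)\<^sup>2)" using i(1) by (intro member_le_sum) auto
    also have "\<dots> \<le> C * act N P h k k" unfolding act_column[OF k] by (rule C(2))
    finally show ?thesis using C(1) by (simp add: field_simps)
  qed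
  then show ?thesis using C(1) by (intro exI[of _ "1 / C"]) auto
qed

lemma lattice_min_pos:
  assumes P: "pd N P" and k: "k < N"
  shows "0 < lattice_min N P k"
proof -
  obtain c where c: "0 < c" "\<forall>h\<in>SLZ N. c \<le> act N P h k k" using act_diag_bounded_below[OF P k] by blast
  have "c \<le> lattice_min N P k" unfolding lattice_min_def using c(2) SLZ_id by (intro cINF_greatest) auto
  then show ?thesis using c(1) by simp
qed

text \<open>Doubling \<open>E\<close> makes the inequality strict, so some matrix realises it
  whether or not the infimum is attained; the factor 2 is absorbed later.\<close>

lemma lattice_min_vector:
  assumes P: "pd N P" and k: "k < N" and E: "0 < E" "lattice_min N P k \<le> E"
  shows "\<exists>v :: nat \<Rightarrow> int. (\<exists>i<N. v i \<noteq> 0) \<and> bil N P (\<lambda>i. of_int (v i)) (\<lambda>i. of_int (v i)) \<le> 2 * E"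
proof -
  have ne: "SLZ N \<noteq> {}" using SLZ_id by blast
  have "lattice_min N P k < 2 * E" using E by simp
  then obtain h where h: "h \<in> SLZ N" "act N P h k k < 2 * E"
    unfolding lattice_min_def using act_diag_bounded_below[OF P k] by (subst (asm) cINF_less_iff[OF ne]) (auto intro: bdd_belowI2)
  obtain v :: "nat \<Rightarrow> int" where v: "\<And>i. i < N \<Longrightarrow> h i k = of_int (v i)" "\<exists>i<N. v i \<noteq> 0"
    using SLZ_column_nonzero[OF h(1) k] by blast
  have "act N P h k k = bil N P (\<lambda>i. of_int (v i)) (\<lambda>i. of_int (v i))"
    unfolding act_column[OF k] using v(1) by (intro bil_cong)
  then show ?thesis using h(2) v(2) by (intro exI[of _ v]) auto
qed

text \<open>A nonzero integer vector is a multiple of a primitive one, at which the form is no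
  larger, and a primitive vector is a column of a unimodular matrix.\<close>

lemma lattice_min_le:
  fixes v :: "nat \<Rightarrow> int"
  assumes P: "pd N P" and N: "2 \<le> N" and k: "k < N" and v: "\<exists>i<N. v i \<noteq> 0"
  shows "lattice_min N P k \<le> bil N P (\<lambda>i. of_int (v i)) (\<lambda>i. of_int (v i))"
proof -
  obtain d w where dw: "d \<noteq> 0" "\<forall>i<N. v i = d * w i" "primitive N w" using primitive_quotient[OF v] by blast
  obtain h where h: "h \<in> SLZ N" "\<forall>i<N. h i k = of_int (w i)"
    using primitive_column[OF N k dw(3)] by (auto simp: column_def)
  have bdd: "bdd_below ((\<lambda>h. act N P h k k) ` SLZ N)"
    using act_diag_bounded_below[OF P k] by (auto intro: bdd_belowI2)
  have "lattice_min N P k \<le> act N P h k k" unfolding lattice_min_def by (rule cINF_lower[OF bdd h(1)])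
  also have "\<dots> = bil N P (\<lambda>i. of_int (w i)) (\<lambda>i. of_int (w i))" unfolding act_column[OF k] using h(2) by (intro bil_cong) auto
  also have "\<dots> \<le> (of_int d)\<^sup>2 * bil N P (\<lambda>i. of_int (w i)) (\<lambda>i. of_int (w i))"
  proof -
    have "1 \<le> \<bar>d\<bar>" using dw(1) by linarith
    then have "1 \<le> \<bar>real_of_int d\<bar>" by linarith
    then have "1 \<le> (real_of_int d)\<^sup>2" using one_le_power[of "\<bar>real_of_int d\<bar>" 2] by simp
    moreover have "\<exists>i<N. w i \<noteq> 0" using v dw(2) by auto
    then have "\<exists>i<N. real_of_int (w i) \<noteq> 0" by simp
    then have "0 < bil N P (\<lambda>i. of_int (w i)) (\<lambda>i. of_int (w i))" using P by (simp add: pd_def)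
    ultimately show ?thesis by (simp add: mult_le_cancel_right1)
  qed
  also have "\<dots> = bil N P (\<lambda>i. of_int (d * w i)) (\<lambda>i. of_int (d * w i))"
    by (simp add: bil_def sum_distrib_left power2_eq_square mult_ac)
  also have "\<dots> = bil N P (\<lambda>i. of_int (v i)) (\<lambda>i. of_int (v i))" using dw(2) by (intro bil_cong) auto
  finally show ?thesis .
qed

lemma ray1_eq_Dk: "ray1 n t = Dk n n t"
  by (intro ext) (auto simp: ray1_def Dk_def diagm_def ray_a_def ray_b_def mult.commute)

lemma Dk_outside: "\<not> (i < n+1 \<and> j < n+1) \<Longrightarrow> Dk n k t i j = 0"
  by (auto simp: Dk_def diagm_def)

lemma busemann_ray1:
  assumes n: "1 \<le> n" and Q: "pd (n+1) Q" "detN (n+1) Q = 1"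
  shows "busemann (n+1) (ray1 n) (pr (n+1) Q) = ray_eta n * ln (lattice_min (n+1) Q n)"
proof -
  obtain c where c: "0 < c" "\<And>h. h \<in> SLZ (n+1) \<Longrightarrow> c \<le> act (n+1) Q h n n"
    using act_diag_bounded_below[OF Q(1), of n] by auto
  have QA: "pd (n+1) (act (n+1) Q h)" "detN (n+1) (act (n+1) Q h) = 1" if "h \<in> SLZ (n+1)" for h
    using pd_act_det[OF Q(1) SLZ_det[OF that]] SLZ_det[OF that] Q(2) by (simp_all only: detN_act power_one mult_1)
  have nk: "n < n + 1" by simp
  have r: "ray1 n = Dk n n" by (rule ext) (rule ray1_eq_Dk)
  show ?thesis
    unfolding lattice_min_def r
    by (rule busemann_eq[OF Q(1) pd_Dk Dk_outside c ray_constants(3)[OF n] ray_dist_lower[OF n nk] ray_dist_upper[OF n nk]])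
       (use QA in auto)
qed

lemma mt_diagm_mult:
  assumes "\<And>i. i < N \<Longrightarrow> f i * g i = (1 :: real)"
  shows "mt N (diagm N f) * mt N (diagm N g) = 1\<^sub>m N"
  unfolding mt_mult mt_one
proof (rule mt_cong)
  fix i j assume ij: "i < N" "j < N"
  have "(\<Sum>k<N. diagm N f i k * diagm N g k j) = (\<Sum>k<N. if k = i then (if i = j then f i * g i else 0) else 0)"
    using ij by (intro sum.cong) (auto simp: diagm_def)
  then show "(\<Sum>k<N. diagm N f i k * diagm N g k j) = (if i = j then 1 else 0)" using ij assms by simp
qed

text \<open>Inversion of forms is an isometry: eigenvalues become reciprocals, and their logarithms
  only change sign.\<close>

lemma pdist_dual:
  assumes Q: "pd N Q" and D: "pd N D" and P: "mt N Q * mt N P = 1\<^sub>m N" and E: "mt N D * mt N E = 1\<^sub>m N"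
  shows "pdist N Q D = pdist N P E"
proof -
  have Qs: "\<forall>i<N. \<forall>j<N. Q i j = Q j i" and Ds: "\<forall>i<N. \<forall>j<N. D i j = D j i" using Q D by (auto simp: pd_def)
  obtain B l where sd: "simdiag N Q D B l" using simdiag_exists[OF Q Ds] by blast
  have l: "0 < l i" if "i < N" for i by (rule simdiag_pos[OF sd D that])
  have "transpose_mat (mt N Q) = mt N Q" unfolding mt_transpose using Qs by (intro mt_cong) auto
  then obtain C where "simdiag N P E C (\<lambda>i. 1 / l i)"
    using simdiag_dual[OF sd P E] l by (metis less_irrefl)
  then have "pdist N P E = sqrt (\<Sum>i<N. (ln (1 / l i))\<^sup>2)" by (rule simdiag_pdist)
  also have "(\<Sum>i<N. (ln (1 / l i))\<^sup>2) = (\<Sum>i<N. (ln (l i))\<^sup>2)"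
    using l by (intro sum.cong) (auto simp: ln_div)
  finally show ?thesis using simdiag_pdist[OF sd] by simp
qed

lemma pd_rayn: "pd (n+1) (rayn n t)"
  unfolding rayn_def by (rule pd_diagm) auto

lemma rayn_Dk: "mt (n+1) (rayn n t) * mt (n+1) (Dk n 0 t) = 1\<^sub>m (n+1)"
  unfolding rayn_def Dk_def by (rule mt_diagm_mult) (auto simp: exp_add[symmetric] ray_a_def ray_b_def mult.commute)

text \<open>The inverse form transforms by the inverse transpose.\<close>

lemma inverse_congruence:
  fixes U V D F :: "nat \<Rightarrow> nat \<Rightarrow> real"
  assumes UV: "transpose_mat (mt N U) * mt N V = 1\<^sub>m N" and DF: "mt N D * mt N F = 1\<^sub>m N"
  shows "mt N (act N D U) * mt N (act N F V) = 1\<^sub>m N"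
proof -
  let ?U = "mt N U" and ?V = "mt N V" and ?D = "mt N D" and ?F = "mt N F"
  note as = assoc_mult_mat[of _ N N _ N _ N] mult_carrier_mat[of _ N N _ N]
  have "?V * transpose_mat ?U = 1\<^sub>m N" by (rule mat_mult_left_right_inverse[OF _ _ UV]) simp_all
  from arg_cong[OF this, of transpose_mat] have VU: "?U * transpose_mat ?V = 1\<^sub>m N"
    by (simp add: transpose_mult[of _ N N _ N])
  have "mt N (act N D U) * mt N (act N F V) = transpose_mat ?U * (?D * ((?U * transpose_mat ?V) * (?F * ?V)))"
    unfolding mt_act by (simp add: as)
  also have "\<dots> = transpose_mat ?U * ((?D * ?F) * ?V)"
    unfolding VU by (simp add: left_mult_one_mat[of _ N N] as)
  also have "\<dots> = 1\<^sub>m N" by (simp add: DF UV)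
  finally show ?thesis .
qed

lemma inverse_unique:
  fixes h h' k :: "nat \<Rightarrow> nat \<Rightarrow> real"
  assumes "mt N h * mt N h' = 1\<^sub>m N" "mt N h' * mt N k = 1\<^sub>m N"
  shows "mt N k = mt N h"
proof -
  have "mt N k = (mt N h * mt N h') * mt N k" by (simp add: assms(1))
  also have "\<dots> = mt N h * (mt N h' * mt N k)" by (rule assoc_mult_mat[OF mt_carrier mt_carrier mt_carrier])
  finally show ?thesis by (simp add: assms(2))
qed

text \<open>Inverting forms turns the ray into \<open>Dk n 0\<close>, for which distances are known,
  and the action into that of inverse transposes. These exhaust the group again, so the infimum is
  the lattice minimum of the inverse form.\<close>

lemma busemann_rayn:
  assumes n: "1 \<le> n" and Q: "pd (n+1) Q" and P: "pd (n+1) P" "detN (n+1) P = 1"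
    and QP: "mt (n+1) Q * mt (n+1) P = 1\<^sub>m (n+1)"
  shows "busemann (n+1) (rayn n) (pr (n+1) Q) = ray_eta n * ln (lattice_min (n+1) P 0)"
proof -
  let ?N = "n + 1"
  have k0: "0 < n + 1" by simp
  \<comment> \<open>A chosen inverse transpose. It is determined on the block alone, so surjectivity
    is shown for the resulting forms rather than for the matrices.\<close>
  define star where "star g = (SOME h. h \<in> SLZ ?N \<and> transpose_mat (mt ?N g) * mt ?N h = 1\<^sub>m ?N)" for g :: "nat \<Rightarrow> nat \<Rightarrow> real"
  have star: "star g \<in> SLZ ?N \<and> transpose_mat (mt ?N g) * mt ?N (star g) = 1\<^sub>m ?N" if g: "g \<in> SLZ ?N" for g
  proof -
    obtain h where "h \<in> SLZ ?N" "mt ?N (\<lambda>i j. g j i) * mt ?N h = 1\<^sub>m ?N" using SLZ_inverse[OF SLZ_transpose[OF g]] by blast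
    then have "\<exists>h. h \<in> SLZ ?N \<and> transpose_mat (mt ?N g) * mt ?N h = 1\<^sub>m ?N" by (auto simp: mt_transpose)
    then show ?thesis unfolding star_def by (rule someI_ex)
  qed
  have star_surj: "\<exists>g\<in>SLZ ?N. act ?N P (star g) = act ?N P h" if h: "h \<in> SLZ ?N" for h
  proof -
    obtain h' where h': "h' \<in> SLZ ?N" "mt ?N h * mt ?N h' = 1\<^sub>m ?N" "mt ?N h' * mt ?N h = 1\<^sub>m ?N" using SLZ_inverse[OF h] by blast
    define g where "g i j = h' j i" for i j
    have g: "g \<in> SLZ ?N" unfolding g_def by (rule SLZ_transpose[OF h'(1)])
    have "transpose_mat (mt ?N g) = mt ?N h'" by (simp add: mt_transpose g_def)
    then have "mt ?N h' * mt ?N (star g) = 1\<^sub>m ?N" using star[OF g] by simp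
    with h'(2) have "mt ?N (star g) = mt ?N h" by (rule inverse_unique)
    then show ?thesis using g act_cong by blast
  qed
  have img: "(\<lambda>g. act ?N P (star g) 0 0) ` SLZ ?N = (\<lambda>h. act ?N P h 0 0) ` SLZ ?N"
  proof (intro subset_antisym image_subsetI)
    fix g assume "g \<in> SLZ ?N"
    then show "act ?N P (star g) 0 0 \<in> (\<lambda>h. act ?N P h 0 0) ` SLZ ?N" using star by blast
  next
    fix h assume "h \<in> SLZ ?N"
    then obtain g where g: "g \<in> SLZ ?N" "act ?N P (star g) = act ?N P h" using star_surj by blast
    show "act ?N P h 0 0 \<in> (\<lambda>g. act ?N P (star g) 0 0) ` SLZ ?N"
      by (rule image_eqI[OF _ g(1)]) (simp only: g(2))
  qed
  obtain c where c: "0 < c" "\<And>h. h \<in> SLZ ?N \<Longrightarrow> c \<le> act ?N P h 0 0"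
    using act_diag_bounded_below[OF P(1) k0] by auto
  have dual: "pdist ?N (act ?N Q g) (rayn n t) = pdist ?N (act ?N P (star g)) (Dk n 0 t)" if g: "g \<in> SLZ ?N" for g t
  proof (rule pdist_dual)
    show "pd ?N (act ?N Q g)" by (rule pd_act_det[OF Q SLZ_det[OF g]])
    show "mt ?N (act ?N Q g) * mt ?N (act ?N P (star g)) = 1\<^sub>m ?N"
      by (rule inverse_congruence[OF _ QP]) (use star[OF g] in blast)
  qed (rule pd_rayn rayn_Dk)+
  have PA: "pd ?N (act ?N P (star g))" "detN ?N (act ?N P (star g)) = 1" if g: "g \<in> SLZ ?N" for g
  proof -
    have sg: "star g \<in> SLZ ?N" using star[OF g] by blast
    show "pd ?N (act ?N P (star g))" "detN ?N (act ?N P (star g)) = 1"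
      using pd_act_det[OF P(1) SLZ_det[OF sg]] SLZ_det[OF sg] P(2) by (simp_all only: detN_act power_one mult_1)
  qed
  have "busemann ?N (rayn n) (pr ?N Q) = ray_eta n * ln (INF g\<in>SLZ ?N. act ?N P (star g) 0 0)"
  proof (rule busemann_eq[OF Q pd_rayn _ c(1) _ ray_constants(3)[OF n]])
    show "rayn n t i j = 0" if "\<not> (i < ?N \<and> j < ?N)" for t i j using that by (auto simp: rayn_def diagm_def)
    show "c \<le> act ?N P (star g) 0 0" if "g \<in> SLZ ?N" for g using c(2) star[OF that] by blast
    show "t + ray_eta n * ln (act ?N P (star g) 0 0) \<le> pdist ?N (act ?N Q g) (rayn n t)" if g: "g \<in> SLZ ?N" for g t
      unfolding dual[OF g] by (rule ray_dist_lower[OF n k0 PA[OF g]])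
    show "\<forall>\<^sub>F t in at_top. pdist ?N (act ?N Q g) (rayn n t) \<le> t + ray_eta n * ln (act ?N P (star g) 0 0 + \<delta>) + \<delta>"
      if g: "g \<in> SLZ ?N" and "0 < \<delta>" for g \<delta>
      unfolding dual[OF g] by (rule ray_dist_upper[OF n k0 PA[OF g] \<open>0 < \<delta>\<close>])
  qed
  then show ?thesis unfolding lattice_min_def img .
qed

section \<open>Unipotent orbits as Diophantine conditions\<close>

lemma detN_upper_triangular:
  fixes A :: "nat \<Rightarrow> nat \<Rightarrow> real"
  assumes "\<And>i j. j < i \<Longrightarrow> i < N \<Longrightarrow> A i j = 0" "\<And>i. i < N \<Longrightarrow> A i i = 1"
  shows "detN N A = 1"
proof -
  have "Determinant.det (mt N A) = prod_list (diag_mat (mt N A))"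
    by (rule det_upper_triangular[of _ N]) (use assms in \<open>auto simp: mt_def upper_triangular_def\<close>)
  also have "diag_mat (mt N A) = map (\<lambda>_. 1) [0..<N]" using assms(2) by (auto simp: diag_mat_def mt_def)
  also have "prod_list (map (\<lambda>_. 1 :: real) [0..<N]) = 1" by (induction N) auto
  finally show ?thesis by (simp add: detN_eq_det)
qed

lemma detN_rayn:
  assumes "1 \<le> n"
  shows "detN (n+1) (rayn n t) = 1"
proof -
  have "Determinant.det (mt (n+1) (rayn n t)) * Determinant.det (mt (n+1) (Dk n 0 t)) = 1"
    using rayn_Dk[of n t] by (simp add: det_mult[OF mt_carrier mt_carrier, symmetric])
  then show ?thesis using detN_Dk[OF assms, of 0 t] by (simp add: detN_eq_det)
qed

text \<open>The form along the orbit after removal of the factor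
  \<open>exp (- (ray_a n * t))\<close>; \<Theta> is the ratio of the two scales. The bound forces
  the norm of \<open>q\<close> to be at most the root of \<open>E\<close>, and the linear form at
  most the root of \<open>E / \<Theta>\<close>.\<close>

definition approx_vector :: "nat \<Rightarrow> (nat \<Rightarrow> real) \<Rightarrow> real \<Rightarrow> real \<Rightarrow> bool" where
  "approx_vector n x \<Theta> E \<longleftrightarrow> (\<exists>(p :: int) (q :: nat \<Rightarrow> int). (p \<noteq> 0 \<or> (\<exists>i<n. q i \<noteq> 0)) \<and>
     (\<Sum>i<n. (of_int (q i))\<^sup>2) + \<Theta> * (of_int p + (\<Sum>i<n. of_int (q i) * x i))\<^sup>2 \<le> E)"

text \<open>The first row of \<open>Ucn n x\<close> evaluates the linear form, so an integer vector
  \<open>v\<close> has \<open>p = v 0\<close> and \<open>q i = v (Suc i)\<close>. The ratio of the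
  scales is \<open>exp (ray_eta n * t)\<close> since
  \<open>ray_eta n = ray_a n + ray_b n\<close>.\<close>

lemma rayn_orbit_min:
  fixes n :: nat and x :: "nat \<Rightarrow> real" and t E :: real
  assumes n: "1 \<le> n"
  defines "Q \<equiv> \<lambda>t. act (n+1) (rayn n t) (Ucn n x)"
  shows "0 < lattice_min (n+1) (Q t) n"
    and "busemann (n+1) (ray1 n) (pr (n+1) (Q t)) = ray_eta n * ln (lattice_min (n+1) (Q t) n)"
    and "0 < E \<Longrightarrow> lattice_min (n+1) (Q t) n \<le> exp (- (ray_a n * t)) * E \<Longrightarrow> approx_vector n x (exp (ray_eta n * t)) (2 * E)"
    and "approx_vector n x (exp (ray_eta n * t)) E \<Longrightarrow> lattice_min (n+1) (Q t) n \<le> exp (- (ray_a n * t)) * E"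
proof -
  have nk: "n < n + 1" and N2: "2 \<le> n + 1" using n by auto
  have dU: "detN (n+1) (Ucn n x) = 1" by (rule detN_upper_triangular) (auto simp: Ucn_def)
  have Q: "pd (n+1) (Q t)" unfolding Q_def by (rule pd_act_det[OF pd_rayn dU])
  have dQ: "detN (n+1) (Q t) = 1" unfolding Q_def by (simp only: detN_act dU detN_rayn[OF n] power_one mult_1)
  show "0 < lattice_min (n+1) (Q t) n" by (rule lattice_min_pos[OF Q nk])
  show "busemann (n+1) (ray1 n) (pr (n+1) (Q t)) = ray_eta n * ln (lattice_min (n+1) (Q t) n)" by (rule busemann_ray1[OF n Q dQ])
  have form: "bil (n+1) (Q t) v v = exp (- (ray_a n * t)) * ((\<Sum>i<n. (v (Suc i))\<^sup>2) + exp (ray_eta n * t) * (v 0 + (\<Sum>i<n. v (Suc i) * x i))\<^sup>2)" for v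
  proof -
    have sym: "\<forall>i<n+1. \<forall>j<n+1. rayn n t i j = rayn n t j i" by (auto simp: rayn_def diagm_def)
    define u where "u k = (\<Sum>i<n+1. v i * Ucn n x k i)" for k
    have u0: "u 0 = v 0 + (\<Sum>i<n. v (Suc i) * x i)"
      unfolding u_def Suc_eq_plus1[symmetric] sum.lessThan_Suc_shift by (simp add: Ucn_def)
    have uS: "u (Suc k) = v (Suc k)" if "k < n" for k
    proof -
      have "u (Suc k) = (\<Sum>i<n+1. if i = Suc k then v (Suc k) else 0)"
        unfolding u_def using that by (intro sum.cong) (auto simp: Ucn_def)
      then show ?thesis using that by simp
    qed
    have "bil (n+1) (Q t) v v = bil (n+1) (rayn n t) u u" unfolding Q_def u_def by (rule bil_act[OF sym])
    also have "\<dots> = (\<Sum>i<Suc n. (if i = 0 then exp (t * ray_b n) else exp (- (ray_a n * t))) * (u i)\<^sup>2)"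
      unfolding rayn_def bil_diagm by (intro sum.cong) (auto simp: ray_a_def ray_b_def)
    also have "\<dots> = exp (t * ray_b n) * (u 0)\<^sup>2 + exp (- (ray_a n * t)) * (\<Sum>i<n. (u (Suc i))\<^sup>2)"
      unfolding sum.lessThan_Suc_shift by (simp add: sum_distrib_left)
    also have "(\<Sum>i<n. (u (Suc i))\<^sup>2) = (\<Sum>i<n. (v (Suc i))\<^sup>2)" using uS by (intro sum.cong) auto
    also have "exp (t * ray_b n) = exp (- (ray_a n * t)) * exp (ray_eta n * t)"
      unfolding exp_add[symmetric] ray_constants(5)[OF n] by (simp add: algebra_simps)
    finally show ?thesis by (simp add: u0 algebra_simps)
  qed
  show "approx_vector n x (exp (ray_eta n * t)) (2 * E)" if E: "0 < E" and le: "lattice_min (n+1) (Q t) n \<le> exp (- (ray_a n * t)) * E"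
  proof -
    obtain v :: "nat \<Rightarrow> int" where v: "\<exists>i<n+1. v i \<noteq> 0"
      "bil (n+1) (Q t) (\<lambda>i. of_int (v i)) (\<lambda>i. of_int (v i)) \<le> 2 * (exp (- (ray_a n * t)) * E)"
      using lattice_min_vector[OF Q nk _ le] E by auto
    have "exp (- (ray_a n * t)) * ((\<Sum>i<n. (of_int (v (Suc i)))\<^sup>2) + exp (ray_eta n * t) * (of_int (v 0) + (\<Sum>i<n. of_int (v (Suc i)) * x i))\<^sup>2) \<le> exp (- (ray_a n * t)) * (2 * E)"
      using v(2) unfolding form by (simp add: mult.left_commute)
    then have "(\<Sum>i<n. (real_of_int (v (Suc i)))\<^sup>2) + exp (ray_eta n * t) * (of_int (v 0) + (\<Sum>i<n. of_int (v (Suc i)) * x i))\<^sup>2 \<le> 2 * E" by simp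
    moreover have "v 0 \<noteq> 0 \<or> (\<exists>i<n. v (Suc i) \<noteq> 0)" using v(1) by (metis Suc_eq_plus1 Suc_less_eq not0_implies_Suc)
    ultimately show ?thesis unfolding approx_vector_def by (intro exI[of _ "v 0"] exI[of _ "\<lambda>i. v (Suc i)"]) simp
  qed
  show "lattice_min (n+1) (Q t) n \<le> exp (- (ray_a n * t)) * E" if "approx_vector n x (exp (ray_eta n * t)) E"
  proof -
    obtain p q where pq: "p \<noteq> 0 \<or> (\<exists>i<n. q i \<noteq> 0)"
      "(\<Sum>i<n. (real_of_int (q i))\<^sup>2) + exp (ray_eta n * t) * (of_int p + (\<Sum>i<n. of_int (q i) * x i))\<^sup>2 \<le> E"
      using \<open>approx_vector n x _ E\<close> unfolding approx_vector_def by blast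
    define v where "v i = (case i of 0 \<Rightarrow> p | Suc j \<Rightarrow> q j)" for i
    have "\<exists>i<n+1. v i \<noteq> 0"
    proof (cases "p = 0")
      case True
      then obtain i where "i < n" "q i \<noteq> 0" using pq(1) by blast
      then show ?thesis by (intro exI[of _ "Suc i"]) (simp add: v_def)
    next
      case False then show ?thesis by (intro exI[of _ 0]) (simp add: v_def)
    qed
    note le = lattice_min_le[OF Q N2 nk this, unfolded form]
    show ?thesis
      by (rule order_trans[OF le mult_left_mono]) (use pq(2) in \<open>simp_all add: v_def\<close>)
  qed
qed

text \<open>Here the Busemann function sees the inverse form. The inverse transpose of
  \<open>U1 n x\<close> carries \<open>- x\<close> in its last row, so the same quadratic expression
  arises with \<open>p = - v n\<close>, and both sets lead to one Diophantine problem. The minimum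
  \<open>m\<close> is existential because the inverse form is constructed inside the proof.\<close>

lemma ray1_orbit_min:
  fixes n :: nat and x :: "nat \<Rightarrow> real" and t :: real
  assumes n: "1 \<le> n"
  defines "Q \<equiv> \<lambda>t. act (n+1) (ray1 n t) (U1 n x)"
  shows "\<exists>m. 0 < m \<and> busemann (n+1) (rayn n) (pr (n+1) (Q t)) = ray_eta n * ln m \<and>
     (\<forall>E. 0 < E \<longrightarrow> m \<le> exp (- (ray_a n * t)) * E \<longrightarrow> approx_vector n x (exp (ray_eta n * t)) (2 * E)) \<and>
     (\<forall>E. approx_vector n x (exp (ray_eta n * t)) E \<longrightarrow> m \<le> exp (- (ray_a n * t)) * E)"
proof -
  have k0: "0 < n + 1" and N2: "2 \<le> n + 1" using n by auto
  let ?N = "n + 1"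
  define V where "V i j = (if i = j then 1 else if i = n then - x j else 0)" for i j
  define F where "F = diagm ?N (\<lambda>i. if i = n then exp (ray_b n * t) else exp (- (ray_a n * t)))"
  define P where "P = act ?N F V"
  let ?U = "mt ?N (U1 n x)" and ?V = "mt ?N V" and ?D = "mt ?N (ray1 n t)" and ?F = "mt ?N F"
  have dU: "detN ?N (U1 n x) = 1" by (rule detN_upper_triangular) (auto simp: U1_def)
  have Q: "pd ?N (Q t)" unfolding Q_def by (rule pd_act_det[OF _ dU]) (simp add: ray1_eq_Dk pd_Dk[simplified])
  have UV: "?U * transpose_mat ?V = 1\<^sub>m ?N"
    unfolding mt_transpose mt_mult mt_one
  proof (rule mt_cong)
    fix i j assume ij: "i < ?N" "j < ?N"
    have "(\<Sum>k<?N. U1 n x i k * V j k) = (\<Sum>k<?N. (if k = i then V j i else 0) + (if k = n then (if i = n then 0 else x i * V j n) else 0))"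
      using ij by (intro sum.cong) (auto simp: U1_def)
    also have "\<dots> = V j i + (if i = n then 0 else x i * V j n)" using ij by (simp add: sum.distrib)
    also have "\<dots> = (if i = j then 1 else 0)" by (auto simp: V_def)
    finally show "(\<Sum>k<?N. U1 n x i k * V j k) = (if i = j then 1 else 0)" .
  qed
  have dV: "detN ?N V = 1"
  proof -
    have "Determinant.det ?U * Determinant.det (transpose_mat ?V) = 1"
      using UV det_mult[of ?U ?N "transpose_mat ?V"] by simp
    then show ?thesis using dU by (simp add: detN_eq_det det_transpose[OF mt_carrier])
  qed
  have DF: "?D * ?F = 1\<^sub>m ?N"
    unfolding ray1_def F_def by (rule mt_diagm_mult) (auto simp: exp_add[symmetric] ray_a_def ray_b_def mult.commute)
  have dF: "detN ?N F = 1"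
  proof -
    have "Determinant.det ?D * Determinant.det ?F = 1"
      using DF by (simp add: det_mult[OF mt_carrier mt_carrier, symmetric])
    then show ?thesis using detN_Dk[OF n, of n t] by (simp add: ray1_eq_Dk detN_eq_det)
  qed
  have pF: "pd ?N F" unfolding F_def by (rule pd_diagm) auto
  have P: "pd ?N P" unfolding P_def by (rule pd_act_det[OF pF dV])
  have dP: "detN ?N P = 1" unfolding P_def by (simp only: detN_act dV dF power_one mult_1)
  have QP: "mt ?N (Q t) * mt ?N P = 1\<^sub>m ?N"
  proof -
    have "transpose_mat ?V * ?U = 1\<^sub>m ?N" by (rule mat_mult_left_right_inverse[OF _ _ UV]) simp_all
    from arg_cong[OF this, of transpose_mat] have UtV: "transpose_mat ?U * ?V = 1\<^sub>m ?N"
      by (simp only: transpose_mult[OF transpose_carrier_mat[THEN iffD2, OF mt_carrier] mt_carrier] Matrix.transpose_transpose transpose_one)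
    show ?thesis unfolding Q_def P_def by (rule inverse_congruence[OF UtV DF])
  qed
  have form: "bil ?N P v v = exp (- (ray_a n * t)) * ((\<Sum>i<n. (v i)\<^sup>2) + exp (ray_eta n * t) * (- v n + (\<Sum>i<n. v i * x i))\<^sup>2)" for v
  proof -
    have sym: "\<forall>i<?N. \<forall>j<?N. F i j = F j i" by (auto simp: F_def diagm_def)
    define u where "u k = (\<Sum>i<?N. v i * V k i)" for k
    have un: "u n = v n - (\<Sum>i<n. v i * x i)"
      unfolding u_def Suc_eq_plus1[symmetric] sum.lessThan_Suc by (simp add: V_def sum_negf)
    have ui: "u k = v k" if "k < n" for k
    proof -
      have "u k = (\<Sum>i<?N. if i = k then v k else 0)"
        unfolding u_def using that by (intro sum.cong) (auto simp: V_def)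
      then show ?thesis using that by simp
    qed
    have "bil ?N P v v = bil ?N F u u" unfolding P_def u_def by (rule bil_act[OF sym])
    also have "\<dots> = (\<Sum>i<Suc n. (if i = n then exp (ray_b n * t) else exp (- (ray_a n * t))) * (u i)\<^sup>2)"
      unfolding F_def bil_diagm by simp
    also have "\<dots> = exp (ray_b n * t) * (u n)\<^sup>2 + exp (- (ray_a n * t)) * (\<Sum>i<n. (u i)\<^sup>2)"
      unfolding sum.lessThan_Suc by (simp add: sum_distrib_left)
    also have "(\<Sum>i<n. (u i)\<^sup>2) = (\<Sum>i<n. (v i)\<^sup>2)" using ui by (intro sum.cong) auto
    also have "(u n)\<^sup>2 = (- v n + (\<Sum>i<n. v i * x i))\<^sup>2" unfolding un by (simp add: power2_commute)
    also have "exp (ray_b n * t) = exp (- (ray_a n * t)) * exp (ray_eta n * t)"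
      unfolding exp_add[symmetric] ray_constants(5)[OF n] by (simp add: algebra_simps)
    finally show ?thesis by (simp add: algebra_simps)
  qed
  let ?m = "lattice_min ?N P 0"
  show ?thesis
  proof (intro exI[of _ ?m] conjI allI impI)
    show "0 < ?m" by (rule lattice_min_pos[OF P k0])
    show "busemann ?N (rayn n) (pr ?N (Q t)) = ray_eta n * ln ?m" by (rule busemann_rayn[OF n Q P dP QP])
  next
    fix E assume E: "0 < E" and le: "?m \<le> exp (- (ray_a n * t)) * E"
    obtain v :: "nat \<Rightarrow> int" where v: "\<exists>i<?N. v i \<noteq> 0"
      "bil ?N P (\<lambda>i. of_int (v i)) (\<lambda>i. of_int (v i)) \<le> 2 * (exp (- (ray_a n * t)) * E)"
      using lattice_min_vector[OF P k0 _ le] E by auto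
    have "exp (- (ray_a n * t)) * ((\<Sum>i<n. (of_int (v i))\<^sup>2) + exp (ray_eta n * t) * (- of_int (v n) + (\<Sum>i<n. of_int (v i) * x i))\<^sup>2) \<le> exp (- (ray_a n * t)) * (2 * E)"
      using v(2) unfolding form by (simp add: mult.left_commute)
    then have "(\<Sum>i<n. (real_of_int (v i))\<^sup>2) + exp (ray_eta n * t) * (of_int (- v n) + (\<Sum>i<n. of_int (v i) * x i))\<^sup>2 \<le> 2 * E" by simp
    moreover have "- v n \<noteq> 0 \<or> (\<exists>i<n. v i \<noteq> 0)" using v(1) by (auto simp: less_Suc_eq)
    ultimately show "approx_vector n x (exp (ray_eta n * t)) (2 * E)"
      unfolding approx_vector_def by (intro exI[of _ "- v n"] exI[of _ v]) simp
  next
    fix E assume "approx_vector n x (exp (ray_eta n * t)) E"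
    then obtain p q where pq: "p \<noteq> 0 \<or> (\<exists>i<n. q i \<noteq> 0)"
      "(\<Sum>i<n. (real_of_int (q i))\<^sup>2) + exp (ray_eta n * t) * (of_int p + (\<Sum>i<n. of_int (q i) * x i))\<^sup>2 \<le> E"
      unfolding approx_vector_def by blast
    define v where "v i = (if i < n then q i else - p)" for i
    have "\<exists>i<?N. v i \<noteq> 0"
    proof (cases "p = 0")
      case True
      then obtain i where "i < n" "q i \<noteq> 0" using pq(1) by blast
      then show ?thesis by (intro exI[of _ i]) (simp add: v_def)
    next
      case False then show ?thesis by (intro exI[of _ n]) (simp add: v_def)
    qed
    note le = lattice_min_le[OF P N2 k0 this, unfolded form]
    show "?m \<le> exp (- (ray_a n * t)) * E"
      by (rule order_trans[OF le mult_left_mono]) (use pq(2) in \<open>simp_all add: v_def\<close>)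
  qed
qed

section \<open>The zero-infinity law\<close>

lemma sum_blocks:
  fixes F :: "nat \<Rightarrow> real"
  assumes "2 \<le> B"
  shows "(\<Sum>m<M. \<Sum>k\<in>{B ^ m..<B ^ Suc m}. F k) = (\<Sum>k\<in>{1..<B ^ M}. F k)"
proof (induction M)
  case (Suc M)
  have "1 \<le> B ^ M" "B ^ M \<le> B ^ Suc M" using assms by (auto intro: power_increasing)
  then have "(\<Sum>k\<in>{1..<B ^ M}. F k) + (\<Sum>k\<in>{B ^ M..<B ^ Suc M}. F k) = (\<Sum>k\<in>{1..<B ^ Suc M}. F k)"
    by (rule sum.atLeastLessThan_concat)
  then show ?case using Suc by simp
qed simp

text \<open>Mere grouping of a nonnegative series; monotonicity enters only afterwards, when each
  block is compared with a single term.\<close>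

lemma summable_blocks_iff:
  fixes F :: "nat \<Rightarrow> real"
  assumes B: "2 \<le> B" and nn: "\<And>k. 0 \<le> F k"
  shows "summable F \<longleftrightarrow> summable (\<lambda>m. \<Sum>k\<in>{B ^ m..<B ^ Suc m}. F k)"
proof
  assume F: "summable F"
  show "summable (\<lambda>m. \<Sum>k\<in>{B ^ m..<B ^ Suc m}. F k)"
  proof (rule summableI_nonneg_bounded)
    show "(\<Sum>m<M. \<Sum>k\<in>{B ^ m..<B ^ Suc m}. F k) \<le> suminf F" for M
      unfolding sum_blocks[OF B] by (rule sum_le_suminf[OF F]) (use nn in auto)
  qed (rule sum_nonneg[OF nn])
next
  assume S: "summable (\<lambda>m. \<Sum>k\<in>{B ^ m..<B ^ Suc m}. F k)"
  show "summable F"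
  proof (rule summableI_nonneg_bounded)
    fix N
    have "N < B ^ N" by (rule less_le_trans[OF less_exp power_mono[OF B]]) simp
    then have "(\<Sum>k<N. F k) \<le> (\<Sum>k\<in>insert 0 {1..<B ^ N}. F k)"
      by (intro sum_mono2) (use nn in auto)
    also have "\<dots> = F 0 + (\<Sum>m<N. \<Sum>k\<in>{B ^ m..<B ^ Suc m}. F k)" by (subst sum_blocks[OF B]) simp
    also have "\<dots> \<le> F 0 + (\<Sum>m. \<Sum>k\<in>{B ^ m..<B ^ Suc m}. F k)"
      by (intro add_left_mono sum_le_suminf[OF S]) (auto intro: sum_nonneg nn)
    finally show "(\<Sum>k<N. F k) \<le> F 0 + (\<Sum>m. \<Sum>k\<in>{B ^ m..<B ^ Suc m}. F k)" .
  qed (rule nn)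
qed

text \<open>Here \<phi> is replaced by a rate \<theta> in the height \<open>k\<close>: solutions
  have \<open>q\<close> of size at most of order \<open>k\<close> and linear form at most of order
  \<open>k * \<theta> k\<close>. \<open>mono\<close> encodes the hypothesis on \<eta>^2 id - \<phi>,
  and \<open>k0\<close> is a height from which the inverse of \<phi> is available. The factor 2 in
  \<open>upper\<close> is the loss from approximating an infimum.\<close>

locale approximation_rate =
  fixes d :: nat and \<theta> :: "real \<Rightarrow> real" and k0 \<sigma> :: real and A :: "(nat \<Rightarrow> real) set"
  assumes k0: "1 \<le> k0" and \<sigma>: "0 < \<sigma>" "\<sigma> < 1" and \<theta>pos: "\<And>k. k0 \<le> k \<Longrightarrow> 0 < \<theta> k"
    and mono: "\<And>k l. k0 \<le> k \<Longrightarrow> k \<le> l \<Longrightarrow> l * \<theta> l \<le> k * \<theta> k"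
    and ARn: "A \<subseteq> Rn (Suc d)"
    and upper: "\<And>x K. x \<in> A \<Longrightarrow> \<exists>k\<ge>K. k0 \<le> k \<and> approx_vector (Suc d) x (1 / (\<theta> k)\<^sup>2) (2 * k\<^sup>2)"
    and lower: "\<And>x. x \<in> Rn (Suc d) \<Longrightarrow> (\<And>K. \<exists>k\<ge>K. k0 \<le> k \<and> approx_vector (Suc d) x (1 / (\<theta> k)\<^sup>2) (k\<^sup>2)) \<Longrightarrow> x \<in> A"
begin

lemma \<theta>_mono: "k0 \<le> k \<Longrightarrow> k \<le> l \<Longrightarrow> \<theta> l \<le> \<theta> k"
proof -
  assume k: "k0 \<le> k" "k \<le> l"
  have "l * \<theta> l \<le> k * \<theta> k" by (rule mono[OF k])
  also have "\<dots> \<le> l * \<theta> k" using k \<theta>pos[of k] by (intro mult_right_mono) auto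
  finally show ?thesis using k k0 by simp
qed

abbreviation F :: "nat \<Rightarrow> real" where "F k \<equiv> real k ^ Suc d * \<theta> (real k) powr \<sigma>"

lemma F_nonneg: "0 \<le> F k"
  by simp

lemma measure_zero:
  assumes F: "summable F"
  shows "hausdorff_measure (distn (Suc d)) (\<sigma> + d) A = 0"
proof -
  obtain m0 :: nat where m0: "k0 \<le> 2 ^ m0" using real_arch_pow[of 2 k0] by (auto intro: less_imp_le)
  have big: "k0 \<le> 2 ^ m" if "m0 \<le> m" for m
    by (rule order_trans[OF m0 power_increasing[OF that]]) simp
  \<comment> \<open>\<theta> is controlled only from \<open>k0\<close> on, so the finitely many
    first widths are frozen.\<close>
  define h where "h m = \<theta> (2 ^ max m m0)" for m
  have sblock: "summable (\<lambda>m. \<Sum>k\<in>{2 ^ m..<2 ^ Suc m}. F k)"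
    using F summable_blocks_iff[of 2 F] F_nonneg by simp
  have lb: "(2 ^ Suc m) ^ (d+2) * \<theta> (2 ^ Suc m) powr \<sigma> \<le> 2 ^ (d+2) * (\<Sum>k\<in>{2 ^ m..<2 ^ Suc m}. F k)" if m: "m0 \<le> m" for m
  proof -
    have "(\<Sum>k\<in>{2 ^ m..<2 ^ Suc m :: nat}. (2 ^ m) ^ Suc d * \<theta> (2 ^ Suc m) powr \<sigma>) \<le> (\<Sum>k\<in>{2 ^ m..<2 ^ Suc m}. F k)"
    proof (intro sum_mono mult_mono power_mono powr_mono2)
      fix k :: nat assume k: "k \<in> {2 ^ m..<2 ^ Suc m}"
      then have "real (2 ^ m) \<le> real k" "real k \<le> real (2 ^ Suc m)" by (simp_all only: of_nat_le_iff atLeastLessThan_iff less_imp_le)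
      then have k': "2 ^ m \<le> real k" "real k \<le> 2 ^ Suc m" by simp_all
      show "(2::real) ^ m \<le> real k" by (rule k')
      show "\<theta> (2 ^ Suc m) \<le> \<theta> (real k)" by (rule \<theta>_mono[OF order_trans[OF big[OF m] k'(1)] k'(2)])
      show "0 \<le> \<theta> (2 ^ Suc m)" using \<theta>pos[of "2 ^ Suc m"] big[of "Suc m"] m by simp
    qed (use \<sigma> in auto)
    then have "2 ^ m * ((2 ^ m) ^ Suc d * \<theta> (2 ^ Suc m) powr \<sigma>) \<le> (\<Sum>k\<in>{2 ^ m..<2 ^ Suc m}. F k)" by simp
    then have "2 ^ (d+2) * (2 ^ m * ((2 ^ m) ^ Suc d * \<theta> (2 ^ Suc m) powr \<sigma>)) \<le> 2 ^ (d+2) * (\<Sum>k\<in>{2 ^ m..<2 ^ Suc m}. F k)"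
      by (intro mult_left_mono) auto
    moreover have "2 ^ (d+2) * (2 ^ m * ((2 ^ m) ^ Suc d * \<theta> (2 ^ Suc m) powr \<sigma>)) = (2 ^ Suc m) ^ (d+2) * \<theta> (2 ^ Suc m) powr \<sigma>"
      by (simp add: power_mult_distrib mult_ac)
    ultimately show ?thesis by simp
  qed
  have sumh: "summable (\<lambda>m. (2 ^ m) ^ (d+2) * h m powr \<sigma>)"
  proof -
    have "summable (\<lambda>m. (2 ^ Suc m) ^ (d+2) * h (Suc m) powr \<sigma>)"
    proof (rule summable_comparison_test'[OF summable_mult[OF sblock, of "2 ^ (d+2)"]])
      fix m assume m: "m0 \<le> m"
      then have "max (Suc m) m0 = Suc m" by simp
      then show "norm ((2 ^ Suc m) ^ (d+2) * h (Suc m) powr \<sigma>) \<le> 2 ^ (d+2) * (\<Sum>k\<in>{2 ^ m..<2 ^ Suc m}. F k)"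
        using lb[OF m] by (simp add: h_def)
    qed
    then show ?thesis by (subst (asm) summable_Suc_iff)
  qed
  show ?thesis
  proof (rule hausdorff_measure_zero[where h = h, OF \<sigma> _ sumh ARn])
    show "0 < h m" for m unfolding h_def using big[of "max m m0"] by (intro \<theta>pos) simp
  next
    fix x M assume x: "x \<in> A"
    obtain k where k: "2 ^ max M m0 \<le> k" "k0 \<le> k" "approx_vector (Suc d) x (1 / (\<theta> k)\<^sup>2) (2 * k\<^sup>2)"
      using upper[OF x] by blast
    then obtain p q where pq: "p \<noteq> 0 \<or> (\<exists>i<Suc d. q i \<noteq> 0)"
      "(\<Sum>i<Suc d. (real_of_int (q i))\<^sup>2) + 1 / (\<theta> k)\<^sup>2 * (of_int p + (\<Sum>i<Suc d. of_int (q i) * x i))\<^sup>2 \<le> 2 * k\<^sup>2"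
      unfolding approx_vector_def by blast
    \<comment> \<open>The integer part places \<open>k\<close> in a dyadic block
      \<open>2 ^ m \<le> k < 2 ^ (m + 1)\<close>. The upper end bounds \<open>q\<close>; the lower
      end bounds the linear form, as \<open>k * \<theta> k\<close> is nonincreasing.\<close>
    define f where "f = nat \<lfloor>k\<rfloor>"
    have k1: "1 \<le> k" using k(2) k0 by simp
    then have f: "real f \<le> k" "k < real f + 1" "1 \<le> f" unfolding f_def by linarith+
    obtain m where m: "2 ^ m \<le> f" "f < 2 ^ (m + 1)" using ex_power_ivl1[of 2 f] f(3) by auto
    have "real (2 ^ m) \<le> real f" using m(1) by (simp only: of_nat_le_iff)
    from order_trans[OF this f(1)] have mk: "2 ^ m \<le> k" by (simp only: of_nat_power of_nat_numeral)
    have "real (f + 1) \<le> real (2 ^ (m + 1))" using m(2) by (simp only: of_nat_le_iff)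
    then have km: "k < 2 ^ (m + 1)" using f(2) by simp
    have "(2::real) ^ max M m0 < 2 ^ (m + 1)" using k(1) km by simp
    then have "max M m0 < m + 1" by (rule power_less_imp_less_exp[rotated]) simp
    then have mM: "M \<le> m" "m0 \<le> m" by auto
    have \<theta>k: "0 < \<theta> k" by (rule \<theta>pos[OF k(2)])
    have nn: "0 \<le> (\<Sum>i<Suc d. (real_of_int (q i))\<^sup>2)" "0 \<le> 1 / (\<theta> k)\<^sup>2 * (of_int p + (\<Sum>i<Suc d. of_int (q i) * x i))\<^sup>2"
      by (rule sum_nonneg, simp, simp)
    have two: "2 * k\<^sup>2 \<le> (2 * k)\<^sup>2" by (simp add: power_mult_distrib)
    show "\<exists>m\<ge>M. \<exists>(p :: int) (q :: nat \<Rightarrow> int). (p \<noteq> 0 \<or> (\<exists>i<Suc d. q i \<noteq> 0)) \<and>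
        (\<forall>i<Suc d. \<bar>q i\<bar> \<le> 4 * 2 ^ m) \<and> \<bar>of_int p + (\<Sum>i<Suc d. of_int (q i) * x i)\<bar> \<le> 2 * 2 ^ m * h m"
    proof (intro exI[of _ m] exI[of _ p] exI[of _ q] conjI allI impI)
      show "M \<le> m" by (rule mM)
      show "p \<noteq> 0 \<or> (\<exists>i<Suc d. q i \<noteq> 0)" by (rule pq(1))
    next
      fix i assume i: "i < Suc d"
      have "(real_of_int (q i))\<^sup>2 \<le> (\<Sum>i<Suc d. (real_of_int (q i))\<^sup>2)" by (rule member_le_sum) (use i in auto)
      then have "(real_of_int (q i))\<^sup>2 \<le> (2 * k)\<^sup>2" using pq(2) nn(2) two by linarith
      then have "\<bar>real_of_int (q i)\<bar> \<le> 2 * k" using k1 abs_le_square_iff[of "real_of_int (q i)" "2 * k"] by simp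
      also have "\<dots> \<le> 4 * 2 ^ m" using km by simp
      finally have "real_of_int \<bar>q i\<bar> \<le> real_of_int (4 * 2 ^ m)" by simp
      then show "\<bar>q i\<bar> \<le> 4 * 2 ^ m" by (simp only: of_int_le_iff)
    next
      let ?z = "of_int p + (\<Sum>i<Suc d. of_int (q i) * x i)"
      have "1 / (\<theta> k)\<^sup>2 * ?z\<^sup>2 \<le> (2 * k)\<^sup>2" using pq(2) nn(1) two by linarith
      then have "?z\<^sup>2 \<le> (2 * (k * \<theta> k))\<^sup>2" using \<theta>k by (simp add: field_simps power_mult_distrib)
      then have "\<bar>?z\<bar> \<le> 2 * (k * \<theta> k)" using k1 \<theta>k abs_le_square_iff[of ?z "2 * (k * \<theta> k)"] by simp
      also have "\<dots> \<le> 2 * (2 ^ m * \<theta> (2 ^ m))" using mono[OF big[OF mM(2)] mk] by simp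
      also have "\<dots> = 2 * 2 ^ m * h m" using mM(2) by (simp add: h_def max_absorb1)
      finally show "\<bar>?z\<bar> \<le> 2 * 2 ^ m * h m" .
    qed
  qed
qed

lemma measure_infinite:
  assumes F: "\<not> summable F"
  shows "hausdorff_measure (distn (Suc d)) (\<sigma> + d) A = \<infinity>"
proof -
  \<comment> \<open>At level \<open>m\<close> the \<open>Suc d\<close> squared coefficients and the
    scaled linear form contribute at most \<open>129 ^ m\<close> squared each; the height
    \<open>?c * 129 ^ m\<close> is large enough for their sum.\<close>
  let ?c = "2 * Suc d"
  obtain m0 :: nat where m0: "k0 \<le> 129 ^ m0" using real_arch_pow[of 129 k0] by (auto intro: less_imp_le)
  have big: "k0 \<le> real ?c * 129 ^ m" if "m0 \<le> m" for m
  proof -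
    have "k0 \<le> 129 ^ m" by (rule order_trans[OF m0 power_increasing[OF that]]) simp
    also have "1 * 129 ^ m \<le> real ?c * 129 ^ m" by (intro mult_right_mono) auto
    finally show ?thesis by simp
  qed
  define \<rho> where "\<rho> m = \<theta> (real ?c * 129 ^ max m m0)" for m
  have \<rho>pos: "0 < \<rho> m" for m unfolding \<rho>_def by (intro \<theta>pos big) simp
  have \<rho>0: "\<rho> \<longlonglongrightarrow> 0"
  proof (rule tendsto_sandwich[OF _ _ tendsto_const])
    have le: "\<rho> m \<le> k0 * \<theta> k0 / 129 ^ m" for m
    proof -
      let ?l = "real ?c * 129 ^ max m m0"
      have l: "k0 \<le> ?l" by (rule big) simp
      have "(129::real) ^ m \<le> 129 ^ max m m0" by (intro power_increasing) auto
      also have "\<dots> \<le> ?l" using mult_right_mono[of 1 "real ?c" "129 ^ max m m0"] by simp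
      finally have "129 ^ m * \<theta> ?l \<le> ?l * \<theta> ?l" using \<theta>pos[OF l] by (intro mult_right_mono) auto
      also have "\<dots> \<le> k0 * \<theta> k0" by (rule mono[OF order_refl l])
      finally show ?thesis by (simp add: \<rho>_def field_simps)
    qed
    show "\<forall>\<^sub>F m in sequentially. \<rho> m \<le> k0 * \<theta> k0 / 129 ^ m" by (intro always_eventually allI le)
    show "\<forall>\<^sub>F m in sequentially. 0 \<le> \<rho> m" by (intro always_eventually allI less_imp_le \<rho>pos)
    show "(\<lambda>m. k0 * \<theta> k0 / 129 ^ m) \<longlonglongrightarrow> 0" by (intro LIMSEQ_divide_realpow_zero) simp
  qed
  have div: "\<not> summable (\<lambda>m. real (129 ^ m) ^ (d+2) * \<rho> m powr \<sigma>)"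
  proof
    assume s: "summable (\<lambda>m. real (129 ^ m) ^ (d+2) * \<rho> m powr \<sigma>)"
    \<comment> \<open>Blocks shifted by \<open>?c\<close> levels lie beyond
      \<open>?c * 129 ^ m\<close>, since \<open>?c \<le> 129 ^ ?c\<close>, so \<theta> is at most
      \<open>\<rho> m\<close> there. \<open>C\<close> collects the powers lost by the shift.\<close>
    define C where "C = 129 * (129 :: real) ^ Suc d * (129 ^ ?c) ^ (d+2)"
    have cj: "real ?c \<le> 129 ^ ?c"
    proof -
      have "?c < 2 ^ ?c" by (rule less_exp)
      also have "(2::nat) ^ ?c \<le> 129 ^ ?c" by (rule power_mono) auto
      finally have "real ?c \<le> real (129 ^ ?c)" by (simp only: of_nat_le_iff less_imp_le)
      then show ?thesis by (simp only: of_nat_power of_nat_numeral)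
    qed
    have "summable (\<lambda>m. \<Sum>k\<in>{129 ^ (m + ?c)..<129 ^ Suc (m + ?c)}. F k)"
    proof (rule summable_comparison_test'[OF summable_mult[OF s, of C]])
      fix m assume m: "m0 \<le> m"
      let ?M = "m + ?c"
      have "(\<Sum>k\<in>{129 ^ ?M..<129 ^ Suc ?M}. F k) \<le> (\<Sum>k\<in>{129 ^ ?M..<129 ^ Suc ?M :: nat}. (129 ^ Suc ?M) ^ Suc d * \<rho> m powr \<sigma>)"
      proof (intro sum_mono mult_mono power_mono powr_mono2)
        fix k :: nat assume "k \<in> {129 ^ ?M..<129 ^ Suc ?M}"
        then have "real (129 ^ ?M) \<le> real k" "real k \<le> real (129 ^ Suc ?M)" by (simp_all only: of_nat_le_iff atLeastLessThan_iff less_imp_le)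
        then have k: "129 ^ ?M \<le> real k" "real k \<le> 129 ^ Suc ?M" by (simp_all only: of_nat_power of_nat_numeral)
        show "real k \<le> 129 ^ Suc ?M" by (rule k)
        have "real ?c * 129 ^ m \<le> 129 ^ ?c * 129 ^ m" by (rule mult_right_mono[OF cj]) simp
        also have "\<dots> = 129 ^ ?M" by (simp only: power_add mult.commute)
        also have "\<dots> \<le> real k" by (rule k)
        finally have ck: "real ?c * 129 ^ m \<le> real k" .
        have mm: "max m m0 = m" using m by simp
        show "\<theta> (real k) \<le> \<rho> m" unfolding \<rho>_def mm by (rule \<theta>_mono[OF big[OF m] ck])
        show "0 \<le> \<theta> (real k)" using \<theta>pos[OF order_trans[OF big[OF m] ck]] by simp
      qed (use \<sigma> in auto)
      also have "\<dots> \<le> 129 ^ Suc ?M * ((129 ^ Suc ?M) ^ Suc d * \<rho> m powr \<sigma>)"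
      proof -
        have "card {129 ^ ?M..<129 ^ Suc ?M :: nat} \<le> 129 ^ Suc ?M" by simp
        then have "real (card {129 ^ ?M..<129 ^ Suc ?M :: nat}) \<le> real (129 ^ Suc ?M)" by (simp only: of_nat_le_iff)
        then have "real (card {129 ^ ?M..<129 ^ Suc ?M :: nat}) \<le> 129 ^ Suc ?M" by (simp only: of_nat_power of_nat_numeral)
        then show ?thesis unfolding sum_constant by (intro mult_right_mono) auto
      qed
      also have "\<dots> = C * (real (129 ^ m) ^ (d+2) * \<rho> m powr \<sigma>)"
      proof -
        have "(129::real) ^ Suc ?M * (129 ^ Suc ?M) ^ Suc d = (129 ^ Suc ?M) ^ (d+2)" by simp
        also have "\<dots> = (129 * 129 ^ ?c * 129 ^ m) ^ (d+2)" by (simp only: power_Suc power_add mult_ac)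
        also have "\<dots> = C * (129 ^ m) ^ (d+2)" by (simp only: C_def power_mult_distrib) simp
        finally show ?thesis by (simp only: mult.assoc[symmetric] of_nat_power of_nat_numeral)
      qed
      finally show "norm (\<Sum>k\<in>{129 ^ ?M..<129 ^ Suc ?M}. F k) \<le> C * (real (129 ^ m) ^ (d+2) * \<rho> m powr \<sigma>)"
        by (simp only: real_norm_def abs_of_nonneg[OF sum_nonneg[OF F_nonneg]])
    qed
    then have "summable (\<lambda>m. \<Sum>k\<in>{129 ^ m..<129 ^ Suc m}. F k)"
      by (simp only: summable_iff_shift[of "\<lambda>m. \<Sum>k\<in>{129 ^ m..<129 ^ Suc m}. F k" ?c])
    then have "summable F" using summable_blocks_iff[of 129 F] F_nonneg by simp
    then show False using F by simp
  qed
  show ?thesis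
  proof (rule hausdorff_measure_infinite[OF \<sigma> \<rho>pos \<rho>0 div])
    fix x assume x: "x \<in> Rn (Suc d)" and ap: "\<forall>M. \<exists>m\<ge>M. \<exists>z\<in>resonant d x (129 ^ m). \<bar>x d - z\<bar> \<le> \<rho> m"
    show "x \<in> A"
    proof (rule lower[OF x])
      fix K :: real
      obtain M :: nat where M: "K \<le> 129 ^ M" using real_arch_pow[of 129 K] by (auto intro: less_imp_le)
      obtain m z where m: "max M m0 \<le> m" and z: "z \<in> resonant d x (129 ^ m)" "\<bar>x d - z\<bar> \<le> \<rho> m" using ap by blast
      let ?Q = "129 ^ m :: real"
      obtain p :: int and q :: "nat \<Rightarrow> int" and l :: int where l: "1 \<le> l" "l \<le> int (129 ^ m)" and q: "\<forall>i<d. \<bar>q i\<bar> \<le> int (129 ^ m)"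
        and zd: "z = - (of_int p + (\<Sum>i<d. of_int (q i) * x i)) / of_int l"
        using z(1) unfolding resonant_def by blast
      define k where "k = real ?c * ?Q"
      have Q1: "1 \<le> ?Q" by simp
      have Qk: "?Q \<le> k" unfolding k_def using mult_right_mono[of 1 "real ?c" ?Q] by simp
      have "(129::real) ^ M \<le> ?Q" using m by (intro power_increasing) auto
      then have Kk: "K \<le> k" using M Qk by linarith
      have k0k: "k0 \<le> k" unfolding k_def by (rule big) (use m in simp)
      have \<rho>k: "\<rho> m = \<theta> k" using m by (simp add: \<rho>_def k_def max_absorb1)
      \<comment> \<open>The denominator of the resonant point becomes the coefficient of the last
        coordinate.\<close>
      define q' where "q' = q(d := l)"
      have q'Q: "(real_of_int (q' i))\<^sup>2 \<le> ?Q\<^sup>2" if "i < Suc d" for i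
      proof -
        have "\<bar>q' i\<bar> \<le> int (129 ^ m)" using that q l by (auto simp: q'_def less_Suc_eq)
        then have "real_of_int \<bar>q' i\<bar> \<le> real_of_int (int (129 ^ m))" by (simp only: of_int_le_iff)
        then have "\<bar>real_of_int (q' i)\<bar> \<le> \<bar>?Q\<bar>" by simp
        then show ?thesis by (simp only: abs_le_square_iff)
      qed
      have "(\<Sum>i<Suc d. (real_of_int (q' i))\<^sup>2) \<le> (\<Sum>i<Suc d. ?Q\<^sup>2)" by (intro sum_mono q'Q) simp
      then have s1: "(\<Sum>i<Suc d. (real_of_int (q' i))\<^sup>2) \<le> real (Suc d) * ?Q\<^sup>2" by simp
      have l0: "0 < real_of_int l" using l(1) by simp
      let ?z = "of_int p + (\<Sum>i<Suc d. of_int (q' i) * x i)"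
      have "?z = of_int p + (\<Sum>i<d. of_int (q i) * x i) + of_int l * x d" by (simp add: q'_def)
      also have "\<dots> = of_int l * (x d - z)" using l0 unfolding zd by (simp add: field_simps)
      finally have "\<bar>?z\<bar> = of_int l * \<bar>x d - z\<bar>" using l0 by (simp add: abs_mult)
      also have "\<dots> \<le> ?Q * \<theta> k"
      proof (rule mult_mono)
        have "real_of_int l \<le> real_of_int (int (129 ^ m))" using l(2) by (simp only: of_int_le_iff)
        then show "real_of_int l \<le> ?Q" by simp
      qed (use z(2) \<rho>k in auto)
      finally have "\<bar>?z\<bar> \<le> \<bar>?Q * \<theta> k\<bar>" by linarith
      then have "?z\<^sup>2 \<le> (?Q * \<theta> k)\<^sup>2" by (simp only: abs_le_square_iff)
      then have "1 / (\<theta> k)\<^sup>2 * ?z\<^sup>2 \<le> 1 / (\<theta> k)\<^sup>2 * (?Q * \<theta> k)\<^sup>2" by (intro mult_left_mono) auto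
      also have "\<dots> = ?Q\<^sup>2" using \<theta>pos[OF k0k] by (simp add: power_mult_distrib)
      finally have "(\<Sum>i<Suc d. (real_of_int (q' i))\<^sup>2) + 1 / (\<theta> k)\<^sup>2 * ?z\<^sup>2 \<le> (real (Suc d) + 1) * ?Q\<^sup>2"
        using s1 by (simp only: distrib_right mult_1)
      also have "\<dots> \<le> (real ?c)\<^sup>2 * ?Q\<^sup>2"
      proof (rule mult_right_mono)
        show "real (Suc d) + 1 \<le> (real ?c)\<^sup>2" by (simp add: power2_eq_square algebra_simps)
      qed simp
      also have "\<dots> = k\<^sup>2" by (simp only: k_def power_mult_distrib)
      finally have fin: "(\<Sum>i<Suc d. (real_of_int (q' i))\<^sup>2) + 1 / (\<theta> k)\<^sup>2 * ?z\<^sup>2 \<le> k\<^sup>2" .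
      have "\<exists>i<Suc d. q' i \<noteq> 0" using l(1) by (intro exI[of _ d]) (simp add: q'_def)
      then have "approx_vector (Suc d) x (1 / (\<theta> k)\<^sup>2) (k\<^sup>2)"
        unfolding approx_vector_def using fin by blast
      then show "\<exists>k\<ge>K. k0 \<le> k \<and> approx_vector (Suc d) x (1 / (\<theta> k)\<^sup>2) (k\<^sup>2)" using Kk k0k by blast
    qed
  qed
qed

end

text \<open>Since \<open>ray_eta n * ray_a n = 1 / n\<close>, the term \<open>t / n\<close> in the
  definition of the sets is exactly the factor removed from the orbit form, and only \<phi>
  remains.\<close>

lemma excursion_iff:
  assumes n: "1 \<le> n" and m: "0 < m"
  shows "t / real n - f \<le> - (ray_eta n * ln m) \<longleftrightarrow> m \<le> exp (- (ray_a n * t)) * exp (f / ray_eta n)"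
proof -
  note rc = ray_constants[OF n]
  have n0: "0 < real n" using n by simp
  have an: "ray_eta n * ray_a n = 1 / real n" using rc(4,6) n0 by (simp add: field_simps)
  have "m \<le> exp (- (ray_a n * t)) * exp (f / ray_eta n) \<longleftrightarrow> exp (ln m) \<le> exp (- (ray_a n * t) + f / ray_eta n)"
    using m by (simp only: exp_add exp_ln)
  also have "\<dots> \<longleftrightarrow> ln m \<le> - (ray_a n * t) + f / ray_eta n" by (rule exp_le_cancel_iff)
  also have "\<dots> \<longleftrightarrow> ray_eta n * ln m \<le> ray_eta n * (- (ray_a n * t) + f / ray_eta n)" using rc(3) by simp
  also have "ray_eta n * (- (ray_a n * t) + f / ray_eta n) = - (ray_eta n * ray_a n * t) + f" using rc(3) by (simp add: algebra_simps)
  also have "ray_eta n * ln m \<le> - (ray_eta n * ray_a n * t) + f \<longleftrightarrow> t / real n - f \<le> - (ray_eta n * ln m)"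
    unfolding an by auto
  finally show ?thesis by simp
qed

section \<open>Both sets as limsup sets for one linear form\<close>

lemma R1n_approx:
  assumes n: "1 \<le> n"
  shows "x \<in> R1n n \<phi> \<Longrightarrow> \<exists>t\<ge>T. approx_vector n x (exp (ray_eta n * t)) (2 * exp (\<phi> t / ray_eta n))"
    and "x \<in> Rn n \<Longrightarrow> (\<And>T. \<exists>t\<ge>T. approx_vector n x (exp (ray_eta n * t)) (exp (\<phi> t / ray_eta n))) \<Longrightarrow> x \<in> R1n n \<phi>"
proof -
  have iff: "t / real n - \<phi> t \<le> - busemann (n+1) (rayn n) (pr (n+1) (act (n+1) (ray1 n t) (U1 n x)))
     \<longrightarrow> approx_vector n x (exp (ray_eta n * t)) (2 * exp (\<phi> t / ray_eta n))"
    "approx_vector n x (exp (ray_eta n * t)) (exp (\<phi> t / ray_eta n)) \<longrightarrow>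
      t / real n - \<phi> t \<le> - busemann (n+1) (rayn n) (pr (n+1) (act (n+1) (ray1 n t) (U1 n x)))" for t
    using ray1_orbit_min[OF n, where t = t and x = x] excursion_iff[OF n] by (metis exp_gt_zero)+
  show "\<exists>t\<ge>T. approx_vector n x (exp (ray_eta n * t)) (2 * exp (\<phi> t / ray_eta n))" if "x \<in> R1n n \<phi>"
    using that iff(1) unfolding R1n_def by blast
  show "x \<in> R1n n \<phi>" if "x \<in> Rn n" "\<And>T. \<exists>t\<ge>T. approx_vector n x (exp (ray_eta n * t)) (exp (\<phi> t / ray_eta n))"
    using that iff(2) unfolding R1n_def by blast
qed

lemma Rn1_approx:
  assumes n: "1 \<le> n"
  shows "x \<in> Rn1 n \<phi> \<Longrightarrow> \<exists>t\<ge>T. approx_vector n x (exp (ray_eta n * t)) (2 * exp (\<phi> t / ray_eta n))"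
    and "x \<in> Rn n \<Longrightarrow> (\<And>T. \<exists>t\<ge>T. approx_vector n x (exp (ray_eta n * t)) (exp (\<phi> t / ray_eta n))) \<Longrightarrow> x \<in> Rn1 n \<phi>"
proof -
  have iff: "t / real n - \<phi> t \<le> - busemann (n+1) (ray1 n) (pr (n+1) (act (n+1) (rayn n t) (Ucn n x)))
     \<longrightarrow> approx_vector n x (exp (ray_eta n * t)) (2 * exp (\<phi> t / ray_eta n))"
    "approx_vector n x (exp (ray_eta n * t)) (exp (\<phi> t / ray_eta n)) \<longrightarrow>
      t / real n - \<phi> t \<le> - busemann (n+1) (ray1 n) (pr (n+1) (act (n+1) (rayn n t) (Ucn n x)))" for t
    using rayn_orbit_min[OF n, where t = t and x = x] excursion_iff[OF n] by (metis exp_gt_zero)+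
  show "\<exists>t\<ge>T. approx_vector n x (exp (ray_eta n * t)) (2 * exp (\<phi> t / ray_eta n))" if "x \<in> Rn1 n \<phi>"
    using that iff(1) unfolding Rn1_def by blast
  show "x \<in> Rn1 n \<phi>" if "x \<in> Rn n" "\<And>T. \<exists>t\<ge>T. approx_vector n x (exp (ray_eta n * t)) (exp (\<phi> t / ray_eta n))"
    using that iff(2) unfolding Rn1_def by blast
qed

theorem theorem5p11:
  fixes n :: nat and \<phi> :: "real \<Rightarrow> real" and a b s :: real
  assumes "n \<ge> 1"
    and "bij_betw \<phi> {a..} {b..}"
    and "mono_on {a..} \<phi>"
    and "mono_on {a..} (\<lambda>t. (sqrt ((real n + 1) / real n))\<^sup>2 * t - \<phi> t)"
    and "real n - 1 < s" and "s < real n"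
  defines "\<eta> \<equiv> sqrt ((real n + 1) / real n)"
  defines "g \<equiv> (\<lambda>k::nat. real k ^ n * exp (- (s - real n + 1) * (\<eta> / 2)
                   * the_inv_into {a..} \<phi> (2 * \<eta> * ln (real k))))"
  shows "\<forall>R \<in> {R1n n \<phi>, Rn1 n \<phi>}.
           (summable (\<lambda>k. g (k + 1)) \<longrightarrow> hausdorff_measure (distn n) s R = 0) \<and>
           (\<not> summable (\<lambda>k. g (k + 1)) \<longrightarrow> hausdorff_measure (distn n) s R = \<infinity>)"
proof
  fix R assume R: "R \<in> {R1n n \<phi>, Rn1 n \<phi>}"
  note n = assms(1) and bij = assms(2) and inc = assms(3) and inc' = assms(4)
  have \<eta>: "\<eta> = ray_eta n" by (simp add: \<eta>_def ray_eta_def)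
  have \<eta>0: "0 < \<eta>" using ray_constants(3)[OF n] by (simp add: \<eta>)
  obtain d where d: "n = Suc d" using n by (cases n) auto
  define \<sigma> where "\<sigma> = s - real n + 1"
  have \<sigma>: "0 < \<sigma>" "\<sigma> < 1" "s = \<sigma> + d" using assms(5,6) by (auto simp: \<sigma>_def d)
  note s_eq = \<sigma>(3)
  have inj: "inj_on \<phi> {a..}" using bij by (simp add: bij_betw_def)
  \<comment> \<open>At the time \<open>t = \<tau> k\<close> the weight
    \<open>exp (\<eta> * t)\<close> must be \<open>1 / (\<theta> k)\<^sup>2\<close> and the bound
    \<open>exp (\<phi> t / \<eta>)\<close> must be \<open>k\<^sup>2\<close>; this fixes \<tau> and
    \<theta>.\<close>
  define \<tau> where "\<tau> k = the_inv_into {a..} \<phi> (2 * \<eta> * ln k)" for k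
  define \<theta> where "\<theta> k = exp (- (\<eta> / 2 * \<tau> k))" for k
  \<comment> \<open>From here on \<open>2 * \<eta> * ln k\<close> lies in \<open>{b..}\<close>, the
    range of \<phi>. Smaller heights, where \<open>the_inv_into\<close> is unspecified, concern
    finitely many terms of the series.\<close>
  define k0 where "k0 = max 1 (exp (b / (2 * \<eta>)))"
  have \<tau>: "a \<le> \<tau> k" "\<phi> (\<tau> k) = 2 * \<eta> * ln k" if k: "k0 \<le> k" for k
  proof -
    have "exp (b / (2 * \<eta>)) \<le> k" "0 < k" using k by (auto simp: k0_def)
    then have "b / (2 * \<eta>) \<le> ln k" by (simp add: ln_ge_iff)
    then have "2 * \<eta> * ln k \<in> {b..}" using \<eta>0 by (simp add: field_simps)
    then show "a \<le> \<tau> k" "\<phi> (\<tau> k) = 2 * \<eta> * ln k"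
      using the_inv_into_into[OF inj _ order_refl] f_the_inv_into_f_bij_betw[OF bij] bij by (auto simp: \<tau>_def bij_betw_def)
  qed
  \<comment> \<open>Injectivity lets the increasing \<phi> reflect the order.\<close>
  have strict: "t \<le> t'" if "a \<le> t" "a \<le> t'" "\<phi> t \<le> \<phi> t'" for t t'
  proof (rule ccontr)
    assume "\<not> t \<le> t'"
    then have "\<phi> t' \<le> \<phi> t" using inc that by (auto simp: mono_on_def)
    then have "\<phi> t = \<phi> t'" using that(3) by simp
    then show False using inj that \<open>\<not> t \<le> t'\<close> by (auto simp: inj_on_def)
  qed
  have \<tau>\<phi>: "\<tau> (exp (\<phi> t / (2 * \<eta>))) = t" if "a \<le> t" for t
    unfolding \<tau>_def using \<eta>0 the_inv_into_f_f[OF inj, of t] that by simp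
  have \<Theta>: "1 / (\<theta> k)\<^sup>2 = exp (ray_eta n * \<tau> k)" for k
  proof -
    have "(\<theta> k)\<^sup>2 = exp (- (ray_eta n * \<tau> k))" by (simp add: \<theta>_def \<eta> power2_eq_square exp_add[symmetric])
    then show ?thesis by (simp add: exp_minus inverse_eq_divide)
  qed
  have E: "k\<^sup>2 = exp (\<phi> (\<tau> k) / ray_eta n)" if k: "k0 \<le> k" for k
  proof -
    have "0 < k" using k by (simp add: k0_def)
    then have "k\<^sup>2 = exp (2 * ln k)" by (simp only: exp_double exp_ln)
    then show ?thesis using \<tau>(2)[OF k] \<eta>0 by (simp add: \<eta>)
  qed
  have approx: "\<exists>t\<ge>T. approx_vector n x (exp (ray_eta n * t)) (2 * exp (\<phi> t / ray_eta n))" if "x \<in> R" for x T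
    using R that R1n_approx(1)[OF n] Rn1_approx(1)[OF n] by auto
  have approx': "x \<in> R" if "x \<in> Rn n" "\<And>T. \<exists>t\<ge>T. approx_vector n x (exp (ray_eta n * t)) (exp (\<phi> t / ray_eta n))" for x
    using R that R1n_approx(2)[OF n] Rn1_approx(2)[OF n] by auto
  interpret approximation_rate d \<theta> k0 \<sigma> R
  proof
    show "1 \<le> k0" "0 < \<sigma>" "\<sigma> < 1" using \<sigma> by (auto simp: k0_def)
    show "0 < \<theta> k" for k by (simp add: \<theta>_def)
    show "R \<subseteq> Rn (Suc d)" using R by (auto simp: R1n_def Rn1_def d)
  next
    fix k l assume kl: "k0 \<le> k" "k \<le> l"
    then have k: "0 < k" "0 < l" "k0 \<le> l" by (auto simp: k0_def)
    have "\<phi> (\<tau> k) \<le> \<phi> (\<tau> l)" unfolding \<tau>(2)[OF kl(1)] \<tau>(2)[OF k(3)] using \<eta>0 k kl by simp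
    from strict[OF \<tau>(1)[OF kl(1)] \<tau>(1)[OF k(3)] this] have le: "\<tau> k \<le> \<tau> l" .
    \<comment> \<open>Exhibits \<open>m * \<theta> m\<close> as a decreasing function of \<eta>^2 t
      - \<phi> t at \<open>t = \<tau> m\<close>, where the second monotonicity hypothesis
      applies.\<close>
    have eq: "m * \<theta> m = exp (- ((\<eta>\<^sup>2 * \<tau> m - \<phi> (\<tau> m)) / (2 * \<eta>)))" if m: "k0 \<le> m" for m
    proof -
      have "m = exp (\<phi> (\<tau> m) / (2 * \<eta>))" unfolding \<tau>(2)[OF m] using m \<eta>0 by (simp add: k0_def)
      then have "m * \<theta> m = exp (\<phi> (\<tau> m) / (2 * \<eta>) + - (\<eta> / 2 * \<tau> m))" unfolding exp_add \<theta>_def by simp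
      also have "\<phi> (\<tau> m) / (2 * \<eta>) + - (\<eta> / 2 * \<tau> m) = - ((\<eta>\<^sup>2 * \<tau> m - \<phi> (\<tau> m)) / (2 * \<eta>))"
        using \<eta>0 by (simp add: field_simps power2_eq_square)
      finally show ?thesis .
    qed
    have "\<eta>\<^sup>2 * \<tau> k - \<phi> (\<tau> k) \<le> \<eta>\<^sup>2 * \<tau> l - \<phi> (\<tau> l)"
      using inc' \<tau>(1)[OF kl(1)] \<tau>(1)[OF k(3)] le unfolding mono_on_def \<eta>_def[symmetric] by auto
    then show "l * \<theta> l \<le> k * \<theta> k" unfolding eq[OF kl(1)] eq[OF k(3)] using \<eta>0 by (simp add: divide_right_mono)
  next
    fix x K assume x: "x \<in> R"
    let ?K = "max K k0"
    have K: "k0 \<le> ?K" by simp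
    obtain t where t: "\<tau> ?K \<le> t" "approx_vector n x (exp (ray_eta n * t)) (2 * exp (\<phi> t / ray_eta n))"
      using approx[OF x] by blast
    have at: "a \<le> t" using t(1) \<tau>(1)[OF K] by simp
    define k where "k = exp (\<phi> t / (2 * \<eta>))"
    have "\<phi> (\<tau> ?K) \<le> \<phi> t"
      by (rule mono_onD[OF inc]) (use \<tau>(1)[OF K] at t(1) in simp_all)
    then have "2 * \<eta> * ln ?K \<le> \<phi> t" unfolding \<tau>(2)[OF K] .
    then have "ln ?K \<le> \<phi> t / (2 * \<eta>)" using \<eta>0 by (simp add: field_simps)
    then have "exp (ln ?K) \<le> k" unfolding k_def by (simp only: exp_le_cancel_iff)
    moreover have "0 < ?K" using K by (simp add: k0_def)
    ultimately have Kk: "?K \<le> k" by simp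
    then have kk: "k0 \<le> k" "K \<le> k" by simp_all
    have "\<tau> k = t" unfolding k_def by (rule \<tau>\<phi>[OF at])
    then have "approx_vector (Suc d) x (1 / (\<theta> k)\<^sup>2) (2 * k\<^sup>2)"
      using t(2) unfolding \<Theta> E[OF kk(1)] by (simp add: d)
    then show "\<exists>k\<ge>K. k0 \<le> k \<and> approx_vector (Suc d) x (1 / (\<theta> k)\<^sup>2) (2 * k\<^sup>2)" using kk by blast
  next
    fix x assume x: "x \<in> Rn (Suc d)" and ap: "\<And>K. \<exists>k\<ge>K. k0 \<le> k \<and> approx_vector (Suc d) x (1 / (\<theta> k)\<^sup>2) (k\<^sup>2)"
    show "x \<in> R"
    proof (rule approx')
      show "x \<in> Rn n" using x by (simp add: d)
      fix T
      \<comment> \<open>A height this large has its time beyond \<open>T\<close>; the maximum with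
        \<open>a\<close> keeps the argument of \<phi> in its domain.\<close>
      obtain k where k: "exp (\<phi> (max a T) / (2 * \<eta>)) \<le> k" "k0 \<le> k" "approx_vector (Suc d) x (1 / (\<theta> k)\<^sup>2) (k\<^sup>2)"
        using ap by blast
      have "0 < k" using k(2) by (simp add: k0_def)
      then have "\<phi> (max a T) / (2 * \<eta>) \<le> ln k" using k(1) by (simp add: ln_ge_iff)
      then have "\<phi> (max a T) \<le> \<phi> (\<tau> k)" unfolding \<tau>(2)[OF k(2)] using \<eta>0 by (simp add: field_simps)
      from strict[OF max.cobounded1 \<tau>(1)[OF k(2)] this] have "max a T \<le> \<tau> k" .
      then show "\<exists>t\<ge>T. approx_vector n x (exp (ray_eta n * t)) (exp (\<phi> t / ray_eta n))"
        using k(3) unfolding \<Theta> E[OF k(2)] by (intro exI[of _ "\<tau> k"]) (simp add: d)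
    qed
  qed
  have gF: "g k = F k" for k
  proof -
    have "\<theta> (real k) powr \<sigma> = exp (\<sigma> * - (\<eta> / 2 * \<tau> (real k)))" by (simp add: powr_def \<theta>_def)
    also have "\<sigma> * - (\<eta> / 2 * \<tau> (real k)) = - (s - real n + 1) * (\<eta> / 2) * \<tau> (real k)"
      unfolding \<sigma>_def by (simp only: mult_minus_left mult_minus_right mult.assoc)
    finally show ?thesis by (simp only: g_def \<tau>_def d)
  qed
  have "summable (\<lambda>k. g (k + 1)) \<longleftrightarrow> summable F"
    unfolding gF using summable_iff_shift[of F 1] by simp
  then show "(summable (\<lambda>k. g (k + 1)) \<longrightarrow> hausdorff_measure (distn n) s R = 0) \<and>
           (\<not> summable (\<lambda>k. g (k + 1)) \<longrightarrow> hausdorff_measure (distn n) s R = \<infinity>)"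
    using measure_zero measure_infinite by (simp add: d s_eq)
qed

end
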